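(* Let $s\in(0,1)$, let $\Omega\subset\mathbb{R}^N$ be a bounded open domain with Lipschitz boundary, and let $f\in L^2(\Omega)$. For $\delta>0$ let $u^{\delta,s}\in\mathbb{H}_0^{\delta,s}(\Omega)$ be the weak solution of $$(-\Delta)_\delta^s u=\frac{\delta^{2(1-s)}}{\kappa(N,s)}f\ \text{ in }\Omega,\qquad u=0\ \text{ on }\partial_\delta\Omega,$$ and let $u^{0,1}\in H_0^1(\Omega)$ be the weak solution of $$-\Delta u=f\ \text{ in }\Omega,\qquad u=0\ \text{ on }\partial\Omega .$$ Then, up to a subsequence, $u^{\delta,s}\to u^{0,1}$ in $L^2(\Omega)$ as $\delta\to0^+$; that is, every sequence $\delta_j\to0^+$ has a subsequence along which $u^{\delta_j,s}\to u^{0,1}$ in $L^2(\Omega)$.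
   Context: For $\delta>0$: $\partial_\delta\Omega=\{y\in\mathbb{R}^N\setminus\Omega:\ |x-y|<\delta\text{ for some }x\in\Omega\}$ and $\Omega_\delta=\Omega\cup\partial_\delta\Omega$. Constants: $c_{N,s}=\dfrac{2^{2s}s\,\Gamma(\frac N2+s)}{\pi^{N/2}\Gamma(1-s)}$ and $\kappa(N,s)=\dfrac{4N(1-s)}{\sigma_{N-1}c_{N,s}}$, where $\sigma_{N-1}$ is the surface measure of the unit sphere $\mathbb{S}^{N-1}\subset\mathbb{R}^N$. The operator is $(-\Delta)_\delta^s u(x)=c_{N,s}\,\mathrm{P.V.}\int_{B(x,\delta)}\frac{u(x)-u(y)}{|x-y|^{N+2s}}dy$. The space $\mathbb{H}_0^{\delta,s}(\Omega)$ is the set of $v\in L^2(\Omega_\delta)$ with $v=0$ a.e. on $\partial_\delta\Omega$ and $\int_{\Omega_\delta}\int_{\Omega_\delta\cap B(x,\delta)}\frac{|v(x)-v(y)|^2}{|x-y|^{N+2s}}dydx<\infty$. For $g\in L^2(\Omega)$, a weak solution of $(-\Delta)_\delta^s u=g$ in $\Omega$, $u=0$ on $\partial_\delta\Omega$, is a function $u\in\mathbb{H}_0^{\delta,s}(\Omega)$ such that for all $v\in\mathbb{H}_0^{\delta,s}(\Omega)$ $$\frac{c_{N,s}}{2}\int_{\Omega_\delta}\int_{\Omega_\delta\cap B(x,\delta)}\frac{(u(x)-u(y))(v(x)-v(y))}{|x-y|^{N+2s}}\,dy\,dx=\int_\Omega g v\,dx ;$$ such a solution exists and is unique. *)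

theory Defs
  imports "HOL-Analysis.Analysis"
begin

section \<open>Lipschitz domains and square-integrable functions\<close>

text \<open>
  Near every boundary point the set is, in suitable orthonormal coordinates, the strict epigraph of
  a Lipschitz function. The vertical direction is the unit vector \<open>e\<close>, and the horizontal
  coordinates of \<open>x\<close> are its projection \<open>x - (x \<bullet> e) *\<^sub>R e\<close> onto the hyperplane orthogonal to
  \<open>e\<close>.
\<close>

definition lipschitz_boundary :: "'a::euclidean_space set \<Rightarrow> bool" where
  "lipschitz_boundary \<Omega> \<longleftrightarrow>
     (\<forall>z\<in>frontier \<Omega>. \<exists>r>0. \<exists>e \<gamma> L.
        norm e = 1 \<and> L-lipschitz_on {y. y \<bullet> e = 0} (\<gamma> :: 'a \<Rightarrow> real) \<and>
        \<Omega> \<inter> ball z r = {x \<in> ball z r. \<gamma> (x - (x \<bullet> e) *\<^sub>R e) < x \<bullet> e})"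

definition bounded_lipschitz_domain :: "'a::euclidean_space set \<Rightarrow> bool" where
  "bounded_lipschitz_domain \<Omega> \<longleftrightarrow>
     open \<Omega> \<and> connected \<Omega> \<and> bounded \<Omega> \<and> lipschitz_boundary \<Omega>"

text \<open>
  Elements of \<open>L\<^sup>2(A)\<close> are represented by functions on the whole space; their values outside \<open>A\<close>
  are irrelevant.
\<close>

definition L2 :: "'a::euclidean_space set \<Rightarrow> ('a \<Rightarrow> 'b::euclidean_space) \<Rightarrow> bool" where
  "L2 A f \<longleftrightarrow> f \<in> borel_measurable (lebesgue_on A) \<and>
     integrable (lebesgue_on A) (\<lambda>x. (norm (f x))\<^sup>2)"

text \<open>The following is the norm only for functions satisfying \<^const>\<open>L2\<close>.\<close>

definition L2_norm :: "'a::euclidean_space set \<Rightarrow> ('a \<Rightarrow> 'b::euclidean_space) \<Rightarrow> real" where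
  "L2_norm A f = sqrt (LINT x|lebesgue_on A. (norm (f x))\<^sup>2)"


section \<open>The local problem\<close>

primrec C_k :: "nat \<Rightarrow> ('a::euclidean_space \<Rightarrow> real) \<Rightarrow> bool" where
  "C_k 0 f \<longleftrightarrow> continuous_on UNIV f"
| "C_k (Suc k) f \<longleftrightarrow> f differentiable_on UNIV \<and>
     (\<forall>i\<in>Basis. C_k k (\<lambda>x. frechet_derivative f (at x) i))"

definition test_function :: "'a::euclidean_space set \<Rightarrow> ('a \<Rightarrow> real) \<Rightarrow> bool" where
  "test_function \<Omega> \<phi> \<longleftrightarrow> (\<forall>k. C_k k \<phi>) \<and>
     compact (closure {x. \<phi> x \<noteq> 0}) \<and> closure {x. \<phi> x \<noteq> 0} \<subseteq> \<Omega>"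

definition gradient :: "('a::euclidean_space \<Rightarrow> real) \<Rightarrow> 'a \<Rightarrow> 'a" where
  "gradient \<phi> x = (\<Sum>i\<in>Basis. frechet_derivative \<phi> (at x) i *\<^sub>R i)"

definition weak_gradient ::
    "'a::euclidean_space set \<Rightarrow> ('a \<Rightarrow> real) \<Rightarrow> ('a \<Rightarrow> 'a) \<Rightarrow> bool" where
  "weak_gradient \<Omega> u G \<longleftrightarrow> L2 \<Omega> u \<and> L2 \<Omega> G \<and>
     (\<forall>\<phi>. test_function \<Omega> \<phi> \<longrightarrow>
        (\<forall>i\<in>Basis. (LINT x|lebesgue_on \<Omega>. u x * frechet_derivative \<phi> (at x) i)
                  = - (LINT x|lebesgue_on \<Omega>. (G x \<bullet> i) * \<phi> x)))"

text \<open>\<open>H\<^sub>0\<^sup>1(\<Omega>)\<close> is the closure of the test functions in \<open>H\<^sup>1(\<Omega>)\<close>.\<close>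

definition H10 :: "'a::euclidean_space set \<Rightarrow> ('a \<Rightarrow> real) set" where
  "H10 \<Omega> = {u. \<exists>G. weak_gradient \<Omega> u G \<and>
     (\<exists>\<phi>. (\<forall>n. test_function \<Omega> (\<phi> n)) \<and>
        (\<lambda>n::nat. L2_norm \<Omega> (\<lambda>x. \<phi> n x - u x)) \<longlonglongrightarrow> 0 \<and>
        (\<lambda>n. L2_norm \<Omega> (\<lambda>x. gradient (\<phi> n) x - G x)) \<longlonglongrightarrow> 0)}"

definition local_weak_solution ::
    "'a::euclidean_space set \<Rightarrow> ('a \<Rightarrow> real) \<Rightarrow> ('a \<Rightarrow> real) \<Rightarrow> bool" where
  "local_weak_solution \<Omega> f u \<longleftrightarrow> u \<in> H10 \<Omega> \<and>
     (\<exists>U. weak_gradient \<Omega> u U \<and>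
        (\<forall>v\<in>H10 \<Omega>. \<forall>V. weak_gradient \<Omega> v V \<longrightarrow>
           (LINT x|lebesgue_on \<Omega>. U x \<bullet> V x) = (LINT x|lebesgue_on \<Omega>. f x * v x)))"


section \<open>The finite-horizon fractional problem\<close>

text \<open>
  The surface measure of a subset of the unit sphere is \<open>N\<close> times the volume of the cone over it
  with apex at the origin (integration in polar coordinates).
\<close>

definition sphere_surface_measure :: "'a::euclidean_space set \<Rightarrow> real" where
  "sphere_surface_measure A =
     real DIM('a) * measure lebesgue {r *\<^sub>R x | r x. 0 < r \<and> r \<le> 1 \<and> x \<in> A}"

lemma sphere_surface_measure_sphere:
  "sphere_surface_measure (sphere (0::'a::euclidean_space) 1) =
     2 * pi powr (real DIM('a) / 2) / Gamma (real DIM('a) / 2)"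
proof -
  have "{r *\<^sub>R x | r x. 0 < r \<and> r \<le> 1 \<and> x \<in> sphere (0::'a) 1} = cball 0 1 - {0}" (is "?C = ?B")
  proof (intro set_eqI iffI)
    fix y :: 'a
    assume "y \<in> ?B"
    then have "y = norm y *\<^sub>R (y /\<^sub>R norm y) \<and> 0 < norm y \<and> norm y \<le> 1 \<and> y /\<^sub>R norm y \<in> sphere 0 1"
      by simp
    then show "y \<in> ?C"
      by blast
  next
    fix y :: 'a
    assume "y \<in> ?C"
    then show "y \<in> ?B"
      by fastforce
  qed
  moreover have "measure lebesgue ?B = measure lebesgue (cball (0::'a) 1)"
    by (rule measure_Diff_null_set) auto
  moreover have "measure lebesgue (cball (0::'a) 1) = unit_ball_vol (real DIM('a))"
    using content_cball[of 1 "0::'a"] by simp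
  ultimately have eq: "sphere_surface_measure (sphere (0::'a) 1) =
      real DIM('a) * unit_ball_vol (real DIM('a))"
    by (simp only: sphere_surface_measure_def)
  define z where "z = real DIM('a) / 2"
  have z: "z > 0" and dim: "real DIM('a) = 2 * z"
    by (simp_all add: z_def)
  have "Gamma (z + 1) = z * Gamma z"
    using z by (intro Gamma_plus1) (auto dest: nonpos_Ints_nonpos)
  then show ?thesis
    unfolding eq unit_ball_vol_def dim using z by simp
qed

definition c_const :: "nat \<Rightarrow> real \<Rightarrow> real" where
  "c_const N s = 2 powr (2 * s) * s * Gamma (real N / 2 + s) /
     (pi powr (real N / 2) * Gamma (1 - s))"

definition kappa_const :: "'a::euclidean_space itself \<Rightarrow> real \<Rightarrow> real" where
  "kappa_const _ s = 4 * real DIM('a) * (1 - s) /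
     (sphere_surface_measure (sphere (0::'a) 1) * c_const DIM('a) s)"

definition nonlocal_boundary :: "real \<Rightarrow> 'a::euclidean_space set \<Rightarrow> 'a set" where
  "nonlocal_boundary \<delta> \<Omega> = {y. y \<notin> \<Omega> \<and> (\<exists>x\<in>\<Omega>. norm (x - y) < \<delta>)}"

definition nonlocal_closure :: "real \<Rightarrow> 'a::euclidean_space set \<Rightarrow> 'a set" where
  "nonlocal_closure \<delta> \<Omega> = \<Omega> \<union> nonlocal_boundary \<delta> \<Omega>"

definition nonlocal_energy ::
    "real \<Rightarrow> real \<Rightarrow> 'a::euclidean_space set \<Rightarrow> ('a \<Rightarrow> real) \<Rightarrow> ennreal" where
  "nonlocal_energy \<delta> s \<Omega> v =
     (\<integral>\<^sup>+ x. (\<integral>\<^sup>+ y. ennreal (\<bar>v x - v y\<bar>\<^sup>2 / norm (x - y) powr (real DIM('a) + 2 * s))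
        \<partial>(lebesgue_on (nonlocal_closure \<delta> \<Omega> \<inter> ball x \<delta>))) \<partial>(lebesgue_on (nonlocal_closure \<delta> \<Omega>)))"

definition nonlocal_H0 ::
    "real \<Rightarrow> real \<Rightarrow> 'a::euclidean_space set \<Rightarrow> ('a \<Rightarrow> real) set" where
  "nonlocal_H0 \<delta> s \<Omega> = {v. L2 (nonlocal_closure \<delta> \<Omega>) v \<and>
     (AE x in lebesgue_on (nonlocal_boundary \<delta> \<Omega>). v x = 0) \<and>
     nonlocal_energy \<delta> s \<Omega> v < \<infinity>}"

definition nonlocal_form ::
    "real \<Rightarrow> real \<Rightarrow> 'a::euclidean_space set \<Rightarrow> ('a \<Rightarrow> real) \<Rightarrow> ('a \<Rightarrow> real) \<Rightarrow> real" where
  "nonlocal_form \<delta> s \<Omega> u v = c_const DIM('a) s / 2 *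
     (LINT x|lebesgue_on (nonlocal_closure \<delta> \<Omega>).
       (LINT y|lebesgue_on (nonlocal_closure \<delta> \<Omega> \<inter> ball x \<delta>).
         (u x - u y) * (v x - v y) / norm (x - y) powr (real DIM('a) + 2 * s)))"

definition nonlocal_weak_solution ::
    "real \<Rightarrow> real \<Rightarrow> 'a::euclidean_space set \<Rightarrow> ('a \<Rightarrow> real) \<Rightarrow> ('a \<Rightarrow> real) \<Rightarrow> bool" where
  "nonlocal_weak_solution \<delta> s \<Omega> g u \<longleftrightarrow> u \<in> nonlocal_H0 \<delta> s \<Omega> \<and>
     (\<forall>v\<in>nonlocal_H0 \<delta> s \<Omega>.
        nonlocal_form \<delta> s \<Omega> u v = (LINT x|lebesgue_on \<Omega>. g x * v x))"

end

theory Submission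
  imports Defs
begin

text \<open>
  Functions vanishing outside the domain are extended by zero; the nonlocal problem then becomes
  \<open>E\<^sub>\<delta>(u, v) = \<integral> f v\<close> for all admissible \<open>v\<close>, where
  \<open>E\<^sub>\<delta>(v, w) = \<integral> \<integral> \<rho>\<^sub>\<delta>(z) (v(x + z) - v(x)) (w(x + z) - w(x)) dz dx\<close> and the truncated
  fractional kernel \<open>\<rho>\<^sub>\<delta>\<close> is normalized by \<open>\<integral> \<rho>\<^sub>\<delta>(z) (a \<bullet> z) (b \<bullet> z) dz = a \<bullet> b\<close>. No compactness theorem
  is used. Telescoping along multiples of \<open>z\<close> gives a Poincare inequality for \<open>E\<^sub>\<delta>\<close> with a constant
  independent of \<open>\<delta>\<close>, so it suffices to make
  \<open>E\<^sub>\<delta>(u\<^sub>\<delta> - \<psi>, u\<^sub>\<delta> - \<psi>) = \<integral> f u\<^sub>\<delta> - 2 \<integral> f \<psi> + E\<^sub>\<delta>(\<psi>, \<psi>)\<close> small for a test function \<open>\<psi>\<close> close to the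
  local solution in \<open>H\<^sub>0\<^sup>1\<close>. The only point is that \<open>\<integral> f u\<^sub>\<delta>\<close> is asymptotically close to
  \<open>\<integral> f \<psi> = E\<^sub>\<delta>(\<psi>, u\<^sub>\<delta>)\<close>. To see this, cut \<open>u\<^sub>\<delta>\<close> into pieces near the Lipschitz boundary, push each piece into the domain
  and mollify it: the result \<open>\<phi>\<close> is an admissible test function of the local problem, so that
  \<open>\<integral> f \<phi> - \<integral> \<nabla>\<psi> \<bullet> \<nabla>\<phi> = \<integral> (G - \<nabla>\<psi>) \<bullet> \<nabla>\<phi>\<close>, where \<open>G\<close> is the gradient of the local solution and \<open>\<nabla>\<phi>\<close> is
  bounded in \<open>L\<^sup>2\<close> because averaging does not increase \<open>E\<^sub>\<delta>\<close>.
\<close>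

text \<open>The functions u_\<delta> need not have a gradient, so they cannot be inserted into the
  local problem, and the energy sees only increments shorter than \<delta>. The remedy is an order
  of choices: the test function \<psi>, the inward shifts and the mollifiers are fixed first, and
  only then does \<delta> tend to 0. Mollification at a fixed scale has regularity constants that
  depend on the mollified function only through its \<open>L^1\<close> norm, hence uniform in
  \<delta>, and for functions with uniform second-order bounds the energy and the Dirichlet form
  differ by O(\<delta>). The error of mollification is transferred to f and \<psi>, which do not
  move with \<delta>, so it is governed by the continuity of translations of these two. Closeness is
  stated as an estimate with a constant independent of \<psi> and additive in the tested function;
  this permits a partition into finitely many pieces, each pushed in its own direction. The given
  constants enter once: \<open>kappa_const\<close> is exactly the factor that turns the equation
  into the one for the normalized kernel.\<close>

section \<open>Square-integrable functions over an arbitrary measure\<close>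

definition sq_int :: "'m measure \<Rightarrow> ('m \<Rightarrow> 'b::euclidean_space) \<Rightarrow> bool" where
  "sq_int M f \<longleftrightarrow> f \<in> borel_measurable M \<and> integrable M (\<lambda>x. (norm (f x))\<^sup>2)"

text \<open>The measure is a parameter because the same calculus serves
  \<open>lebesgue_on \<Omega>\<close>, \<open>lborel\<close> on points, and \<open>lborel\<close> on
  pairs of points, where the energy is such a norm.\<close>

definition nrm :: "'m measure \<Rightarrow> ('m \<Rightarrow> 'b::euclidean_space) \<Rightarrow> real" where
  "nrm M f = sqrt (LINT x|M. (norm (f x))\<^sup>2)"

lemma L2_iff_sq_int: "L2 A f \<longleftrightarrow> sq_int (lebesgue_on A) f"
  by (simp add: L2_def sq_int_def)

lemma L2_norm_eq_nrm: "L2_norm A f = nrm (lebesgue_on A) f"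
  by (simp add: L2_norm_def nrm_def)

lemma nrm_nonneg [simp]: "0 \<le> nrm M f"
  by (simp add: nrm_def)

lemma nrm_power2: "(nrm M f)\<^sup>2 = (LINT x|M. (norm (f x))\<^sup>2)"
  by (simp add: nrm_def)

lemma sq_int_measurable: "sq_int M f \<Longrightarrow> f \<in> borel_measurable M"
  by (simp add: sq_int_def)

lemma sq_int_bound:
  fixes f :: "'m \<Rightarrow> 'b::euclidean_space"
  assumes "f \<in> borel_measurable M" "integrable M g" "\<And>x. x \<in> space M \<Longrightarrow> (norm (f x))\<^sup>2 \<le> g x"
  shows "sq_int M f"
  unfolding sq_int_def
proof (intro conjI Bochner_Integration.integrable_bound[OF assms(2)])
  show "AE x in M. norm ((norm (f x))\<^sup>2) \<le> norm (g x)"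
    using assms(3) by (intro AE_I2) (smt (verit) real_norm_def zero_le_power2)
qed (use assms(1) in measurable)

lemma sq_int_minus: "sq_int M f \<Longrightarrow> sq_int M (\<lambda>x. - f x)"
  by (simp add: sq_int_def)

lemma norm_add_sq_le: "(norm (a + b :: 'b::real_normed_vector))\<^sup>2 \<le> 2 * (norm a)\<^sup>2 + 2 * (norm b)\<^sup>2"
proof -
  have "(norm (a + b))\<^sup>2 \<le> (norm a + norm b)\<^sup>2"
    by (intro power_mono norm_triangle_ineq) auto
  also have "\<dots> \<le> 2 * (norm a)\<^sup>2 + 2 * (norm b)\<^sup>2"
    using sum_squares_bound[of "norm a" "norm b"] by (simp add: power2_sum)
  finally show ?thesis .
qed

lemma sq_int_add: "sq_int M f \<Longrightarrow> sq_int M g \<Longrightarrow> sq_int M (\<lambda>x. f x + g x)"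
  by (rule sq_int_bound[where g = "\<lambda>x. 2 * (norm (f x))\<^sup>2 + 2 * (norm (g x))\<^sup>2"])
     (auto simp: sq_int_def norm_add_sq_le)

lemma sq_int_diff: "sq_int M f \<Longrightarrow> sq_int M g \<Longrightarrow> sq_int M (\<lambda>x. f x - g x)"
  using sq_int_add[of M f "\<lambda>x. - g x"] sq_int_minus[of M g] by simp

lemma sq_int_cong_AE:
  "sq_int M f \<Longrightarrow> g \<in> borel_measurable M \<Longrightarrow> AE x in M. f x = g x \<Longrightarrow> sq_int M g"
  unfolding sq_int_def
  by (auto elim!: integrable_cong_AE_imp simp: AE_conj_iff)

lemma integrable_inner_sq_int:
  assumes "sq_int M f" "sq_int M g"
  shows "integrable M (\<lambda>x. f x \<bullet> g x)"
proof (rule Bochner_Integration.integrable_bound)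
  show "integrable M (\<lambda>x. (norm (f x))\<^sup>2 + (norm (g x))\<^sup>2)"
    using assms by (simp add: sq_int_def)
  have "\<bar>f x \<bullet> g x\<bar> \<le> (norm (f x))\<^sup>2 + (norm (g x))\<^sup>2" for x
    using Cauchy_Schwarz_ineq2[of "f x" "g x"] sum_squares_bound[of "norm (f x)" "norm (g x)"]
      zero_le_power2[of "norm (f x)"] zero_le_power2[of "norm (g x)"] 
      mult_nonneg_nonneg[OF norm_ge_zero[of "f x"] norm_ge_zero[of "g x"]] by linarith
  then show "AE x in M. norm (f x \<bullet> g x) \<le> norm ((norm (f x))\<^sup>2 + (norm (g x))\<^sup>2)"
    by (intro AE_I2) simp
qed (use assms in \<open>auto simp: sq_int_def\<close>)

lemma integrable_mult_sq_int:
  fixes f g :: "'m \<Rightarrow> real"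
  assumes "sq_int M f" "sq_int M g"
  shows "integrable M (\<lambda>x. f x * g x)"
  using integrable_inner_sq_int[OF assms] by simp

lemma nrm_add_power2:
  assumes "sq_int M f" "sq_int M g"
  shows "(nrm M (\<lambda>x. f x + g x))\<^sup>2 = (nrm M f)\<^sup>2 + 2 * (LINT x|M. f x \<bullet> g x) + (nrm M g)\<^sup>2"
proof -
  have "(norm (f x + g x))\<^sup>2 = (norm (f x))\<^sup>2 + 2 * (f x \<bullet> g x) + (norm (g x))\<^sup>2" for x
    by (simp add: power2_norm_eq_inner inner_add_left inner_add_right inner_commute)
  then show ?thesis
    using assms integrable_inner_sq_int[OF assms] by (simp add: nrm_power2 sq_int_def)
qed

text \<open>The squared norm of \<open>t *\<^sub>R f + g\<close> is a quadratic in \<open>t\<close>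
  that is never negative; its discriminant gives the bound.\<close>

lemma Cauchy_Schwarz_integral:
  assumes f: "sq_int M f" and g: "sq_int M g"
  shows "\<bar>LINT x|M. f x \<bullet> g x\<bar> \<le> nrm M f * nrm M g"
proof -
  define a b c where "a = (nrm M f)\<^sup>2" "b = (nrm M g)\<^sup>2" "c = (LINT x|M. f x \<bullet> g x)"
  have pos: "0 \<le> a * t\<^sup>2 + 2 * c * t + b" for t
  proof -
    have tf: "sq_int M (\<lambda>x. t *\<^sub>R f x)"
      using f by (auto simp: sq_int_def power_mult_distrib)
    have "0 \<le> (nrm M (\<lambda>x. t *\<^sub>R f x + g x))\<^sup>2"
      by simp
    also have "\<dots> = a * t\<^sup>2 + 2 * c * t + b"
      unfolding nrm_add_power2[OF tf g] a_b_c_def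
      by (simp add: nrm_power2 power_mult_distrib mult_ac)
    finally show ?thesis .
  qed
  have "0 \<le> a" "0 \<le> b"
    by (simp_all add: a_b_c_def)
  have "c\<^sup>2 \<le> a * b"
  proof (cases "a = 0")
    case True
    have "c = 0"
    proof (rule ccontr)
      assume "c \<noteq> 0"
      \<comment> \<open>At this \<open>t\<close> the affine function \<open>2 * c * t + b\<close>
        equals -1.\<close>
      then show False
        using pos[of "- (b + 1) / (2 * c)"] True by simp
    qed
    then show ?thesis
      using \<open>0 \<le> a\<close> \<open>0 \<le> b\<close> by simp
  next
    case False
    with \<open>0 \<le> a\<close> have "0 < a" by simp
    then show ?thesis
      using pos[of "- c / a"] by (simp add: field_simps power2_eq_square)
  qed
  then have "\<bar>c\<bar>\<^sup>2 \<le> (nrm M f * nrm M g)\<^sup>2"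
    by (simp add: a_b_c_def power_mult_distrib)
  then show ?thesis
    unfolding a_b_c_def(3) by (rule power2_le_imp_le) simp
qed

lemma nrm_triangle:
  assumes "sq_int M f" "sq_int M g"
  shows "nrm M (\<lambda>x. f x + g x) \<le> nrm M f + nrm M g"
proof (rule power2_le_imp_le)
  show "(nrm M (\<lambda>x. f x + g x))\<^sup>2 \<le> (nrm M f + nrm M g)\<^sup>2"
    using Cauchy_Schwarz_integral[OF assms] nrm_add_power2[OF assms] by (simp add: power2_sum)
qed simp

lemma nrm_minus_commute: "nrm M (\<lambda>x. f x - g x) = nrm M (\<lambda>x. g x - f x)"
  by (simp add: nrm_def norm_minus_commute)

lemma nrm_triangle_diff:
  assumes "sq_int M f" "sq_int M g" "sq_int M h"
  shows "nrm M (\<lambda>x. f x - h x) \<le> nrm M (\<lambda>x. f x - g x) + nrm M (\<lambda>x. g x - h x)"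
  using nrm_triangle[OF sq_int_diff[OF assms(1,2)] sq_int_diff[OF assms(2,3)]] by simp

lemma nrm_diff_le:
  assumes "sq_int M f" "sq_int M g"
  shows "nrm M f \<le> nrm M (\<lambda>x. f x - g x) + nrm M g"
  using nrm_triangle[OF sq_int_diff[OF assms] assms(2)] by simp

lemma nrm_cong_AE:
  assumes "f \<in> borel_measurable M" "g \<in> borel_measurable M" "AE x in M. f x = g x"
  shows "nrm M f = nrm M g"
proof -
  have "(LINT x|M. (norm (f x))\<^sup>2) = (LINT x|M. (norm (g x))\<^sup>2)"
    using assms by (intro integral_cong_AE) (auto simp: AE_conj_iff)
  then show ?thesis by (simp add: nrm_def)
qed

lemma nrm_mono:
  fixes f :: "'m \<Rightarrow> 'b::euclidean_space" and g :: "'m \<Rightarrow> 'c::euclidean_space"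
  assumes "sq_int M f" "sq_int M g" "\<And>x. x \<in> space M \<Longrightarrow> norm (f x) \<le> norm (g x)"
  shows "nrm M f \<le> nrm M g"
  unfolding nrm_def using assms by (intro real_sqrt_le_mono integral_mono) (auto simp: sq_int_def power_mono)

subsection \<open>Translations\<close>

lemma lborel_translate:
  fixes f :: "'a::euclidean_space \<Rightarrow> 'b::{banach, second_countable_topology}"
  assumes [measurable]: "f \<in> borel_measurable borel"
  shows "integrable lborel (\<lambda>x. f (x + h)) = integrable lborel f"
    and "(LINT x|lborel. f (x + h)) = (LINT x|lborel. f x)"
proof -
  have eq: "distr lborel borel ((+) h) = lborel"
    by (rule lborel_distr_plus)
  show "integrable lborel (\<lambda>x. f (x + h)) = integrable lborel f"
    by (subst (2) eq[symmetric], subst integrable_distr_eq) (auto simp: add.commute)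
  show "(LINT x|lborel. f (x + h)) = (LINT x|lborel. f x)"
    by (subst (2) eq[symmetric], subst integral_distr) (auto simp: add.commute)
qed

lemma nn_integral_lborel_translate:
  fixes f :: "'a::euclidean_space \<Rightarrow> ennreal"
  assumes [measurable]: "f \<in> borel_measurable borel"
  shows "(\<integral>\<^sup>+x. f (x + h) \<partial>lborel) = (\<integral>\<^sup>+x. f x \<partial>lborel)"
proof -
  have eq: "distr lborel borel ((+) h) = lborel"
    by (rule lborel_distr_plus)
  show ?thesis
    by (subst (2) eq[symmetric], subst nn_integral_distr) (auto simp: add.commute)
qed

lemma sq_int_translate:
  fixes f :: "'a::euclidean_space \<Rightarrow> 'b::euclidean_space"
  assumes "sq_int lborel f"
  shows "sq_int lborel (\<lambda>x. f (x + h))"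
proof -
  have [measurable]: "f \<in> borel_measurable borel"
    using assms by (simp add: sq_int_def)
  show ?thesis
    using assms lborel_translate(1)[of "\<lambda>x. (norm (f x))\<^sup>2" h] by (simp add: sq_int_def)
qed

lemma nrm_translate:
  fixes f :: "'a::euclidean_space \<Rightarrow> 'b::euclidean_space"
  assumes "f \<in> borel_measurable borel"
  shows "nrm lborel (\<lambda>x. f (x + h)) = nrm lborel f"
  using lborel_translate(2)[of "\<lambda>x. (norm (f x))\<^sup>2" h] assms by (simp add: nrm_def)

subsection \<open>Kernels\<close>

text \<open>The last clause says that the matrix of second moments is the identity.
  \<open>\<rho>\<close> itself may fail to be integrable at the origin, as the fractional kernel
  does for positive \<open>s\<close>; only the second moments are finite, so increments must supply
  a factor \<open>(norm z)\<^sup>2\<close>.\<close>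

definition kernel :: "('a::euclidean_space \<Rightarrow> real) \<Rightarrow> real \<Rightarrow> bool" where
  "kernel \<rho> \<delta> \<longleftrightarrow> \<rho> \<in> borel_measurable borel \<and> (\<forall>z. 0 \<le> \<rho> z) \<and> (\<forall>z. \<delta> \<le> norm z \<longrightarrow> \<rho> z = 0) \<and>
     (\<forall>a b. integrable lborel (\<lambda>z. \<rho> z * ((a \<bullet> z) * (b \<bullet> z))) \<and>
        (LINT z|lborel. \<rho> z * ((a \<bullet> z) * (b \<bullet> z))) = a \<bullet> b)"

text \<open>A pair consists of a base point and an increment. Giving each factor the square root of
  the kernel makes \<open>energy_form\<close> an \<open>L^2\<close> inner product on pairs, so that
  Cauchy-Schwarz and averaging apply to it directly.\<close>

definition diffq :: "('a::euclidean_space \<Rightarrow> real) \<Rightarrow> ('a \<Rightarrow> real) \<Rightarrow> 'a \<times> 'a \<Rightarrow> real" where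
  "diffq \<rho> w p = sqrt (\<rho> (snd p)) * (w (fst p + snd p) - w (fst p))"

definition energy_form :: "('a::euclidean_space \<Rightarrow> real) \<Rightarrow> ('a \<Rightarrow> real) \<Rightarrow> ('a \<Rightarrow> real) \<Rightarrow> real" where
  "energy_form \<rho> v w = (LINT p|lborel. diffq \<rho> v p * diffq \<rho> w p)"

lemma kernel_nonneg: "kernel \<rho> \<delta> \<Longrightarrow> 0 \<le> \<rho> z"
  by (simp add: kernel_def)

lemma kernel_eq_0: "kernel \<rho> \<delta> \<Longrightarrow> \<delta> \<le> norm z \<Longrightarrow> \<rho> z = 0"
  by (simp add: kernel_def)

lemma kernel_measurable: "kernel \<rho> \<delta> \<Longrightarrow> \<rho> \<in> borel_measurable borel"
  by (simp add: kernel_def)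

text \<open>Summing the diagonal second moments over \<open>Basis\<close> gives the trace of the
  identity.\<close>

lemma
  fixes \<rho> :: "'a::euclidean_space \<Rightarrow> real"
  assumes "kernel \<rho> \<delta>"
  shows kernel_integrable: "integrable lborel (\<lambda>z. \<rho> z * (norm z)\<^sup>2)"
    and kernel_integral: "(LINT z|lborel. \<rho> z * (norm z)\<^sup>2) = DIM('a)"
proof -
  have eq: "(\<lambda>z. \<rho> z * (norm z)\<^sup>2) = (\<lambda>z. \<Sum>b\<in>Basis. \<rho> z * ((b \<bullet> z) * (b \<bullet> z)))"
    unfolding power2_norm_eq_inner
    by (subst euclidean_inner) (simp add: sum_distrib_left inner_commute)
  show "integrable lborel (\<lambda>z. \<rho> z * (norm z)\<^sup>2)"
    unfolding eq using assms by (intro Bochner_Integration.integrable_sum) (simp add: kernel_def)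
  show "(LINT z|lborel. \<rho> z * (norm z)\<^sup>2) = DIM('a)"
    unfolding eq using assms by (subst Bochner_Integration.integral_sum) (auto simp: kernel_def)
qed

lemma measurable_fst_borel [measurable]:
  "fst \<in> borel_measurable (borel :: ('a::euclidean_space \<times> 'b::euclidean_space) measure)"
  by (intro borel_measurable_continuous_onI continuous_on_fst continuous_on_id)

lemma measurable_snd_borel [measurable]:
  "snd \<in> borel_measurable (borel :: ('a::euclidean_space \<times> 'b::euclidean_space) measure)"
  by (intro borel_measurable_continuous_onI continuous_on_snd continuous_on_id)

lemma diffq_measurable [measurable]:
  assumes [measurable]: "\<rho> \<in> borel_measurable borel" "w \<in> borel_measurable borel"
  shows "diffq \<rho> w \<in> borel_measurable borel"
  unfolding diffq_def[abs_def] by measurable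

lemma diffq_add: "diffq \<rho> (\<lambda>x. v x + w x) p = diffq \<rho> v p + diffq \<rho> w p"
  by (simp add: diffq_def algebra_simps)

lemma diffq_diff: "diffq \<rho> (\<lambda>x. v x - w x) p = diffq \<rho> v p - diffq \<rho> w p"
  by (simp add: diffq_def algebra_simps)

lemma energy_form_commute: "energy_form \<rho> v w = energy_form \<rho> w v"
  by (simp add: energy_form_def mult.commute)

lemma energy_form_self: "energy_form \<rho> v v = (nrm lborel (diffq \<rho> v))\<^sup>2"
  unfolding nrm_power2 by (simp add: energy_form_def power2_eq_square)

lemma energy_form_Cauchy_Schwarz:
  assumes "sq_int lborel (diffq \<rho> v)" "sq_int lborel (diffq \<rho> w)"
  shows "\<bar>energy_form \<rho> v w\<bar> \<le> nrm lborel (diffq \<rho> v) * nrm lborel (diffq \<rho> w)"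
  using Cauchy_Schwarz_integral[OF assms] by (simp add: energy_form_def)

lemma energy_form_add_right:
  assumes "sq_int lborel (diffq \<rho> u)" "sq_int lborel (diffq \<rho> v)" "sq_int lborel (diffq \<rho> w)"
  shows "energy_form \<rho> u (\<lambda>x. v x + w x) = energy_form \<rho> u v + energy_form \<rho> u w"
  unfolding energy_form_def diffq_add
  using integrable_mult_sq_int[OF assms(1,2)] integrable_mult_sq_int[OF assms(1,3)]
  by (simp add: distrib_left)

lemma energy_form_diff_right:
  assumes "sq_int lborel (diffq \<rho> u)" "sq_int lborel (diffq \<rho> v)" "sq_int lborel (diffq \<rho> w)"
  shows "energy_form \<rho> u (\<lambda>x. v x - w x) = energy_form \<rho> u v - energy_form \<rho> u w"
  unfolding energy_form_def diffq_diff
  using integrable_mult_sq_int[OF assms(1,2)] integrable_mult_sq_int[OF assms(1,3)]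
  by (simp add: right_diff_distrib)

lemma sq_int_diffq_diff:
  "sq_int lborel (diffq \<rho> v) \<Longrightarrow> sq_int lborel (diffq \<rho> w) \<Longrightarrow> sq_int lborel (diffq \<rho> (\<lambda>x. v x - w x))"
  using sq_int_diff[of lborel "diffq \<rho> v" "diffq \<rho> w"] by (simp add: diffq_diff[abs_def])

subsection \<open>Product integrals\<close>

lemma
  fixes f :: "'a::euclidean_space \<times> 'b::euclidean_space \<Rightarrow> real"
  assumes "integrable lborel f"
  shows integral_lborel_fst: "(LINT p|lborel. f p) = (LINT x|lborel. LINT z|lborel. f (x, z))"
    and integral_lborel_snd: "(LINT p|lborel. f p) = (LINT z|lborel. LINT x|lborel. f (x, z))"
    and integrable_lborel_snd: "integrable lborel (\<lambda>z. LINT x|lborel. f (x, z))"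
proof -
  have f: "integrable (lborel \<Otimes>\<^sub>M lborel) f"
    using assms by (simp add: lborel_prod)
  have f': "integrable (lborel \<Otimes>\<^sub>M lborel) (case_prod (\<lambda>x z. f (x, z)))"
    using f by simp
  show "(LINT p|lborel. f p) = (LINT x|lborel. LINT z|lborel. f (x, z))"
    using lborel_pair.integral_fst'[OF f] by (simp add: lborel_prod)
  show "(LINT p|lborel. f p) = (LINT z|lborel. LINT x|lborel. f (x, z))"
    using lborel_pair.integral_snd[OF f'] by (simp add: lborel_prod)
  show "integrable lborel (\<lambda>z. LINT x|lborel. f (x, z))"
    using lborel_pair.integrable_snd[OF f'] by simp
qed

lemma nn_integral_lborel_fst:
  fixes f :: "'a::euclidean_space \<times> 'b::euclidean_space \<Rightarrow> ennreal"
  assumes "f \<in> borel_measurable borel"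
  shows "(\<integral>\<^sup>+p. f p \<partial>lborel) = (\<integral>\<^sup>+x. \<integral>\<^sup>+z. f (x, z) \<partial>lborel \<partial>lborel)"
  using lborel.nn_integral_fst[of f lborel] assms by (simp add: lborel_prod)

lemma
  fixes f :: "'a::euclidean_space \<Rightarrow> real" and g :: "'b::euclidean_space \<Rightarrow> real"
  assumes f: "integrable lborel f" and g: "integrable lborel g"
  shows integrable_lborel_product: "integrable lborel (\<lambda>p. f (fst p) * g (snd p))"
    and integral_lborel_product:
      "(LINT p|lborel. f (fst p) * g (snd p)) = (LINT x|lborel. f x) * (LINT z|lborel. g z)"
proof -
  have [measurable]: "f \<in> borel_measurable borel" "g \<in> borel_measurable borel"
    using f g by auto
  show *: "integrable lborel (\<lambda>p. f (fst p) * g (snd p))"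
  proof (rule integrableI_bounded)
    have "(\<integral>\<^sup>+p. ennreal (norm (f (fst p) * g (snd p))) \<partial>lborel) =
        (\<integral>\<^sup>+x. \<integral>\<^sup>+z. ennreal (norm (f x)) * ennreal (norm (g z)) \<partial>lborel \<partial>lborel)"
      by (subst nn_integral_lborel_fst) (auto simp: abs_mult ennreal_mult)
    also have "\<dots> = (\<integral>\<^sup>+x. ennreal (norm (f x)) \<partial>lborel) * (\<integral>\<^sup>+z. ennreal (norm (g z)) \<partial>lborel)"
      by (simp add: nn_integral_cmult nn_integral_multc)
    also have "\<dots> < \<infinity>"
      using f g by (auto simp: integrable_iff_bounded ennreal_mult_less_top)
    finally show "(\<integral>\<^sup>+p. ennreal (norm (f (fst p) * g (snd p))) \<partial>lborel) < \<infinity>" .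
  qed measurable
  show "(LINT p|lborel. f (fst p) * g (snd p)) = (LINT x|lborel. f x) * (LINT z|lborel. g z)"
    by (subst integral_lborel_fst[OF *]) simp
qed

subsection \<open>A Poincare inequality that is uniform in the horizon\<close>

text \<open>The increment over \<open>n\<close> steps is a sum of \<open>n\<close> translates of the
  increment over one step, and translates have equal norm.\<close>

lemma nrm_translate_nat_le:
  fixes v :: "'a::euclidean_space \<Rightarrow> real"
  assumes v: "sq_int lborel v"
  shows "nrm lborel (\<lambda>x. v (x + real n *\<^sub>R z) - v x) \<le> real n * nrm lborel (\<lambda>x. v (x + z) - v x)"
proof (induction n)
  case (Suc n)
  have [measurable]: "v \<in> borel_measurable borel"
    using v by (simp add: sq_int_def)
  let ?g = "\<lambda>x. v (x + z) - v x"
  have "nrm lborel (\<lambda>x. v (x + real (Suc n) *\<^sub>R z) - v x) \<le>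
      nrm lborel (\<lambda>x. v (x + real (Suc n) *\<^sub>R z) - v (x + real n *\<^sub>R z))
      + nrm lborel (\<lambda>x. v (x + real n *\<^sub>R z) - v x)"
    by (intro nrm_triangle_diff sq_int_translate v)
  also have "nrm lborel (\<lambda>x. v (x + real (Suc n) *\<^sub>R z) - v (x + real n *\<^sub>R z)) = nrm lborel ?g"
    using nrm_translate[of ?g "real n *\<^sub>R z"] by (simp add: algebra_simps)
  finally show ?case
    using Suc by (simp add: algebra_simps)
qed (simp add: nrm_def)

text \<open>Walking along multiples of \<open>z\<close> until the total displacement lies between
  \<open>2 * R\<close> and \<open>4 * R\<close> moves the support off itself. The total increment
  then dominates \<open>v\<close> pointwise, while its norm is at most \<open>n\<close> times that
  of one step.\<close>

lemma translate_lower_bound: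
  fixes v :: "'a::euclidean_space \<Rightarrow> real"
  assumes v: "sq_int lborel v" and supp: "\<And>x. v x \<noteq> 0 \<Longrightarrow> norm x < R" and z: "norm z \<le> 2 * R"
  shows "(norm z)\<^sup>2 * (nrm lborel v)\<^sup>2 \<le> 16 * R\<^sup>2 * (nrm lborel (\<lambda>x. v (x + z) - v x))\<^sup>2"
proof (cases "z = 0")
  case False
  define d where "d = norm z"
  \<comment> \<open>The least number of steps that covers the diameter \<open>2 * R\<close>.
    Rounding up costs at most one step, and \<open>d \<le> 2 * R\<close> keeps the total at most
    \<open>4 * R\<close>, whence the factor 16.\<close>
  define n where "n = nat \<lceil>2 * R / d\<rceil>"
  have d: "0 < d" "d \<le> 2 * R"
    using False z by (auto simp: d_def)
  have n1: "2 * R / d \<le> real n"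
    by (simp add: n_def real_nat_ceiling_ge)
  have "real n \<le> 2 * R / d + 1"
    using d by (simp add: n_def)
  then have n2: "real n * d \<le> 4 * R"
    using d by (simp add: field_simps)
  have vn: "v (x + real n *\<^sub>R z) = 0" if "v x \<noteq> 0" for x
  proof (rule ccontr)
    assume "v (x + real n *\<^sub>R z) \<noteq> 0"
    then have "norm (x + real n *\<^sub>R z) < R" "norm x < R"
      using supp that by auto
    moreover have "norm (real n *\<^sub>R z) \<le> norm (x + real n *\<^sub>R z) + norm x"
      by (metis add_diff_cancel_left' norm_triangle_ineq4)
    moreover have "2 * R \<le> norm (real n *\<^sub>R z)"
      using n1 d by (simp add: d_def field_simps)
    ultimately show False by simp
  qed
  have "nrm lborel v \<le> nrm lborel (\<lambda>x. v (x + real n *\<^sub>R z) - v x)"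
  proof (intro nrm_mono sq_int_diff sq_int_translate v)
    show "norm (v x) \<le> norm (v (x + real n *\<^sub>R z) - v x)" for x
      using vn[of x] by (cases "v x = 0") auto
  qed
  also have "\<dots> \<le> real n * nrm lborel (\<lambda>x. v (x + z) - v x)"
    by (rule nrm_translate_nat_le[OF v])
  finally have "d * nrm lborel v \<le> (real n * d) * nrm lborel (\<lambda>x. v (x + z) - v x)"
    using d by simp
  also have "\<dots> \<le> (4 * R) * nrm lborel (\<lambda>x. v (x + z) - v x)"
    by (intro mult_right_mono n2) simp
  finally have "(d * nrm lborel v)\<^sup>2 \<le> ((4 * R) * nrm lborel (\<lambda>x. v (x + z) - v x))\<^sup>2"
    using d by (intro power_mono) auto
  then show ?thesis
    by (simp add: d_def power_mult_distrib)
qed simp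

text \<open>Fubini with the increment as the outer variable.\<close>

lemma nrm_diffq_power2:
  assumes k: "kernel \<rho> \<delta>" and s: "sq_int lborel (diffq \<rho> v)"
  shows "(nrm lborel (diffq \<rho> v))\<^sup>2 = (LINT z|lborel. \<rho> z * (nrm lborel (\<lambda>x. v (x + z) - v x))\<^sup>2)"
    and "integrable lborel (\<lambda>z. \<rho> z * (nrm lborel (\<lambda>x. v (x + z) - v x))\<^sup>2)"
proof -
  have eq: "\<rho> z * (nrm lborel (\<lambda>x. v (x + z) - v x))\<^sup>2 = (LINT x|lborel. (norm (diffq \<rho> v (x, z)))\<^sup>2)" for z
    using kernel_nonneg[OF k, of z] by (simp add: nrm_power2 diffq_def power_mult_distrib)
  have i: "integrable lborel (\<lambda>p. (norm (diffq \<rho> v p))\<^sup>2)"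
    using s by (simp add: sq_int_def)
  show "(nrm lborel (diffq \<rho> v))\<^sup>2 = (LINT z|lborel. \<rho> z * (nrm lborel (\<lambda>x. v (x + z) - v x))\<^sup>2)"
    unfolding eq nrm_power2[of lborel "diffq \<rho> v"] by (rule integral_lborel_snd[OF i])
  show "integrable lborel (\<lambda>z. \<rho> z * (nrm lborel (\<lambda>x. v (x + z) - v x))\<^sup>2)"
    unfolding eq by (rule integrable_lborel_snd[OF i])
qed

text \<open>The bound of \<open>translate_lower_bound\<close> is integrated against
  \<open>\<rho>\<close>. Only the total second moment of the kernel enters, and that is the same for
  every horizon; \<open>\<delta> \<le> 2 * R\<close> makes the bound available for all increments in
  the support of \<open>\<rho>\<close>.\<close>

lemma poincare:
  fixes v :: "'a::euclidean_space \<Rightarrow> real"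
  assumes k: "kernel \<rho> \<delta>" and v: "sq_int lborel v" and supp: "\<And>x. v x \<noteq> 0 \<Longrightarrow> norm x < R"
    and \<delta>: "\<delta> \<le> 2 * R" and s: "sq_int lborel (diffq \<rho> v)"
  shows "(nrm lborel v)\<^sup>2 \<le> 16 * R\<^sup>2 * (nrm lborel (diffq \<rho> v))\<^sup>2"
proof -
  have "(LINT z|lborel. \<rho> z * (norm z)\<^sup>2) * (nrm lborel v)\<^sup>2 =
      (LINT z|lborel. \<rho> z * (norm z)\<^sup>2 * (nrm lborel v)\<^sup>2)"
    by simp
  also have "\<dots> \<le> (LINT z|lborel. 16 * R\<^sup>2 * (\<rho> z * (nrm lborel (\<lambda>x. v (x + z) - v x))\<^sup>2))"
  proof (rule integral_mono)
    show "integrable lborel (\<lambda>z. \<rho> z * (norm z)\<^sup>2 * (nrm lborel v)\<^sup>2)"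
      using kernel_integrable[OF k] by simp
    show "integrable lborel (\<lambda>z. 16 * R\<^sup>2 * (\<rho> z * (nrm lborel (\<lambda>x. v (x + z) - v x))\<^sup>2))"
      using nrm_diffq_power2(2)[OF k s] by simp
    fix z :: 'a
    show "\<rho> z * (norm z)\<^sup>2 * (nrm lborel v)\<^sup>2 \<le> 16 * R\<^sup>2 * (\<rho> z * (nrm lborel (\<lambda>x. v (x + z) - v x))\<^sup>2)"
    proof (cases "\<delta> \<le> norm z")
      case True
      then show ?thesis by (simp add: kernel_eq_0[OF k])
    next
      case False
      then have "norm z \<le> 2 * R" using \<delta> by simp
      from mult_left_mono[OF translate_lower_bound[OF v supp this] kernel_nonneg[OF k, of z]]
      show ?thesis by (simp add: mult_ac)
    qed
  qed
  also have "\<dots> = 16 * R\<^sup>2 * (nrm lborel (diffq \<rho> v))\<^sup>2"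
    using nrm_diffq_power2(1)[OF k s] by simp
  finally have *: "real DIM('a) * (nrm lborel v)\<^sup>2 \<le> 16 * R\<^sup>2 * (nrm lborel (diffq \<rho> v))\<^sup>2"
    by (simp add: kernel_integral[OF k])
  \<comment> \<open>The dimension, which is the total second moment, is at least 1 and is dropped on
    the left.\<close>
  have "1 * (nrm lborel v)\<^sup>2 \<le> real DIM('a) * (nrm lborel v)\<^sup>2"
    using DIM_positive[where 'a = 'a] by (intro mult_right_mono) (simp_all add: Suc_leI del: DIM_positive)
  with * show ?thesis by simp
qed

subsection \<open>Averages of square-integrable functions\<close>

text \<open>Jensen's inequality for the probability density \<open>\<eta>\<close>, followed by
  Tonelli. The family \<open>W\<close> is abstract, on a space that may differ from that of its
  index, because it will be both the translates of a function and the translates of its difference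
  quotients on pairs.\<close>

lemma average_sq_int:
  fixes \<eta> :: "'a::euclidean_space \<Rightarrow> real" and W :: "'a \<Rightarrow> 'm::euclidean_space \<Rightarrow> real"
  assumes [measurable]: "\<eta> \<in> borel_measurable borel" "(\<lambda>p. W (fst p) (snd p)) \<in> borel_measurable borel"
    and \<eta>: "\<And>h. 0 \<le> \<eta> h" "integrable lborel \<eta>" "(LINT h|lborel. \<eta> h) = 1"
    and W: "\<And>h. sq_int lborel (W h)" "\<And>h. nrm lborel (W h) \<le> C"
  shows "sq_int lborel (\<lambda>m. LINT h|lborel. \<eta> h * W h m)"
    and "nrm lborel (\<lambda>m. LINT h|lborel. \<eta> h * W h m) \<le> C"
    and "sq_int lborel g \<Longrightarrow> integrable lborel (\<lambda>h. \<eta> h * (LINT m|lborel. g m * W h m))"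
    and "sq_int lborel g \<Longrightarrow> (LINT m|lborel. g m * (LINT h|lborel. \<eta> h * W h m)) =
      (LINT h|lborel. \<eta> h * (LINT m|lborel. g m * W h m))"
proof -
  have W'[measurable]: "(\<lambda>(m, h). W h m) \<in> borel_measurable (lborel \<Otimes>\<^sub>M lborel)"
  proof -
    have "(\<lambda>p. (snd p, fst p)) \<in> borel \<rightarrow>\<^sub>M (borel :: ('a \<times> 'm) measure)"
      by (intro borel_measurable_continuous_onI continuous_intros)
    from measurable_compose[OF this assms(2)] show ?thesis
      by (simp add: split_beta lborel_prod)
  qed
  have W2[measurable]: "(\<lambda>(h, m). W h m) \<in> borel_measurable (lborel \<Otimes>\<^sub>M lborel)"
    using assms(2) by (simp add: split_beta lborel_prod)
  have Wh[measurable]: "(\<lambda>h. W h m) \<in> borel_measurable borel" for m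
    using measurable_Pair2[OF W', of m] by simp
  have Wm[measurable]: "W h \<in> borel_measurable borel" for h
    using W(1)[of h] by (simp add: sq_int_def)
  have C: "0 \<le> C"
    using W(2)[of 0] nrm_nonneg order_trans by blast
  have WC: "(\<integral>\<^sup>+m. ennreal ((W h m)\<^sup>2) \<partial>lborel) \<le> ennreal (C\<^sup>2)" for h
  proof -
    have "(\<integral>\<^sup>+m. ennreal ((W h m)\<^sup>2) \<partial>lborel) = ennreal ((nrm lborel (W h))\<^sup>2)"
      unfolding nrm_power2 using W(1)[of h] by (subst nn_integral_eq_integral) (auto simp: sq_int_def)
    also have "\<dots> \<le> ennreal (C\<^sup>2)"
      using W(2)[of h] by (intro ennreal_leI power_mono) auto
    finally show ?thesis .
  qed
  have \<eta>1: "(\<integral>\<^sup>+h. ennreal (\<eta> h) \<partial>lborel) = 1"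
    using \<eta> by (subst nn_integral_eq_integral) auto
  let ?\<Phi> = "\<lambda>m. LINT h|lborel. \<eta> h * W h m"
  have [measurable]: "?\<Phi> \<in> borel_measurable borel"
    by measurable
  have jensen: "ennreal ((?\<Phi> m)\<^sup>2) \<le> (\<integral>\<^sup>+h. ennreal (\<eta> h * (W h m)\<^sup>2) \<partial>lborel)" for m
  proof (cases "integrable lborel (\<lambda>h. \<eta> h * (W h m)\<^sup>2)")
    case True
    define a where "a = ?\<Phi> m"
    have i1: "integrable lborel (\<lambda>h. \<eta> h * W h m)"
    proof (rule Bochner_Integration.integrable_bound)
      show "integrable lborel (\<lambda>h. \<eta> h + \<eta> h * (W h m)\<^sup>2)"
        using True \<eta> by simp
      have "\<bar>t\<bar> \<le> 1 + t\<^sup>2" for t :: real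
        using sum_squares_bound[of 1 "\<bar>t\<bar>"] by (simp add: algebra_simps)
      then have "\<eta> h * \<bar>W h m\<bar> \<le> \<eta> h * (1 + (W h m)\<^sup>2)" for h
        using \<eta>(1) by (intro mult_left_mono) auto
      then show "AE h in lborel. norm (\<eta> h * W h m) \<le> norm (\<eta> h + \<eta> h * (W h m)\<^sup>2)"
        using \<eta>(1) by (intro AE_I2) (simp add: abs_mult distrib_left)
    qed measurable
    have "0 \<le> (LINT h|lborel. \<eta> h * (W h m - a)\<^sup>2)"
      using \<eta>(1) by (intro integral_nonneg_AE) simp
    also have "\<dots> = (LINT h|lborel. \<eta> h * (W h m)\<^sup>2 - 2 * a * (\<eta> h * W h m) + a\<^sup>2 * \<eta> h)"
      by (simp add: power2_diff algebra_simps)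
    also have "\<dots> = (LINT h|lborel. \<eta> h * (W h m)\<^sup>2) - 2 * a * a + a\<^sup>2"
      using True i1 \<eta> by (simp add: a_def)
    finally have "a\<^sup>2 \<le> (LINT h|lborel. \<eta> h * (W h m)\<^sup>2)"
      by (simp add: power2_eq_square)
    then show ?thesis
      using True \<eta>(1) by (subst nn_integral_eq_integral) (auto simp: a_def)
  next
    case False
    then have "(\<integral>\<^sup>+h. ennreal (\<eta> h * (W h m)\<^sup>2) \<partial>lborel) = \<infinity>"
      using \<eta>(1) by (simp add: integrable_iff_bounded) (metis less_top)
    then show ?thesis by simp
  qed
  have "(\<integral>\<^sup>+m. ennreal ((?\<Phi> m)\<^sup>2) \<partial>lborel) \<le> (\<integral>\<^sup>+m. \<integral>\<^sup>+h. ennreal (\<eta> h * (W h m)\<^sup>2) \<partial>lborel \<partial>lborel)"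
    by (intro nn_integral_mono jensen)
  also have "\<dots> = (\<integral>\<^sup>+h. \<integral>\<^sup>+m. ennreal (\<eta> h * (W h m)\<^sup>2) \<partial>lborel \<partial>lborel)"
    by (rule lborel_pair.Fubini') measurable
  also have "\<dots> = (\<integral>\<^sup>+h. ennreal (\<eta> h) * (\<integral>\<^sup>+m. ennreal ((W h m)\<^sup>2) \<partial>lborel) \<partial>lborel)"
    using \<eta>(1) by (simp add: ennreal_mult nn_integral_cmult)
  also have "\<dots> \<le> (\<integral>\<^sup>+h. ennreal (\<eta> h) * ennreal (C\<^sup>2) \<partial>lborel)"
    by (intro nn_integral_mono mult_left_mono WC) simp
  also have "\<dots> = ennreal (C\<^sup>2)"
    by (simp add: nn_integral_multc \<eta>1)
  finally have fin: "(\<integral>\<^sup>+m. ennreal ((?\<Phi> m)\<^sup>2) \<partial>lborel) \<le> ennreal (C\<^sup>2)" .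
  then show sq: "sq_int lborel ?\<Phi>"
    by (auto simp: sq_int_def integrable_iff_bounded intro: order_le_less_trans)
  then have "ennreal ((nrm lborel ?\<Phi>)\<^sup>2) \<le> ennreal (C\<^sup>2)"
    using fin unfolding nrm_power2 by (subst (asm) nn_integral_eq_integral) (auto simp: sq_int_def)
  then have "(nrm lborel ?\<Phi>)\<^sup>2 \<le> C\<^sup>2"
    by (simp only: ennreal_le_iff[OF zero_le_power2])
  then show "nrm lborel ?\<Phi> \<le> C"
    by (rule power2_le_imp_le[OF _ C])
  assume g: "sq_int lborel g"
  then have [measurable]: "g \<in> borel_measurable borel"
    by (simp add: sq_int_def)
  \<comment> \<open>Absolute integrability on the product, which the interchange of integrals
    demands: the inner integral of \<open>\<bar>g m * W h m\<bar>\<close> is bounded uniformly in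
    \<open>h\<close>.\<close>
  have i: "integrable (lborel \<Otimes>\<^sub>M lborel) (\<lambda>(h, m). \<eta> h * (g m * W h m))"
  proof (rule integrableI_bounded)
    have bd: "(\<integral>\<^sup>+m. ennreal \<bar>g m * W h m\<bar> \<partial>lborel) \<le> ennreal (nrm lborel g ^ 2 + C\<^sup>2)" for h
    proof -
      have "\<bar>g m * W h m\<bar> \<le> (g m)\<^sup>2 + (W h m)\<^sup>2" for m
        using sum_squares_bound[of "\<bar>g m\<bar>" "\<bar>W h m\<bar>"]
          mult_nonneg_nonneg[of "\<bar>g m\<bar>" "\<bar>W h m\<bar>"]
        unfolding abs_mult power2_abs by linarith
      then have "(\<integral>\<^sup>+m. ennreal \<bar>g m * W h m\<bar> \<partial>lborel) \<le> (\<integral>\<^sup>+m. ennreal ((g m)\<^sup>2) + ennreal ((W h m)\<^sup>2) \<partial>lborel)"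
        by (intro nn_integral_mono) (simp flip: ennreal_plus)
      also have "\<dots> = (\<integral>\<^sup>+m. ennreal ((g m)\<^sup>2) \<partial>lborel) + (\<integral>\<^sup>+m. ennreal ((W h m)\<^sup>2) \<partial>lborel)"
        by (rule nn_integral_add) measurable
      also have "(\<integral>\<^sup>+m. ennreal ((g m)\<^sup>2) \<partial>lborel) = ennreal (nrm lborel g ^ 2)"
        unfolding nrm_power2 using g by (subst nn_integral_eq_integral) (auto simp: sq_int_def)
      finally show ?thesis
        using add_left_mono[OF WC[of h], of "ennreal (nrm lborel g ^ 2)"] by (simp add: order_trans)
    qed
    have "(\<integral>\<^sup>+p. ennreal (norm (case p of (h, m) \<Rightarrow> \<eta> h * (g m * W h m))) \<partial>(lborel \<Otimes>\<^sub>M lborel)) =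
        (\<integral>\<^sup>+h. \<integral>\<^sup>+m. ennreal (\<eta> h) * ennreal \<bar>g m * W h m\<bar> \<partial>lborel \<partial>lborel)"
      using \<eta>(1) by (subst lborel.nn_integral_fst[symmetric]) (auto simp: abs_mult ennreal_mult)
    also have "\<dots> = (\<integral>\<^sup>+h. ennreal (\<eta> h) * (\<integral>\<^sup>+m. ennreal \<bar>g m * W h m\<bar> \<partial>lborel) \<partial>lborel)"
      by (simp add: nn_integral_cmult)
    also have "\<dots> \<le> (\<integral>\<^sup>+h. ennreal (\<eta> h) * ennreal (nrm lborel g ^ 2 + C\<^sup>2) \<partial>lborel)"
      by (intro nn_integral_mono mult_left_mono bd) simp
    also have "\<dots> < \<infinity>"
      by (simp add: nn_integral_multc \<eta>1)
    finally show "(\<integral>\<^sup>+p. ennreal (norm (case p of (h, m) \<Rightarrow> \<eta> h * (g m * W h m))) \<partial>(lborel \<Otimes>\<^sub>M lborel)) < \<infinity>" .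
  qed measurable
  show "integrable lborel (\<lambda>h. \<eta> h * (LINT m|lborel. g m * W h m))"
    using lborel_pair.integrable_fst'[OF i] by simp
  have "(LINT m|lborel. g m * ?\<Phi> m) = (LINT m|lborel. LINT h|lborel. \<eta> h * (g m * W h m))"
    by (simp add: mult.left_commute[of "\<eta> _"])
  also have "\<dots> = (LINT h|lborel. LINT m|lborel. \<eta> h * (g m * W h m))"
    by (rule lborel_pair.Fubini_integral[OF i])
  finally show "(LINT m|lborel. g m * ?\<Phi> m) = (LINT h|lborel. \<eta> h * (LINT m|lborel. g m * W h m))"
    by simp
qed

lemma average_close:
  fixes \<eta> F :: "'a::euclidean_space \<Rightarrow> real"
  assumes \<eta>: "\<And>h. 0 \<le> \<eta> h" "integrable lborel \<eta>" "(LINT h|lborel. \<eta> h) = 1"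
    and F: "integrable lborel (\<lambda>h. \<eta> h * F h)" "\<And>h. \<eta> h \<noteq> 0 \<Longrightarrow> \<bar>F h - c\<bar> \<le> \<epsilon>"
  shows "\<bar>(LINT h|lborel. \<eta> h * F h) - c\<bar> \<le> \<epsilon>"
proof -
  have "(LINT h|lborel. \<eta> h * F h) - c = (LINT h|lborel. \<eta> h * F h - \<eta> h * c)"
    using F(1) \<eta> by simp
  also have "\<bar>\<dots>\<bar> \<le> (LINT h|lborel. \<bar>\<eta> h * F h - \<eta> h * c\<bar>)"
    by (rule integral_abs_bound)
  also have "\<dots> \<le> (LINT h|lborel. \<eta> h * \<epsilon>)"
  proof (rule integral_mono)
    fix h
    show "\<bar>\<eta> h * F h - \<eta> h * c\<bar> \<le> \<eta> h * \<epsilon>"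
      using F(2)[of h] \<eta>(1)[of h] by (cases "\<eta> h = 0") (auto simp: abs_mult mult_left_mono simp flip: right_diff_distrib)
  qed (use F(1) \<eta> in auto)
  also have "\<dots> = \<epsilon>"
    using \<eta> by simp
  finally show ?thesis .
qed

subsection \<open>Smooth functions\<close>

abbreviation partial :: "'a \<Rightarrow> ('a::euclidean_space \<Rightarrow> real) \<Rightarrow> 'a \<Rightarrow> real" where
  "partial i f x \<equiv> frechet_derivative f (at x) i"

definition smooth :: "('a::euclidean_space \<Rightarrow> real) \<Rightarrow> bool" where
  "smooth f \<longleftrightarrow> (\<forall>k. C_k k f)"

text \<open>Induction on the order \<open>k\<close> with the function left general. Smoothness is
  thereby reduced to exhibiting a class of differentiable functions that is stable under partial
  derivatives, without any formula for higher derivatives.\<close>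

lemma smooth_coinduct:
  fixes f :: "'a::euclidean_space \<Rightarrow> real"
  assumes "S f"
    and step: "\<And>g. S g \<Longrightarrow> g differentiable_on UNIV \<and> (\<forall>i\<in>Basis. S (partial i g))"
  shows "smooth f"
proof -
  have "C_k k g" if "S g" for k g
    using that step by (induction k arbitrary: g) (auto intro: differentiable_imp_continuous_on)
  with assms(1) show ?thesis by (simp add: smooth_def)
qed

lemma smooth_differentiable: "smooth f \<Longrightarrow> f differentiable (at x)"
  unfolding smooth_def by (metis C_k.simps(2) UNIV_I differentiable_on_def)

lemma smooth_partial: "smooth f \<Longrightarrow> i \<in> Basis \<Longrightarrow> smooth (partial i f)"
  unfolding smooth_def by (metis C_k.simps(2))

lemma smooth_continuous: "smooth f \<Longrightarrow> continuous_on S f"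
  unfolding smooth_def using C_k.simps(1) continuous_on_subset by blast

lemma gradient_has_derivative:
  assumes "f differentiable (at x)"
  shows "(f has_derivative (\<lambda>h. gradient f x \<bullet> h)) (at x)"
proof -
  have d: "(f has_derivative frechet_derivative f (at x)) (at x)"
    using assms by (simp add: frechet_derivative_works)
  then have lin: "linear (frechet_derivative f (at x))"
    by (rule has_derivative_linear)
  have "frechet_derivative f (at x) h = gradient f x \<bullet> h" for h
  proof -
    have "frechet_derivative f (at x) h = frechet_derivative f (at x) (\<Sum>i\<in>Basis. (h \<bullet> i) *\<^sub>R i)"
      by (simp add: euclidean_representation)
    also have "\<dots> = gradient f x \<bullet> h"
      unfolding gradient_def inner_sum_left linear_sum[OF lin] linear_cmul[OF lin]
      by (simp add: inner_commute mult.commute)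
    finally show ?thesis .
  qed
  with d show ?thesis
    by (metis (no_types, lifting) ext)
qed

lemma
  assumes "(f has_derivative (\<lambda>h. D \<bullet> h)) (at x)"
  shows partial_eqI: "partial i f x = i \<bullet> D" and gradient_eqI: "gradient f x = D"
proof -
  have *: "frechet_derivative f (at x) = (\<lambda>h. D \<bullet> h)"
    using frechet_derivative_at[OF assms] by simp
  then show "partial i f x = i \<bullet> D"
    by (simp add: inner_commute)
  show "gradient f x = D"
    unfolding gradient_def * by (simp add: euclidean_representation)
qed

lemma gradient_inner: "i \<in> Basis \<Longrightarrow> gradient f x \<bullet> i = partial i f x"
  by (simp add: gradient_def inner_sum_left inner_Basis if_distrib cong: if_cong)

lemma norm_gradient_le: "norm (gradient f x) \<le> (\<Sum>i\<in>Basis. \<bar>partial i f x\<bar>)"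
  unfolding gradient_def by (rule order_trans[OF norm_sum]) simp

lemma gradient_mult:
  assumes "f differentiable (at x)" "g differentiable (at x)"
  shows "gradient (\<lambda>x. f x * g x) x = f x *\<^sub>R gradient g x + g x *\<^sub>R gradient f x"
  by (rule gradient_eqI)
     (rule has_derivative_eq_rhs[OF has_derivative_mult[OF assms[THEN gradient_has_derivative]]],
      simp add: inner_add_left algebra_simps)

section \<open>A function that is smooth across the edge of its support\<close>

text \<open>The classical \<open>exp (- 1 / t)\<close>, extended by zero, times a polynomial in
  \<open>1 / t\<close>; the polynomial factor makes the family closed under differentiation.\<close>

definition flat :: "real poly \<Rightarrow> real \<Rightarrow> real" where
  "flat p t = (if 0 < t then poly p (1 / t) * exp (- (1 / t)) else 0)"

lemma flat_tendsto_0: "(flat p \<longlongrightarrow> 0) (at_right 0)"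
proof -
  have "((\<lambda>x. \<Sum>i\<le>degree p. coeff p i * (x ^ i / exp x)) \<longlongrightarrow> (\<Sum>i\<le>degree p. coeff p i * 0)) at_top"
    by (intro tendsto_sum tendsto_mult tendsto_const tendsto_power_div_exp_0)
  then have "((\<lambda>x. poly p x * exp (- x)) \<longlongrightarrow> 0) at_top"
    by (simp add: poly_altdef sum_distrib_right exp_minus divide_inverse mult.assoc)
  then have "((\<lambda>t. poly p (inverse t) * exp (- inverse t)) \<longlongrightarrow> 0) (at_right 0)"
    by (rule filterlim_compose[OF _ filterlim_inverse_at_top_right])
  then show ?thesis
    by (rule Lim_transform_eventually)
       (auto simp: eventually_at_right_field flat_def divide_inverse intro!: exI[of _ 1])
qed

text \<open>With \<open>x = 1 / t\<close>, differentiation in \<open>t\<close> is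
  \<open>- x\<^sup>2\<close> times differentiation in \<open>x\<close>; it sends
  \<open>p(x) exp(- x)\<close> to \<open>x\<^sup>2 (p - p')(x) exp(- x)\<close>.\<close>

lemma flat_has_derivative:
  "(flat p has_real_derivative flat ([:0, 0, 1:] * (p - pderiv p)) t) (at t)"
proof -
  consider "t < 0" | "t = 0" | "0 < t" by linarith
  then show ?thesis
  proof cases
    case 1
    have "((\<lambda>_. 0) has_real_derivative 0) (at t)"
      by simp
    then have "(flat p has_real_derivative 0) (at t)"
      by (rule has_field_derivative_transform_within_open[where S = "{..<0}"]) (use 1 in \<open>auto simp: flat_def\<close>)
    then show ?thesis
      using 1 by (simp add: flat_def)
  next
    case 2
    have "((\<lambda>h. (flat p (0 + h) - flat p 0) / h) \<longlongrightarrow> 0) (at_left 0)"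
      by (rule Lim_transform_eventually[OF tendsto_const])
         (auto simp: flat_def eventually_at_left_field intro!: exI[of _ "-1"])
    \<comment> \<open>The right difference quotient at 0 is again a \<open>flat\<close> function,
      with polynomial \<open>[:0, 1:] * p\<close>, so its limit is already known.\<close>
    moreover have "((\<lambda>h. (flat p (0 + h) - flat p 0) / h) \<longlongrightarrow> 0) (at_right 0)"
      by (rule Lim_transform_eventually[OF flat_tendsto_0[of "[:0, 1:] * p"]])
         (auto simp: flat_def eventually_at_right_field intro!: exI[of _ "1"])
    ultimately show ?thesis
      using 2 by (simp add: DERIV_def filterlim_split_at flat_def[of _ "0::real"])
  next
    case 3
    have "((\<lambda>t. poly p (1 / t) * exp (- (1 / t))) has_real_derivative
       (poly (pderiv p) (1 / t) * (- 1 / t\<^sup>2)) * exp (- (1 / t)) +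
       poly p (1 / t) * (exp (- (1 / t)) * (1 / t\<^sup>2))) (at t)"
      using 3 by (auto intro!: derivative_eq_intros simp: power2_eq_square)
    then have "(flat p has_real_derivative
       (poly (pderiv p) (1 / t) * (- 1 / t\<^sup>2)) * exp (- (1 / t)) +
       poly p (1 / t) * (exp (- (1 / t)) * (1 / t\<^sup>2))) (at t)"
      by (rule has_field_derivative_transform_within_open[where S = "{0<..}"]) (use 3 in \<open>auto simp: flat_def\<close>)
    then show ?thesis
      using 3 by (simp add: flat_def field_simps power2_eq_square)
  qed
qed

text \<open>Made to be stable under partial derivatives: differentiating a bump yields another
  polynomial and an affine factor, and the product rule turns products into sums of products. The
  clause \<open>smooth\<close> admits arbitrary smooth factors, which gives the stability of smooth
  functions under multiplication.\<close>

inductive smooth_closure :: "('a::euclidean_space \<Rightarrow> real) \<Rightarrow> bool" where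
  const: "smooth_closure (\<lambda>_. c)"
| inner: "smooth_closure (\<lambda>x. x \<bullet> v)"
| bump: "smooth_closure (\<lambda>x. flat p (r - (x - a) \<bullet> (x - a)))"
| add: "smooth_closure f \<Longrightarrow> smooth_closure g \<Longrightarrow> smooth_closure (\<lambda>x. f x + g x)"
| mult: "smooth_closure f \<Longrightarrow> smooth_closure g \<Longrightarrow> smooth_closure (\<lambda>x. f x * g x)"
| smooth: "smooth f \<Longrightarrow> smooth_closure f"

lemma smooth_closure_derivative:
  assumes "smooth_closure f"
  shows "(\<forall>x. f differentiable (at x)) \<and> (\<forall>i\<in>Basis. smooth_closure (partial i f))"
  using assms
proof induction
  case (const c)
  have "((\<lambda>_. c) has_derivative (\<lambda>h. 0 \<bullet> h)) (at x)" for x :: 'a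
    by (auto intro!: derivative_eq_intros)
  from partial_eqI[OF this] show ?case
    by (auto intro: smooth_closure.const)
next
  case (inner v)
  have d: "((\<lambda>x. x \<bullet> v) has_derivative (\<lambda>h. v \<bullet> h)) (at x)" for x :: 'a
    by (auto intro!: derivative_eq_intros simp: inner_commute)
  from partial_eqI[OF this] differentiableI[OF d] show ?case
    by (auto intro: smooth_closure.const)
next
  case (bump p r a)
  define q where "q = [:0, 0, 1:] * (p - pderiv p)"
  define D :: "'a \<Rightarrow> 'a" where
    "D = (\<lambda>x. (flat q (r - (x - a) \<bullet> (x - a)) * (- 2)) *\<^sub>R (x - a))"
  have d: "((\<lambda>x. flat p (r - (x - a) \<bullet> (x - a))) has_derivative (\<lambda>h. D x \<bullet> h)) (at x)" for x :: 'a
  proof -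
    have "((\<lambda>x. r - (x - a) \<bullet> (x - a)) has_derivative (\<lambda>h. - 2 * ((x - a) \<bullet> h))) (at x)"
      by (auto intro!: derivative_eq_intros simp: inner_commute)
    from has_derivative_compose[OF this flat_has_derivative[unfolded has_field_derivative_def]]
    show ?thesis
      by (simp add: D_def q_def mult.assoc)
  qed
  have *: "partial i (\<lambda>x. flat p (r - (x - a) \<bullet> (x - a))) =
      (\<lambda>x. flat q (r - (x - a) \<bullet> (x - a)) * ((- 2) * (x \<bullet> i + - (a \<bullet> i))))" for i
  proof
    fix x
    have "partial i (\<lambda>x. flat p (r - (x - a) \<bullet> (x - a))) x = i \<bullet> D x"
      by (rule partial_eqI[OF d])
    also have "i \<bullet> D x = flat q (r - (x - a) \<bullet> (x - a)) * ((- 2) * (x \<bullet> i + - (a \<bullet> i)))"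
      unfolding D_def inner_scaleR_right inner_commute[of i] inner_diff_left[of x a i]
      by (simp only: mult.assoc diff_conv_add_uminus)
    finally show "partial i (\<lambda>x. flat p (r - (x - a) \<bullet> (x - a))) x =
        flat q (r - (x - a) \<bullet> (x - a)) * ((- 2) * (x \<bullet> i + - (a \<bullet> i)))" .
  qed
  show ?case
    unfolding * using differentiableI[OF d]
    by (intro conjI allI ballI smooth_closure.mult[OF smooth_closure.bump
      smooth_closure.mult[OF smooth_closure.const smooth_closure.add[OF smooth_closure.inner smooth_closure.const]]])
next
  case (add f g)
  have d: "((\<lambda>x. f x + g x) has_derivative (\<lambda>h. (gradient f x + gradient g x) \<bullet> h)) (at x)" for x
    using add.IH by (auto intro!: derivative_eq_intros gradient_has_derivative simp: inner_add_left)
  have *: "partial i (\<lambda>x. f x + g x) = (\<lambda>x. partial i f x + partial i g x)" if "i \<in> Basis" for i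
    using partial_eqI[OF d] that by (auto simp: inner_add_right gradient_inner inner_commute[of i])
  show ?case
    using differentiableI[OF d] add.IH by (auto simp: * intro: smooth_closure.add)
next
  case (mult f g)
  have d: "((\<lambda>x. f x * g x) has_derivative (\<lambda>h. (f x *\<^sub>R gradient g x + g x *\<^sub>R gradient f x) \<bullet> h)) (at x)" for x
    using mult.IH by (auto intro!: derivative_eq_intros gradient_has_derivative simp: inner_add_left)
  have *: "partial i (\<lambda>x. f x * g x) = (\<lambda>x. f x * partial i g x + g x * partial i f x)" if "i \<in> Basis" for i
    using partial_eqI[OF d] that by (auto simp: inner_add_right gradient_inner inner_commute[of i])
  show ?case
    using differentiableI[OF d] mult.IH mult.hyps by (auto simp: * intro!: smooth_closure.add smooth_closure.mult)
next
  case (smooth f)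
  then show ?case
    by (auto intro: smooth_differentiable smooth_partial smooth_closure.smooth)
qed

lemma smooth_closure_smooth: "smooth_closure f \<Longrightarrow> smooth f"
  by (rule smooth_coinduct[of smooth_closure])
     (auto dest: smooth_closure_derivative simp: differentiable_on_def intro: differentiable_at_withinI)

lemma smooth_const: "smooth (\<lambda>_. c)"
  by (rule smooth_closure_smooth[OF smooth_closure.const])

lemma smooth_mult: "smooth f \<Longrightarrow> smooth g \<Longrightarrow> smooth (\<lambda>x. f x * g x)"
  using smooth_closure_smooth[OF smooth_closure.mult] smooth_closure.smooth by blast

subsection \<open>Test functions\<close>

lemma test_functionI:
  assumes "smooth \<phi>" "compact K" "K \<subseteq> \<Omega>" "\<And>x. x \<notin> K \<Longrightarrow> \<phi> x = 0"
  shows "test_function \<Omega> \<phi>"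
proof -
  have "closure {x. \<phi> x \<noteq> 0} \<subseteq> K"
    using assms by (intro closure_minimal compact_imp_closed) auto
  then show ?thesis
    using assms unfolding test_function_def smooth_def
    by (meson closed_closure compact_Int_closed compact_closure bounded_subset closure_subset compact_imp_bounded subset_trans)
qed

lemma test_function_smooth: "test_function \<Omega> \<phi> \<Longrightarrow> smooth \<phi>"
  by (simp add: test_function_def smooth_def)

lemma test_function_eq_0: "test_function \<Omega> \<phi> \<Longrightarrow> x \<notin> \<Omega> \<Longrightarrow> \<phi> x = 0"
  using closure_subset[of "{x. \<phi> x \<noteq> 0}"] unfolding test_function_def by blast

lemma test_function_compact:
  assumes "test_function \<Omega> \<phi>"
  obtains K where "compact K" "K \<subseteq> \<Omega>" "\<And>x. x \<notin> K \<Longrightarrow> \<phi> x = 0"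
  using assms closure_subset[of "{x. \<phi> x \<noteq> 0}"] unfolding test_function_def by blast

lemma partial_eq_0:
  assumes "closed K" "\<And>x. x \<notin> K \<Longrightarrow> \<phi> x = 0" "x \<notin> K"
  shows "partial i \<phi> x = 0"
proof -
  have "((\<lambda>_. 0) has_derivative (\<lambda>h. 0 \<bullet> h)) (at x)"
    by (auto intro!: derivative_eq_intros)
  then have "(\<phi> has_derivative (\<lambda>h. 0 \<bullet> h)) (at x)"
    by (rule has_derivative_transform_within_open[where s = "- K"]) (use assms in auto)
  from partial_eqI[OF this] show ?thesis by simp
qed

lemma test_function_partial:
  assumes "test_function \<Omega> \<phi>" "i \<in> Basis"
  shows "test_function \<Omega> (partial i \<phi>)"
proof -
  obtain K where K: "compact K" "K \<subseteq> \<Omega>" "\<And>x. x \<notin> K \<Longrightarrow> \<phi> x = 0"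
    using test_function_compact[OF assms(1)] by metis
  show ?thesis
    using K assms(2) smooth_partial[OF test_function_smooth[OF assms(1)]]
      partial_eq_0[OF compact_imp_closed[OF K(1)]] by (intro test_functionI[of _ K]) auto
qed

lemma test_function_mult:
  assumes "test_function \<Omega> \<phi>" "smooth \<psi>"
  shows "test_function \<Omega> (\<lambda>x. \<psi> x * \<phi> x)"
proof -
  obtain K where "compact K" "K \<subseteq> \<Omega>" "\<And>x. x \<notin> K \<Longrightarrow> \<phi> x = 0"
    using test_function_compact[OF assms(1)] by metis
  then show ?thesis
    using assms by (intro test_functionI[of _ K] smooth_mult test_function_smooth[OF assms(1)]) auto
qed

lemma test_function_gradient_eq_0:
  "test_function \<Omega> \<phi> \<Longrightarrow> x \<notin> \<Omega> \<Longrightarrow> gradient \<phi> x = 0"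
  by (simp add: gradient_def test_function_eq_0[OF test_function_partial])

lemma test_function_bounded:
  assumes "test_function \<Omega> \<phi>"
  obtains A where "0 < A" "\<And>x. \<bar>\<phi> x\<bar> \<le> A"
proof -
  obtain K where K: "compact K" "K \<subseteq> \<Omega>" "\<And>x. x \<notin> K \<Longrightarrow> \<phi> x = 0"
    using test_function_compact[OF assms(1)] by metis
  have "bounded (\<phi> ` K)"
    using K(1) smooth_continuous[OF test_function_smooth[OF assms]]
    by (intro compact_imp_bounded compact_continuous_image) auto
  then obtain A where "0 < A" "\<forall>x\<in>K. \<bar>\<phi> x\<bar> \<le> A"
    unfolding bounded_pos by auto
  then show ?thesis
    using K(3) that[of A] by fastforce
qed

lemma smooth_measurable: "smooth \<phi> \<Longrightarrow> \<phi> \<in> borel_measurable borel"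
  by (intro borel_measurable_continuous_onI smooth_continuous)

lemma smooth_gradient_measurable: "smooth \<phi> \<Longrightarrow> gradient \<phi> \<in> borel_measurable borel"
  unfolding gradient_def[abs_def]
  by (intro borel_measurable_sum borel_measurable_scaleR smooth_measurable smooth_partial) auto

section \<open>Quantitative second-order bounds\<close>

text \<open>A \<open>C^2\<close> bound that avoids second derivatives. One constant controls
  gradient and remainder, and under convolution it is multiplied only by the \<open>L^1\<close> norm
  of the other factor.\<close>

definition taylor :: "real \<Rightarrow> ('a::euclidean_space \<Rightarrow> real) \<Rightarrow> bool" where
  "taylor A p \<longleftrightarrow> (\<forall>x. norm (gradient p x) \<le> A) \<and>
     (\<forall>x z. \<bar>p (x + z) - p x - gradient p x \<bullet> z\<bar> \<le> A * (norm z)\<^sup>2)"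

lemma lipschitz_of_gradient_bound:
  assumes "\<And>x. p differentiable (at x)" "\<And>x. norm (gradient p x) \<le> A"
  shows "\<bar>p y - p x\<bar> \<le> A * norm (y - x)"
proof -
  have "norm (p y - p x) \<le> A * norm (y - x)"
  proof (rule differentiable_bound[OF convex_UNIV])
    show "(p has_derivative (\<lambda>h. gradient p x \<bullet> h)) (at x within UNIV)" for x
      using gradient_has_derivative assms(1) by blast
    show "onorm (\<lambda>h. gradient p x \<bullet> h) \<le> A" for x
    proof (rule onorm_bound)
      show "0 \<le> A" using assms(2) norm_ge_zero order_trans by blast
      fix h
      have "norm (gradient p x \<bullet> h) \<le> norm (gradient p x) * norm h"
        by (simp add: Cauchy_Schwarz_ineq2)
      also have "\<dots> \<le> A * norm h"
        by (intro mult_right_mono assms(2)) simp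
      finally show "norm (gradient p x \<bullet> h) \<le> A * norm h" .
    qed
  qed auto
  then show ?thesis by simp
qed

lemma test_function_gradient_bounded:
  fixes \<phi> :: "'a::euclidean_space \<Rightarrow> real"
  assumes "test_function \<Omega> \<phi>"
  obtains A where "0 < A" "\<And>x. norm (gradient \<phi> x) \<le> A"
proof -
  have "\<forall>i\<in>Basis. \<exists>A>0. \<forall>x. \<bar>partial i \<phi> x\<bar> \<le> A"
    using test_function_bounded test_function_partial[OF assms] by metis
  then obtain A where A: "\<And>i. i \<in> Basis \<Longrightarrow> 0 < A i \<and> (\<forall>x. \<bar>partial i \<phi> x\<bar> \<le> A i)"
    by metis
  have "norm (gradient \<phi> x) \<le> (\<Sum>i\<in>Basis. A i)" for x
    using A by (intro order_trans[OF norm_gradient_le] sum_mono) auto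
  moreover have "0 < (\<Sum>i\<in>(Basis::'a set). A i)"
    using A by (intro sum_pos) auto
  ultimately show ?thesis using that by blast
qed

lemma test_function_gradient_lipschitz:
  fixes \<phi> :: "'a::euclidean_space \<Rightarrow> real"
  assumes "test_function \<Omega> \<phi>"
  obtains A where "0 < A" "\<And>x y. norm (gradient \<phi> y - gradient \<phi> x) \<le> A * norm (y - x)"
proof -
  have "\<forall>i\<in>Basis. \<exists>A>0. \<forall>x. norm (gradient (partial i \<phi>) x) \<le> A"
    using test_function_gradient_bounded test_function_partial[OF assms] by metis
  then obtain A where A: "\<And>i. i \<in> Basis \<Longrightarrow> 0 < A i \<and> (\<forall>x. norm (gradient (partial i \<phi>) x) \<le> A i)"
    by metis
  have "norm (gradient \<phi> y - gradient \<phi> x) \<le> (\<Sum>i\<in>Basis. A i) * norm (y - x)" for x y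
  proof -
    have "gradient \<phi> y - gradient \<phi> x = (\<Sum>i\<in>Basis. (partial i \<phi> y - partial i \<phi> x) *\<^sub>R i)"
      by (simp add: gradient_def sum_subtractf scaleR_left_diff_distrib)
    also have "norm \<dots> \<le> (\<Sum>i\<in>Basis. \<bar>partial i \<phi> y - partial i \<phi> x\<bar>)"
      by (rule order_trans[OF norm_sum]) simp
    also have "\<dots> \<le> (\<Sum>i\<in>Basis. A i * norm (y - x))"
    proof (intro sum_mono lipschitz_of_gradient_bound)
      fix i :: 'a assume i: "i \<in> Basis"
      show "partial i \<phi> differentiable at x" for x
        using smooth_differentiable smooth_partial test_function_smooth assms i by blast
      show "norm (gradient (partial i \<phi>) x) \<le> A i" for x
        using A i by blast
    qed
    finally show ?thesis by (simp add: sum_distrib_right)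
  qed
  moreover have "0 < (\<Sum>i\<in>(Basis::'a set). A i)"
    using A by (intro sum_pos) auto
  ultimately show ?thesis using that by blast
qed

lemma taylor_mono: "taylor A p \<Longrightarrow> A \<le> B \<Longrightarrow> taylor B p"
  unfolding taylor_def by (meson mult_right_mono order_trans zero_le_power2)

lemma test_function_taylor:
  fixes \<phi> :: "'a::euclidean_space \<Rightarrow> real"
  assumes "test_function \<Omega> \<phi>"
  obtains A where "0 < A" "taylor A \<phi>"
proof -
  obtain A where A: "0 < A" "\<And>x. norm (gradient \<phi> x) \<le> A"
    using test_function_gradient_bounded[OF assms] by metis
  obtain B where B: "0 < B" "\<And>x y. norm (gradient \<phi> y - gradient \<phi> x) \<le> B * norm (y - x)"
    using test_function_gradient_lipschitz[OF assms] by metis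
  have t: "\<bar>\<phi> (x + z) - \<phi> x - gradient \<phi> x \<bullet> z\<bar> \<le> B * (norm z)\<^sup>2" for x z
  proof -
    \<comment> \<open>Mean value inequality for \<open>\<phi>\<close> minus its linear part at
      \<open>x\<close>: on \<open>cball x (norm z)\<close> the derivative of this difference is at
      most \<open>B * norm z\<close>.\<close>
    have "norm ((\<phi> (x + z) - gradient \<phi> x \<bullet> (x + z)) - (\<phi> x - gradient \<phi> x \<bullet> x)) \<le> (B * norm z) * norm (x + z - x)"
    proof (rule differentiable_bound[of "cball x (norm z)"])
      fix y assume y: "y \<in> cball x (norm z)"
      have "\<phi> differentiable (at y)"
        using smooth_differentiable test_function_smooth assms by blast
      from gradient_has_derivative[OF this]
      have "((\<lambda>y. \<phi> y - gradient \<phi> x \<bullet> y) has_derivative (\<lambda>h. (gradient \<phi> y - gradient \<phi> x) \<bullet> h)) (at y)"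
        by (auto intro!: derivative_eq_intros simp: inner_diff_left)
      then show "((\<lambda>y. \<phi> y - gradient \<phi> x \<bullet> y) has_derivative (\<lambda>h. (gradient \<phi> y - gradient \<phi> x) \<bullet> h))
          (at y within cball x (norm z))"
        by (rule has_derivative_at_withinI)
      show "onorm (\<lambda>h. (gradient \<phi> y - gradient \<phi> x) \<bullet> h) \<le> B * norm z"
      proof (rule onorm_bound)
        fix h
        have "norm ((gradient \<phi> y - gradient \<phi> x) \<bullet> h) \<le> norm (gradient \<phi> y - gradient \<phi> x) * norm h"
          by (simp add: Cauchy_Schwarz_ineq2)
        also have "\<dots> \<le> (B * norm z) * norm h"
        proof (rule mult_right_mono)
          have "B * norm (y - x) \<le> B * norm z"
            using B(1) y by (intro mult_left_mono) (auto simp: dist_norm norm_minus_commute)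
          then show "norm (gradient \<phi> y - gradient \<phi> x) \<le> B * norm z"
            using B(2)[of y x] by linarith
        qed simp
        finally show "norm ((gradient \<phi> y - gradient \<phi> x) \<bullet> h) \<le> (B * norm z) * norm h" .
      qed (use B(1) in simp)
    qed (auto simp: dist_norm)
    then show ?thesis
      by (simp add: inner_add_right power2_eq_square algebra_simps)
  qed
  have "B * (norm z)\<^sup>2 \<le> max A B * (norm z)\<^sup>2" for z :: 'a
    by (intro mult_right_mono) auto
  with t have "\<bar>\<phi> (x + z) - \<phi> x - gradient \<phi> x \<bullet> z\<bar> \<le> max A B * (norm z)\<^sup>2" for x z
    using order_trans by blast
  moreover have "norm (gradient \<phi> x) \<le> max A B" for x
    using A(2)[of x] by (rule max.coboundedI1)
  ultimately have "taylor (max A B) \<phi>"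
    by (auto simp: taylor_def)
  then show ?thesis
    using A(1) by (intro that[of "max A B"]) auto
qed

subsection \<open>Functions of bounded support\<close>

lemma
  fixes f :: "'a::euclidean_space \<Rightarrow> real"
  assumes [measurable]: "f \<in> borel_measurable borel" and A: "\<And>x. \<bar>f x\<bar> \<le> A"
    and R: "\<And>x. f x \<noteq> 0 \<Longrightarrow> norm x \<le> R"
  shows integrable_bounded_support: "integrable lborel f"
    and integral_bounded_support: "\<bar>LINT x|lborel. f x\<bar> \<le> A * measure lborel (cball (0::'a) R)"
proof -
  have le: "\<bar>f x\<bar> \<le> A * indicator (cball 0 R) x" for x
    using A[of x] R[of x] by (cases "f x = 0") (auto simp: indicator_def)
  have i: "integrable lborel (\<lambda>x. A * indicator (cball (0::'a) R) x)"
    using emeasure_lborel_cball_finite[of "0::'a" R] by (intro integrable_mult_right) simp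
  show f: "integrable lborel f"
    by (rule Bochner_Integration.integrable_bound[OF i])
       (measurable, intro AE_I2, simp, rule order_trans[OF le abs_ge_self])
  have "\<bar>LINT x|lborel. f x\<bar> \<le> (LINT x|lborel. \<bar>f x\<bar>)"
    by (rule integral_abs_bound)
  also have "\<dots> \<le> (LINT x|lborel. A * indicator (cball (0::'a) R) x)"
    using f i le by (intro integral_mono) auto
  also have "\<dots> = A * measure lborel (cball (0::'a) R)"
    by simp
  finally show "\<bar>LINT x|lborel. f x\<bar> \<le> A * measure lborel (cball (0::'a) R)" .
qed

lemma sq_int_bounded_support:
  fixes f :: "'a::euclidean_space \<Rightarrow> 'b::euclidean_space"
  assumes "f \<in> borel_measurable borel" "\<And>x. norm (f x) \<le> A" "\<And>x. f x \<noteq> 0 \<Longrightarrow> norm x \<le> R"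
  shows "sq_int lborel f"
  unfolding sq_int_def using assms
  by (auto intro!: integrable_bounded_support[where A = "A\<^sup>2" and R = R] power_mono)

text \<open>Cauchy-Schwarz against the indicator of the ball.\<close>

lemma integrable_sq_int_bounded_support:
  fixes w :: "'a::euclidean_space \<Rightarrow> real"
  assumes w: "sq_int lborel w" and R: "\<And>x. w x \<noteq> 0 \<Longrightarrow> norm x \<le> R"
  shows "integrable lborel w"
    and "(LINT x|lborel. \<bar>w x\<bar>) \<le> nrm lborel w * sqrt (measure lborel (cball (0::'a) R))"
proof -
  have [measurable]: "w \<in> borel_measurable borel"
    using w by (simp add: sq_int_def)
  have 1: "sq_int lborel (indicator (cball (0::'a) R) :: 'a \<Rightarrow> real)"
    by (rule sq_int_bounded_support[where A = 1 and R = R], measurable) (auto simp: indicator_def split: if_splits)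
  have eq: "w x * indicator (cball 0 R) x = w x" for x
    using R[of x] by (auto simp: indicator_def)
  show "integrable lborel w"
    using integrable_mult_sq_int[OF w 1] by (simp add: eq)
  have aw: "sq_int lborel (\<lambda>x. \<bar>w x\<bar>)"
    using w by (simp add: sq_int_def)
  have "(indicator (cball (0::'a) R) x :: real)\<^sup>2 = indicator (cball 0 R) x" for x
    by (simp add: indicator_def)
  then have "nrm lborel (indicator (cball (0::'a) R) :: 'a \<Rightarrow> real) = sqrt (measure lborel (cball (0::'a) R))"
    by (simp add: nrm_def)
  moreover have "(LINT x|lborel. \<bar>w x\<bar> \<bullet> indicator (cball 0 R) x) = (LINT x|lborel. \<bar>w x\<bar>)"
    using R by (intro Bochner_Integration.integral_cong) (auto simp: indicator_def)
  moreover have "nrm lborel (\<lambda>x. \<bar>w x\<bar>) = nrm lborel w"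
    by (simp add: nrm_def)
  ultimately show "(LINT x|lborel. \<bar>w x\<bar>) \<le> nrm lborel w * sqrt (measure lborel (cball (0::'a) R))"
    using Cauchy_Schwarz_integral[OF aw 1] abs_ge_self order_trans by metis
qed

lemma test_function_support:
  assumes "test_function \<Omega> \<phi>"
  obtains R where "0 < R" "\<And>x. \<phi> x \<noteq> 0 \<Longrightarrow> norm x \<le> R" "\<And>x. gradient \<phi> x \<noteq> 0 \<Longrightarrow> norm x \<le> R"
proof -
  obtain K where K: "compact K" "K \<subseteq> \<Omega>" "\<And>x. x \<notin> K \<Longrightarrow> \<phi> x = 0"
    using test_function_compact[OF assms] by metis
  obtain R where R: "0 < R" "\<And>x. x \<in> K \<Longrightarrow> norm x \<le> R"
    using compact_imp_bounded[OF K(1)] unfolding bounded_pos by metis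
  have "gradient \<phi> x = 0" if "x \<notin> K" for x
    using partial_eq_0[OF compact_imp_closed[OF K(1)] K(3) that] by (simp add: gradient_def)
  then show ?thesis
    using that R K(3) by metis
qed

lemma test_function_measurable: "test_function \<Omega> \<phi> \<Longrightarrow> \<phi> \<in> borel_measurable borel"
  by (intro smooth_measurable test_function_smooth)

lemma test_function_gradient_measurable: "test_function \<Omega> \<phi> \<Longrightarrow> gradient \<phi> \<in> borel_measurable borel"
  by (intro smooth_gradient_measurable test_function_smooth)

lemma test_function_integrable:
  assumes "test_function \<Omega> \<phi>"
  shows "integrable lborel \<phi>"
proof -
  obtain R where "\<And>x. \<phi> x \<noteq> 0 \<Longrightarrow> norm x \<le> R"
    using test_function_support[OF assms] by metis
  moreover obtain A where "\<And>x. \<bar>\<phi> x\<bar> \<le> A"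
    using test_function_bounded[OF assms] by metis
  ultimately show ?thesis
    using integrable_bounded_support test_function_measurable[OF assms] by blast
qed

lemma test_function_sq_int:
  assumes "test_function \<Omega> \<phi>"
  shows "sq_int lborel \<phi>" "sq_int lborel (gradient \<phi>)"
proof -
  obtain R where R: "\<And>x. \<phi> x \<noteq> 0 \<Longrightarrow> norm x \<le> R" "\<And>x. gradient \<phi> x \<noteq> 0 \<Longrightarrow> norm x \<le> R"
    using test_function_support[OF assms] by metis
  obtain A where "\<And>x. \<bar>\<phi> x\<bar> \<le> A"
    using test_function_bounded[OF assms] by metis
  then show "sq_int lborel \<phi>"
    using sq_int_bounded_support[OF test_function_measurable[OF assms], of A R] R by simp
  obtain B where "\<And>x. norm (gradient \<phi> x) \<le> B"
    using test_function_gradient_bounded[OF assms] by metis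
  then show "sq_int lborel (gradient \<phi>)"
    using sq_int_bounded_support[OF test_function_gradient_measurable[OF assms], of B R] R by simp
qed

section \<open>Integration by parts for test functions\<close>

text \<open>Translation invariance makes the integral of
  \<open>\<phi> (x + h *\<^sub>R i) - \<phi> x\<close> vanish. The Taylor remainder is of order
  \<open>h\<^sup>2\<close> on a bounded set, so \<open>h\<close> times the integral of the
  derivative is of that order as well; divide by \<open>h\<close> and let it tend to 0.\<close>

lemma test_function_integral_partial:
  fixes \<phi> :: "'a::euclidean_space \<Rightarrow> real"
  assumes t: "test_function \<Omega> \<phi>" and i: "i \<in> Basis"
  shows "(LINT x|lborel. partial i \<phi> x) = 0"
proof -
  obtain R where R: "0 < R" "\<And>x. \<phi> x \<noteq> 0 \<Longrightarrow> norm x \<le> R" "\<And>x. gradient \<phi> x \<noteq> 0 \<Longrightarrow> norm x \<le> R"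
    using test_function_support[OF t] by metis
  obtain A where A: "0 < A" "taylor A \<phi>"
    using test_function_taylor[OF t] by metis
  have [measurable]: "\<phi> \<in> borel_measurable borel"
    by (rule test_function_measurable[OF t])
  have i1: "integrable lborel \<phi>"
    by (rule test_function_integrable[OF t])
  have i2: "integrable lborel (partial i \<phi>)"
    by (rule test_function_integrable[OF test_function_partial[OF t i]])
  have [measurable]: "partial i \<phi> \<in> borel_measurable borel"
    using i2 by auto
  define V where "V = measure lborel (cball (0::'a) (R + 1))"
  define I where "I = (LINT x|lborel. partial i \<phi> x)"
  have bd: "\<bar>I\<bar> \<le> (A * V) * h" if h: "0 < h" "h \<le> 1" for h
  proof -
    let ?g = "\<lambda>x. \<phi> (x + h *\<^sub>R i) - \<phi> x - h * partial i \<phi> x"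
    have "\<bar>LINT x|lborel. ?g x\<bar> \<le> (A * h\<^sup>2) * V"
      unfolding V_def
    proof (rule integral_bounded_support)
      show "\<bar>?g x\<bar> \<le> A * h\<^sup>2" for x
        using A(2)[unfolded taylor_def, THEN conjunct2, rule_format, of x "h *\<^sub>R i"] i h
        by (simp add: gradient_inner[OF i] power_mult_distrib)
      show "norm x \<le> R + 1" if "?g x \<noteq> 0" for x
      proof (rule ccontr)
        assume x: "\<not> norm x \<le> R + 1"
        then have "\<phi> x = 0" "gradient \<phi> x = 0"
          using R(2)[of x] R(3)[of x] by auto
        moreover have "\<phi> (x + h *\<^sub>R i) = 0"
        proof (rule ccontr)
          assume "\<phi> (x + h *\<^sub>R i) \<noteq> 0"
          from R(2)[OF this] have "norm (x + h *\<^sub>R i) \<le> R" .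
          moreover have "norm x \<le> norm (x + h *\<^sub>R i) + norm (h *\<^sub>R i)"
            by (metis add_diff_cancel_right' norm_triangle_ineq4)
          ultimately show False
            using h i x by simp
        qed
        ultimately show False
          using that i by (simp add: gradient_inner[OF i, symmetric])
      qed
    qed measurable
    moreover have "(LINT x|lborel. ?g x) = - h * I"
      using i1 i2 lborel_translate[of \<phi> "h *\<^sub>R i"] by (simp add: I_def)
    ultimately have "h * \<bar>I\<bar> \<le> h * ((A * V) * h)"
      using h by (simp add: abs_mult power2_eq_square mult_ac)
    then show ?thesis
      using h by simp
  qed
  have "\<bar>I\<bar> \<le> 0"
  proof (rule tendsto_lowerbound)
    show "((\<lambda>h. (A * V) * h) \<longlongrightarrow> 0) (at_right 0)"
      by (auto intro!: tendsto_eq_intros)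
    show "\<forall>\<^sub>F h in at_right 0. \<bar>I\<bar> \<le> A * V * h"
      using bd by (auto simp: eventually_at_right_field intro!: exI[of _ 1])
  qed simp
  then show ?thesis
    by (simp add: I_def)
qed

lemma integration_by_parts:
  assumes "test_function \<Omega> \<phi>" "test_function \<Omega> \<psi>" "i \<in> Basis"
  shows "(LINT x|lborel. \<psi> x * partial i \<phi> x) = - (LINT x|lborel. partial i \<psi> x * \<phi> x)"
proof -
  note s = test_function_smooth[OF assms(1)] test_function_smooth[OF assms(2)]
  have eq: "partial i (\<lambda>x. \<psi> x * \<phi> x) x = \<psi> x * partial i \<phi> x + partial i \<psi> x * \<phi> x" for x
    unfolding gradient_inner[OF assms(3), symmetric]
    by (subst gradient_mult) (auto intro: smooth_differentiable s simp: inner_add_left mult.commute)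
  have "(LINT x|lborel. partial i (\<lambda>x. \<psi> x * \<phi> x) x) = 0"
    by (rule test_function_integral_partial[OF test_function_mult[OF assms(1) s(2)] assms(3)])
  moreover have "integrable lborel (\<lambda>x. \<psi> x * partial i \<phi> x)" "integrable lborel (\<lambda>x. partial i \<psi> x * \<phi> x)"
    using assms by (auto intro!: integrable_mult_sq_int test_function_sq_int(1) test_function_partial)
  ultimately show ?thesis
    by (simp add: eq)
qed

subsection \<open>Convolution\<close>

text \<open>Written with \<open>x\<close> inside the mollifier, so that derivatives fall on
  \<open>\<eta>\<close>; \<open>conv_eq\<close> is the equivalent form as an average of translates
  of \<open>w\<close>, which serves the norm and energy estimates.\<close>

definition conv :: "('a::euclidean_space \<Rightarrow> real) \<Rightarrow> ('a \<Rightarrow> real) \<Rightarrow> 'a \<Rightarrow> real" where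
  "conv \<eta> w x = (LINT y|lborel. w y * \<eta> (x - y))"

lemma distr_lborel_reflect: "distr lborel borel (\<lambda>h. x - h) = (lborel :: 'a::euclidean_space measure)"
  using lborel_affine[of "-1" x] by (simp add: density_1)

lemma conv_eq:
  assumes [measurable]: "\<eta> \<in> borel_measurable borel" "w \<in> borel_measurable borel"
  shows "conv \<eta> w x = (LINT h|lborel. \<eta> h * w (x - h))"
  unfolding conv_def
  by (subst distr_lborel_reflect[of x, symmetric], subst integral_distr) (auto simp: mult.commute)

lemma integrable_scaleR_bounded:
  fixes F :: "'a::euclidean_space \<Rightarrow> 'b::euclidean_space"
  assumes [measurable]: "F \<in> borel_measurable borel" and "\<And>y. norm (F y) \<le> A" and w: "integrable lborel w"
  shows "integrable lborel (\<lambda>y. w y *\<^sub>R F y)"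
    and "norm (LINT y|lborel. w y *\<^sub>R F y) \<le> A * (LINT y|lborel. \<bar>w y\<bar>)"
proof -
  have [measurable]: "w \<in> borel_measurable borel"
    using w by auto
  have le: "norm (w y *\<^sub>R F y) \<le> A * \<bar>w y\<bar>" for y
    using mult_left_mono[OF assms(2)[of y] abs_ge_zero[of "w y"]] by (simp add: mult.commute)
  have i: "integrable lborel (\<lambda>y. A * \<bar>w y\<bar>)"
    using w by simp
  show int: "integrable lborel (\<lambda>y. w y *\<^sub>R F y)"
    by (rule Bochner_Integration.integrable_bound[OF i]) (measurable, intro AE_I2, rule order_trans[OF le], simp)
  have "norm (LINT y|lborel. w y *\<^sub>R F y) \<le> (LINT y|lborel. norm (w y *\<^sub>R F y))"
    by (rule integral_norm_bound)
  also have "\<dots> \<le> (LINT y|lborel. A * \<bar>w y\<bar>)"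
    by (intro integral_mono integrable_norm int i le)
  finally show "norm (LINT y|lborel. w y *\<^sub>R F y) \<le> A * (LINT y|lborel. \<bar>w y\<bar>)"
    by simp
qed

lemma has_derivative_of_quadratic_bound:
  fixes p :: "'a::euclidean_space \<Rightarrow> real"
  assumes "\<And>z. \<bar>p (x + z) - p x - D \<bullet> z\<bar> \<le> A * (norm z)\<^sup>2"
  shows "(p has_derivative (\<lambda>h. D \<bullet> h)) (at x)"
  unfolding has_derivative_at
proof (rule conjI[OF bounded_linear_inner_right], rule Lim_null_comparison)
  show "\<forall>\<^sub>F h in at 0. norm (norm (p (x + h) - p x - D \<bullet> h) / norm h) \<le> A * norm h"
  proof (rule always_eventually, rule allI)
    fix h
    show "norm (norm (p (x + h) - p x - D \<bullet> h) / norm h) \<le> A * norm h"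
      using assms[of h] by (cases "h = 0") (auto simp: divide_simps power2_eq_square mult_ac)
  qed
  show "((\<lambda>h. A * norm h) \<longlongrightarrow> 0) (at 0)"
    by (auto intro!: tendsto_eq_intros)
qed

context
  fixes \<eta> w :: "'a::euclidean_space \<Rightarrow> real"
  assumes \<eta>: "test_function UNIV \<eta>" and w: "integrable lborel w"
begin

lemma conv_gradient_integrable: "integrable lborel (\<lambda>y. w y *\<^sub>R gradient \<eta> (x - y))"
proof -
  obtain B where "\<And>x. norm (gradient \<eta> x) \<le> B"
    using test_function_gradient_bounded[OF \<eta>] by metis
  moreover have [measurable]: "gradient \<eta> \<in> borel_measurable borel"
    by (rule test_function_gradient_measurable[OF \<eta>])
  ultimately show ?thesis
    using w by (intro integrable_scaleR_bounded[where A = B]) auto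
qed

lemma conv_integrable: "integrable lborel (\<lambda>y. w y * \<eta> (x - y))"
proof -
  obtain B where "\<And>x. \<bar>\<eta> x\<bar> \<le> B"
    using test_function_bounded[OF \<eta>] by metis
  moreover have [measurable]: "\<eta> \<in> borel_measurable borel"
    by (rule test_function_measurable[OF \<eta>])
  ultimately show ?thesis
    using w integrable_scaleR_bounded(1)[where A = B and F = "\<lambda>y. \<eta> (x - y)" and w = w] by auto
qed

text \<open>The Taylor estimate of \<open>\<eta>\<close> is integrated against \<open>w\<close>.
  This yields differentiability under the integral sign and, at the same time, constants that depend
  on \<open>w\<close> only through its \<open>L^1\<close> norm.\<close>

lemma conv_quadratic_bound:
  assumes "taylor A \<eta>"
  shows "\<bar>conv \<eta> w (x + z) - conv \<eta> w x - (LINT y|lborel. w y *\<^sub>R gradient \<eta> (x - y)) \<bullet> z\<bar>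
     \<le> (A * (LINT y|lborel. \<bar>w y\<bar>)) * (norm z)\<^sup>2"
proof -
  have [measurable]: "\<eta> \<in> borel_measurable borel" "gradient \<eta> \<in> borel_measurable borel"
    by (rule test_function_measurable[OF \<eta>], rule test_function_gradient_measurable[OF \<eta>])
  let ?F = "\<lambda>y. \<eta> (x - y + z) - \<eta> (x - y) - gradient \<eta> (x - y) \<bullet> z"
  have 1: "x + z - y = x - y + z" for y by simp
  have "conv \<eta> w (x + z) - conv \<eta> w x - (LINT y|lborel. w y *\<^sub>R gradient \<eta> (x - y)) \<bullet> z =
      (LINT y|lborel. w y * \<eta> (x + z - y) - w y * \<eta> (x - y) - (w y *\<^sub>R gradient \<eta> (x - y)) \<bullet> z)"
    using conv_integrable[of "x + z"] conv_integrable[of x] conv_gradient_integrable[of x]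
    by (simp add: conv_def del: inner_scaleR_left)
  also have "\<dots> = (LINT y|lborel. w y *\<^sub>R ?F y)"
    by (rule Bochner_Integration.integral_cong)
       (simp_all only: 1 real_scaleR_def inner_scaleR_left right_diff_distrib)
  also have "norm \<dots> \<le> (A * (norm z)\<^sup>2) * (LINT y|lborel. \<bar>w y\<bar>)"
    using assms by (intro integrable_scaleR_bounded(2) w) (auto simp: taylor_def)
  finally show ?thesis
    by (simp add: mult_ac)
qed

lemma conv_has_derivative:
  "(conv \<eta> w has_derivative (\<lambda>h. (LINT y|lborel. w y *\<^sub>R gradient \<eta> (x - y)) \<bullet> h)) (at x)"
proof -
  obtain A where "taylor A \<eta>"
    using test_function_taylor[OF \<eta>] by metis
  from conv_quadratic_bound[OF this] show ?thesis
    by (rule has_derivative_of_quadratic_bound)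
qed

lemma conv_gradient: "gradient (conv \<eta> w) x = (LINT y|lborel. w y *\<^sub>R gradient \<eta> (x - y))"
  by (rule gradient_eqI[OF conv_has_derivative])

lemma conv_taylor: "taylor A \<eta> \<Longrightarrow> taylor (A * (LINT y|lborel. \<bar>w y\<bar>)) (conv \<eta> w)"
  unfolding taylor_def conv_gradient using conv_quadratic_bound[of A]
proof (intro conjI allI)
  assume t: "(\<forall>x. norm (gradient \<eta> x) \<le> A) \<and>
     (\<forall>x z. \<bar>\<eta> (x + z) - \<eta> x - gradient \<eta> x \<bullet> z\<bar> \<le> A * (norm z)\<^sup>2)"
  fix x z
  have [measurable]: "gradient \<eta> \<in> borel_measurable borel"
    by (rule test_function_gradient_measurable[OF \<eta>])
  show "norm (LINT y|lborel. w y *\<^sub>R gradient \<eta> (x - y)) \<le> A * (LINT y|lborel. \<bar>w y\<bar>)"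
    using t by (intro integrable_scaleR_bounded(2) w) auto
  show "\<bar>conv \<eta> w (x + z) - conv \<eta> w x - (LINT y|lborel. w y *\<^sub>R gradient \<eta> (x - y)) \<bullet> z\<bar>
     \<le> (A * (LINT y|lborel. \<bar>w y\<bar>)) * (norm z)\<^sup>2"
    using t by (intro conv_quadratic_bound) (simp add: taylor_def)
qed

lemma conv_partial: "i \<in> Basis \<Longrightarrow> partial i (conv \<eta> w) = conv (partial i \<eta>) w"
proof
  fix x assume i: "i \<in> Basis"
  have "partial i (conv \<eta> w) x = (LINT y|lborel. w y *\<^sub>R gradient \<eta> (x - y)) \<bullet> i"
    by (simp add: gradient_inner[OF i, symmetric] conv_gradient)
  also have "\<dots> = (LINT y|lborel. (w y *\<^sub>R gradient \<eta> (x - y)) \<bullet> i)"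
    by (rule integral_inner_left[symmetric]) (use conv_gradient_integrable in blast)
  also have "\<dots> = conv (partial i \<eta>) w x"
    by (simp add: conv_def gradient_inner[OF i])
  finally show "partial i (conv \<eta> w) x = conv (partial i \<eta>) w x" .
qed

lemma conv_nonzero: "conv \<eta> w x \<noteq> 0 \<Longrightarrow> \<exists>y. w y \<noteq> 0 \<and> \<eta> (x - y) \<noteq> 0"
  unfolding conv_def by (rule ccontr) (auto simp: not_ex intro!: integral_eq_zero_AE)

end

text \<open>Convolutions with a fixed \<open>w\<close> form a class stable under partial
  derivatives, since a partial derivative of the mollifier is again a test function.\<close>

lemma conv_smooth:
  assumes "test_function UNIV \<eta>" "integrable lborel w"
  shows "smooth (conv \<eta> w)"
proof (rule smooth_coinduct[of "\<lambda>\<phi>. \<exists>\<eta>. test_function UNIV \<eta> \<and> \<phi> = conv \<eta> w"])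
  fix \<phi> assume "\<exists>\<eta>. test_function UNIV \<eta> \<and> \<phi> = conv \<eta> w"
  then obtain \<eta> where \<eta>: "test_function UNIV \<eta>" and \<phi>: "\<phi> = conv \<eta> w" by blast
  have "\<phi> differentiable_on UNIV"
    unfolding \<phi> differentiable_on_def
    using differentiableI[OF conv_has_derivative[OF \<eta> assms(2)]] differentiable_at_withinI by blast
  then show "\<phi> differentiable_on UNIV \<and> (\<forall>i\<in>Basis. \<exists>\<eta>. test_function UNIV \<eta> \<and> partial i \<phi> = conv \<eta> w)"
    unfolding \<phi> using conv_partial[OF \<eta> assms(2)] test_function_partial[OF \<eta>] by blast
qed (use assms in blast)

subsection \<open>Mollifiers and cutoff functions\<close>

text \<open>The centre \<open>a\<close> is arbitrary: convolving with such a function shifts by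
  \<open>a\<close> and smooths in one operation, which is how supports are moved into the
  domain.\<close>

lemma mollifier_exists:
  fixes a :: "'a::euclidean_space"
  assumes r: "0 < r"
  obtains \<eta> where "test_function UNIV \<eta>" "\<And>h. 0 \<le> \<eta> h" "\<And>h. \<eta> h \<noteq> 0 \<Longrightarrow> norm (h - a) < r"
    "integrable lborel \<eta>" "(LINT h|lborel. \<eta> h) = 1"
proof -
  define b where "b = (\<lambda>x. flat 1 (r\<^sup>2 - (x - a) \<bullet> (x - a)))"
  have b_pos: "b x > 0 \<longleftrightarrow> x \<in> ball a r" and b_nn: "0 \<le> b x" for x
  proof -
    have "(x - a) \<bullet> (x - a) < r\<^sup>2 \<longleftrightarrow> norm (x - a) < r"
      using r by (metis abs_of_pos norm_ge_zero abs_norm_cancel power2_norm_eq_inner abs_square_less_1 power2_less_imp_less power_strict_mono pos2 less_imp_le)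
    then show "b x > 0 \<longleftrightarrow> x \<in> ball a r" "0 \<le> b x"
      by (auto simp: b_def flat_def dist_norm norm_minus_commute)
  qed
  have "smooth b"
    unfolding b_def by (rule smooth_closure_smooth[OF smooth_closure.bump])
  moreover have "b x = 0" if "x \<notin> cball a r" for x
    using b_pos[of x] b_nn[of x] that by auto
  ultimately have tb: "test_function UNIV b"
    by (intro test_functionI[of _ "cball a r"]) auto
  have ib: "integrable lborel b"
    by (rule test_function_integrable[OF tb])
  define c where "c = (LINT x|lborel. b x)"
  \<comment> \<open>\<open>b\<close> is positive on a ball of positive volume, so its integral can
    be normalized.\<close>
  have "c \<noteq> 0"
  proof
    assume "c = 0"
    then have "AE x in lborel. b x = 0"
      using integral_nonneg_eq_0_iff_AE[OF ib] b_nn by (simp add: c_def)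
    then have "AE x in lborel. x \<notin> ball a r"
      by eventually_elim (use b_pos in \<open>metis less_irrefl\<close>)
    then have "emeasure lborel (ball a r) = 0"
      by (subst (asm) AE_iff_measurable[of "ball a r"]) auto
    then show False
      using content_ball_pos[OF r, of a] by (simp add: measure_def)
  qed
  moreover have "0 \<le> c"
    unfolding c_def using b_nn by simp
  ultimately have c: "0 < c" by simp
  show ?thesis
  proof
    show "test_function UNIV (\<lambda>x. 1 / c * b x)"
      by (rule test_function_mult[OF tb smooth_const])
    show "0 \<le> 1 / c * b h" for h
      using c b_nn by simp
    show "norm (h - a) < r" if "1 / c * b h \<noteq> 0" for h
      using that b_nn[of h] b_pos[of h] by (auto simp: dist_norm norm_minus_commute)
    show "integrable lborel (\<lambda>x. 1 / c * b x)" "(LINT x|lborel. 1 / c * b x) = 1"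
      using ib c by (auto simp: c_def)
  qed
qed

text \<open>The indicator of the ball of radius \<open>3 * r / 4\<close> is mollified at scale
  \<open>r / 4\<close>; this leaves the value 1 up to radius \<open>r / 2\<close> and the value 0
  from radius \<open>r\<close> on.\<close>

lemma cutoff_exists:
  fixes z :: "'a::euclidean_space"
  assumes r: "0 < r"
  obtains \<zeta> where "test_function UNIV \<zeta>" "\<And>x. 0 \<le> \<zeta> x" "\<And>x. \<zeta> x \<le> 1"
    "\<And>x. norm (x - z) \<le> r / 2 \<Longrightarrow> \<zeta> x = 1" "\<And>x. \<zeta> x \<noteq> 0 \<Longrightarrow> norm (x - z) < r"
proof -
  obtain \<eta> :: "'a \<Rightarrow> real" where \<eta>: "test_function UNIV \<eta>" "\<And>h. 0 \<le> \<eta> h"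
    "\<And>h. \<eta> h \<noteq> 0 \<Longrightarrow> norm (h - 0) < r / 4" "integrable lborel \<eta>" "(LINT h|lborel. \<eta> h) = 1"
    using mollifier_exists[of "r / 4" 0] r by (metis divide_pos_pos zero_less_numeral)
  have [measurable]: "\<eta> \<in> borel_measurable borel"
    by (rule test_function_measurable[OF \<eta>(1)])
  define w :: "'a \<Rightarrow> real" where "w = indicator (cball z (3 * r / 4))"
  have w[measurable]: "w \<in> borel_measurable borel"
    unfolding w_def by (intro borel_measurable_indicator) simp
  have iw: "integrable lborel w"
    unfolding w_def using emeasure_lborel_cball_finite[of z "3 * r / 4"] by simp
  have eq: "conv \<eta> w x = (LINT h|lborel. \<eta> h * w (x - h))" for x
    by (rule conv_eq) measurable
  have w01: "0 \<le> w x" "w x \<le> 1" for x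
    by (auto simp: w_def indicator_def)
  have supp: "norm (x - z) < r" if nz: "conv \<eta> w x \<noteq> 0" for x
  proof -
    obtain y where y: "w y \<noteq> 0" "\<eta> (x - y) \<noteq> 0"
      using conv_nonzero[OF \<eta>(1) iw nz] by blast
    then have "norm (y - z) \<le> 3 * r / 4" "norm (x - y) < r / 4"
      using \<eta>(3)[of "x - y"] by (auto simp: w_def indicator_def dist_norm norm_minus_commute split: if_splits)
    then show ?thesis
      using norm_triangle_ineq[of "x - y" "y - z"] by simp
  qed
  have int: "integrable lborel (\<lambda>h. \<eta> h * w (x - h))" for x
    by (rule Bochner_Integration.integrable_bound[OF \<eta>(4)])
       (use w01 \<eta>(2) in \<open>auto intro!: AE_I2 mult_left_le simp: abs_mult\<close>)
  show ?thesis
  proof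
    show "test_function UNIV (conv \<eta> w)"
    proof (rule test_functionI[OF conv_smooth[OF \<eta>(1) iw], of "cball z r"])
      show "conv \<eta> w x = 0" if "x \<notin> cball z r" for x
        using supp[of x] that by (fastforce simp: dist_norm norm_minus_commute)
    qed auto
    show "0 \<le> conv \<eta> w x" for x
      unfolding eq using w01 \<eta>(2) by simp
    have "conv \<eta> w x \<le> (LINT h|lborel. \<eta> h)" for x
      unfolding eq using w01 \<eta>(2) by (intro integral_mono int \<eta>(4)) (auto intro!: mult_left_le)
    then show "conv \<eta> w x \<le> 1" for x
      using \<eta>(5) by simp
    show "conv \<eta> w x = 1" if x: "norm (x - z) \<le> r / 2" for x
    proof -
      have "\<eta> h * w (x - h) = \<eta> h" for h
      proof (cases "\<eta> h = 0")
        case False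
        then have "norm h < r / 4" using \<eta>(3)[of h] by simp
        then have "norm (x - h - z) \<le> 3 * r / 4"
          using x norm_triangle_ineq4[of "x - z" h] by (simp add: algebra_simps)
        then show ?thesis
          by (simp add: w_def indicator_def dist_norm norm_minus_commute)
      qed simp
      then have "(LINT h|lborel. \<eta> h * w (x - h)) = (LINT h|lborel. \<eta> h)"
        by (intro Bochner_Integration.integral_cong) auto
      then show ?thesis
        unfolding eq using \<eta>(5) by simp
    qed
  qed (use supp in blast)
qed

subsection \<open>Continuity of translations\<close>

text \<open>Two dominated convergences. Values and support are cut off first, with dominating
  function \<open>(g x)\<^sup>2\<close>. After that, almost everywhere approximation by continuous
  functions suffices, because the same cutoffs applied to the approximants provide a dominating
  function.\<close>

lemma dense_continuous_bounded_support:
  fixes g :: "'a::euclidean_space \<Rightarrow> real"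
  assumes g: "sq_int lborel g" and \<epsilon>: "0 < \<epsilon>"
  obtains \<phi> A R where "continuous_on UNIV \<phi>" "\<And>x. \<bar>\<phi> x\<bar> \<le> A" "\<And>x. \<phi> x \<noteq> 0 \<Longrightarrow> norm x \<le> R"
    "nrm lborel (\<lambda>x. g x - \<phi> x) \<le> \<epsilon>"
proof -
  define \<xi> :: "real \<Rightarrow> 'a \<Rightarrow> real" where "\<xi> m x = max 0 (min 1 (m + 1 - norm x))" for m x
  define cl :: "real \<Rightarrow> real \<Rightarrow> real" where "cl m t = max (- m) (min m t)" for m t
  have [measurable]: "g \<in> borel_measurable borel"
    using g by (simp add: sq_int_def)
  have \<xi>01: "0 \<le> \<xi> m x" "\<xi> m x \<le> 1" for m x
    by (auto simp: \<xi>_def)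
  have \<xi>c: "continuous_on UNIV (\<xi> m)" for m
    unfolding \<xi>_def by (intro continuous_intros)
  have clc: "continuous_on UNIV (cl m)" for m
    unfolding cl_def by (intro continuous_intros)
  have [measurable]: "\<xi> m \<in> borel_measurable borel" "cl m \<in> borel_measurable borel" for m
    by (intro borel_measurable_continuous_onI \<xi>c clc)+
  have "(\<lambda>n. LINT x|lborel. (g x - cl (real n) (g x) * \<xi> (real n) x)\<^sup>2) \<longlonglongrightarrow> (LINT x|(lborel::'a measure). (0::real))"
  proof (rule integral_dominated_convergence[where w = "\<lambda>x. (g x)\<^sup>2"])
    show "integrable lborel (\<lambda>x. (g x)\<^sup>2)"
      using g by (simp add: sq_int_def)
    show "AE x in lborel. (\<lambda>n. (g x - cl (real n) (g x) * \<xi> (real n) x)\<^sup>2) \<longlonglongrightarrow> 0"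
    proof (rule AE_I2)
      fix x
      obtain N where N: "\<bar>g x\<bar> + norm x \<le> real N"
        using real_arch_simple by blast
      have "(g x - cl (real n) (g x) * \<xi> (real n) x)\<^sup>2 = 0" if "N \<le> n" for n
      proof -
        have "\<bar>g x\<bar> + norm x \<le> real n" using N that by linarith
        then have "\<bar>g x\<bar> \<le> real n" "norm x \<le> real n"
          using norm_ge_zero[of x] by linarith+
        then show ?thesis
          by (simp add: cl_def \<xi>_def abs_le_iff min_def max_def)
      qed
      then show "(\<lambda>n. (g x - cl (real n) (g x) * \<xi> (real n) x)\<^sup>2) \<longlonglongrightarrow> 0"
        by (intro tendsto_eventually eventually_sequentiallyI) blast
    qed
    show "AE x in lborel. norm ((g x - cl (real n) (g x) * \<xi> (real n) x)\<^sup>2) \<le> (g x)\<^sup>2" for n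
    proof (rule AE_I2)
      fix x
      define t where "t = cl (real n) (g x) * \<xi> (real n) x"
      have "0 \<le> g x \<Longrightarrow> 0 \<le> cl (real n) (g x) \<and> cl (real n) (g x) \<le> g x"
        "g x \<le> 0 \<Longrightarrow> cl (real n) (g x) \<le> 0 \<and> g x \<le> cl (real n) (g x)"
        by (auto simp: cl_def)
      then have "0 \<le> g x \<Longrightarrow> 0 \<le> t \<and> t \<le> g x" "g x \<le> 0 \<Longrightarrow> t \<le> 0 \<and> g x \<le> t"
        unfolding t_def using \<xi>01[of "real n" x]
          mult_left_mono[of "\<xi> (real n) x" 1 "cl (real n) (g x)"]
          mult_left_mono_neg[of "\<xi> (real n) x" 1 "cl (real n) (g x)"]
        by (auto simp: mult_nonpos_nonneg)
      then have "\<bar>g x - t\<bar> \<le> \<bar>g x\<bar>"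
        by linarith
      then have "\<bar>g x - t\<bar>\<^sup>2 \<le> \<bar>g x\<bar>\<^sup>2"
        by (intro power_mono) auto
      then show "norm ((g x - cl (real n) (g x) * \<xi> (real n) x)\<^sup>2) \<le> (g x)\<^sup>2"
        by (simp add: t_def)
    qed
  qed measurable
  then have "(\<lambda>n. nrm lborel (\<lambda>x. g x - cl (real n) (g x) * \<xi> (real n) x)) \<longlonglongrightarrow> sqrt 0"
    unfolding nrm_def by (intro tendsto_real_sqrt) simp
  then have "\<forall>\<^sub>F n in sequentially. nrm lborel (\<lambda>x. g x - cl (real n) (g x) * \<xi> (real n) x) < \<epsilon> / 2"
    using \<epsilon> by (intro order_tendstoD(2)) auto
  then obtain n where n: "nrm lborel (\<lambda>x. g x - cl (real n) (g x) * \<xi> (real n) x) < \<epsilon> / 2"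
    by (auto dest!: eventually_happens)
  define m where "m = real n"
  have m: "0 \<le> m" by (simp add: m_def)
  have clm: "\<bar>cl m t\<bar> \<le> m" for t
    using m by (auto simp: cl_def)
  have \<xi>R: "norm x \<le> m + 1" if "\<xi> m x \<noteq> 0" for x
    using that by (auto simp: \<xi>_def)
  have bd: "\<bar>cl m t * \<xi> m x\<bar> \<le> m" for t x
    using mult_mono[OF clm[of t] \<xi>01(2)[of m x]] \<xi>01(1)[of m x] m by (simp add: abs_mult)
  \<comment> \<open>Measurability in this sense supplies continuous functions that converge to
    \<open>g\<close> outside a negligible set.\<close>
  have "g measurable_on UNIV"
    by (intro lebesgue_measurable_imp_measurable_on) (auto intro: measurable_completion)
  then obtain N G where N: "negligible N" and G: "\<And>k. continuous_on UNIV (G k)"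
    "\<And>x. x \<notin> N \<Longrightarrow> (\<lambda>k. G k x) \<longlonglongrightarrow> g x"
    unfolding measurable_on_def by auto
  have [measurable]: "G k \<in> borel_measurable borel" for k
    by (intro borel_measurable_continuous_onI G)
  have "AE x in lebesgue. x \<notin> N"
    using N by (intro AE_not_in) (simp add: negligible_iff_null_sets)
  then have AEN: "AE x in lborel. x \<notin> N"
    by (simp add: AE_completion_iff)
  have "(\<lambda>k. LINT x|lborel. (cl m (g x) * \<xi> m x - cl m (G k x) * \<xi> m x)\<^sup>2) \<longlonglongrightarrow> (LINT x|(lborel::'a measure). (0::real))"
  proof (rule integral_dominated_convergence[where w = "\<lambda>x. (2 * m)\<^sup>2 * indicator (cball 0 (m + 1)) x"])
    show "integrable lborel (\<lambda>x. (2 * m)\<^sup>2 * indicator (cball (0::'a) (m + 1)) x)"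
      using emeasure_lborel_cball_finite[of "0::'a" "m + 1"] by (intro integrable_mult_right) simp
    show "AE x in lborel. (\<lambda>k. (cl m (g x) * \<xi> m x - cl m (G k x) * \<xi> m x)\<^sup>2) \<longlonglongrightarrow> 0"
      using AEN
    proof eventually_elim
      case (elim x)
      have "isCont (cl m) (g x)"
        using clc[of m] by (simp add: continuous_on_eq_continuous_at)
      then have "(\<lambda>k. cl m (G k x)) \<longlonglongrightarrow> cl m (g x)"
        by (rule isCont_tendsto_compose[OF _ G(2)[OF elim]])
      then show ?case
        by (auto intro!: tendsto_eq_intros)
    qed
    show "AE x in lborel. norm ((cl m (g x) * \<xi> m x - cl m (G k x) * \<xi> m x)\<^sup>2) \<le> (2 * m)\<^sup>2 * indicator (cball 0 (m + 1)) x" for k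
    proof (rule AE_I2)
      fix x
      have "\<bar>cl m (g x) * \<xi> m x - cl m (G k x) * \<xi> m x\<bar> \<le> 2 * m"
        using bd[of "g x" x] bd[of "G k x" x] by linarith
      then have "\<bar>cl m (g x) * \<xi> m x - cl m (G k x) * \<xi> m x\<bar>\<^sup>2 \<le> (2 * m)\<^sup>2"
        by (intro power_mono) auto
      then show "norm ((cl m (g x) * \<xi> m x - cl m (G k x) * \<xi> m x)\<^sup>2) \<le> (2 * m)\<^sup>2 * indicator (cball 0 (m + 1)) x"
        using \<xi>R[of x] by (cases "\<xi> m x = 0") (auto simp: indicator_def)
    qed
  qed measurable
  then have "(\<lambda>k. nrm lborel (\<lambda>x. cl m (g x) * \<xi> m x - cl m (G k x) * \<xi> m x)) \<longlonglongrightarrow> sqrt 0"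
    unfolding nrm_def by (intro tendsto_real_sqrt) simp
  then have "\<forall>\<^sub>F k in sequentially. nrm lborel (\<lambda>x. cl m (g x) * \<xi> m x - cl m (G k x) * \<xi> m x) < \<epsilon> / 2"
    using \<epsilon> by (intro order_tendstoD(2)) auto
  then obtain k where k: "nrm lborel (\<lambda>x. cl m (g x) * \<xi> m x - cl m (G k x) * \<xi> m x) < \<epsilon> / 2"
    by (auto dest!: eventually_happens)
  have sq: "sq_int lborel (\<lambda>x. cl m (h x) * \<xi> m x)" if [measurable]: "h \<in> borel_measurable borel" for h
    using bd \<xi>R by (intro sq_int_bounded_support[where A = m and R = "m + 1"]) auto
  show ?thesis
  proof
    show "continuous_on UNIV (\<lambda>x. cl m (G k x) * \<xi> m x)"
      by (intro continuous_on_mult \<xi>c continuous_on_compose2[OF clc G(1)]) auto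
    show "\<bar>cl m (G k x) * \<xi> m x\<bar> \<le> m" for x by (rule bd)
    show "norm x \<le> m + 1" if "cl m (G k x) * \<xi> m x \<noteq> 0" for x
      using that \<xi>R by auto
    show "nrm lborel (\<lambda>x. g x - cl m (G k x) * \<xi> m x) \<le> \<epsilon>"
      using nrm_triangle_diff[OF g sq[of g] sq[of "G k"]] n k by (simp add: m_def)
  qed
qed

lemma nrm_translate_continuous:
  fixes g :: "'a::euclidean_space \<Rightarrow> real"
  assumes g: "sq_int lborel g" and \<epsilon>: "0 < \<epsilon>"
  obtains \<theta> where "0 < \<theta>" "\<And>h. norm h < \<theta> \<Longrightarrow> nrm lborel (\<lambda>x. g (x + h) - g x) \<le> \<epsilon>"
proof -
  obtain \<phi> A R where \<phi>: "continuous_on UNIV \<phi>" "\<And>x. \<bar>\<phi> x\<bar> \<le> A" "\<And>x. \<phi> x \<noteq> 0 \<Longrightarrow> norm x \<le> R"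
    "nrm lborel (\<lambda>x. g x - \<phi> x) \<le> \<epsilon> / 3"
    using dense_continuous_bounded_support[OF g, of "\<epsilon> / 3"] \<epsilon> by (metis zero_less_divide_iff zero_less_numeral)
  have [measurable]: "\<phi> \<in> borel_measurable borel" "g \<in> borel_measurable borel"
    using g by (auto intro: borel_measurable_continuous_onI \<phi> simp: sq_int_def)
  have s\<phi>: "sq_int lborel \<phi>"
    using \<phi> by (intro sq_int_bounded_support[where A = A and R = R]) auto
  define V where "V = measure lborel (cball (0::'a) (R + 1))"
  \<comment> \<open>A difference of size at most \<open>\<epsilon>'\<close> on a ball of volume
    \<open>V\<close> has norm at most \<open>\<epsilon> / 3\<close>; the added 1 keeps the
    denominator positive.\<close>
  define \<epsilon>' where "\<epsilon>' = \<epsilon> / (3 * sqrt (V + 1))"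
  have V: "0 \<le> V" by (simp add: V_def)
  then have \<epsilon>': "0 < \<epsilon>'" using \<epsilon> by (simp add: \<epsilon>'_def)
  \<comment> \<open>The radius is \<open>R + 2\<close> because both \<open>x\<close>, of norm at
    most \<open>R + 1\<close>, and its translate by less than 1 must lie in the compact set.\<close>
  have "uniformly_continuous_on (cball 0 (R + 2)) \<phi>"
    by (intro compact_uniformly_continuous continuous_on_subset[OF \<phi>(1)]) auto
  then obtain \<theta> where \<theta>: "0 < \<theta>"
    "\<And>x y. x \<in> cball 0 (R + 2) \<Longrightarrow> y \<in> cball 0 (R + 2) \<Longrightarrow> dist y x < \<theta> \<Longrightarrow> dist (\<phi> y) (\<phi> x) < \<epsilon>'"
    unfolding uniformly_continuous_on_def using \<epsilon>' by metis
  have "nrm lborel (\<lambda>x. g (x + h) - g x) \<le> \<epsilon>" if h: "norm h < min \<theta> 1" for h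
  proof -
    have sup: "norm x \<le> R + 1" if "\<phi> (x + h) - \<phi> x \<noteq> 0" for x
    proof -
      have "norm x \<le> norm (x + h) + norm h"
        by (metis add_diff_cancel_right' norm_triangle_ineq4)
      then show ?thesis
        using that \<phi>(3)[of x] \<phi>(3)[of "x + h"] h by (cases "\<phi> x = 0") auto
    qed
    have "\<bar>\<phi> (x + h) - \<phi> x\<bar> \<le> \<epsilon>'" for x
    proof (cases "\<phi> (x + h) - \<phi> x = 0")
      case False
      then have "norm x \<le> R + 1" by (rule sup)
      moreover from this have "norm (x + h) \<le> R + 2"
        using norm_triangle_ineq[of x h] h by simp
      ultimately have "dist (\<phi> (x + h)) (\<phi> x) < \<epsilon>'"
        using h by (intro \<theta>(2)) (auto simp only: mem_cball_0, auto simp: dist_norm)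
      then show ?thesis by (simp add: dist_real_def)
    qed (use \<epsilon>' in simp)
    then have "\<bar>LINT x|lborel. (\<phi> (x + h) - \<phi> x)\<^sup>2\<bar> \<le> \<epsilon>'\<^sup>2 * V"
      unfolding V_def using \<epsilon>' sup
      by (intro integral_bounded_support) (auto simp: abs_le_square_iff[of _ \<epsilon>', symmetric])
    also have "\<dots> \<le> \<epsilon>'\<^sup>2 * (V + 1)"
      by (intro mult_left_mono) auto
    also have "\<dots> = (\<epsilon> / 3)\<^sup>2"
      using V unfolding \<epsilon>'_def power_divide power_mult_distrib by (simp add: divide_simps)
    finally have "nrm lborel (\<lambda>x. \<phi> (x + h) - \<phi> x) \<le> \<epsilon> / 3"
      using \<epsilon> unfolding nrm_def by (intro real_le_lsqrt) auto
    moreover have "nrm lborel (\<lambda>x. g (x + h) - \<phi> (x + h)) = nrm lborel (\<lambda>x. g x - \<phi> x)"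
      using nrm_translate[of "\<lambda>x. g x - \<phi> x" h] by simp
    moreover have "nrm lborel (\<lambda>x. \<phi> x - g x) = nrm lborel (\<lambda>x. g x - \<phi> x)"
      by (rule nrm_minus_commute)
    moreover have "nrm lborel (\<lambda>x. g (x + h) - g x) \<le>
        nrm lborel (\<lambda>x. g (x + h) - \<phi> (x + h)) + nrm lborel (\<lambda>x. \<phi> (x + h) - g x)"
      by (intro nrm_triangle_diff sq_int_translate g s\<phi>)
    moreover have "nrm lborel (\<lambda>x. \<phi> (x + h) - g x) \<le>
        nrm lborel (\<lambda>x. \<phi> (x + h) - \<phi> x) + nrm lborel (\<lambda>x. \<phi> x - g x)"
      by (intro nrm_triangle_diff sq_int_translate g s\<phi>)
    ultimately show ?thesis
      using \<phi>(4) by linarith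
  qed
  then show ?thesis
    using \<theta>(1) by (intro that[of "min \<theta> 1"]) auto
qed

subsection \<open>The energy of smooth functions\<close>

lemma kernel_product:
  fixes \<rho> :: "'a::euclidean_space \<Rightarrow> real" and f :: "'a \<Rightarrow> real"
  assumes k: "kernel \<rho> \<delta>" and f: "integrable lborel f"
  shows "integrable lborel (\<lambda>p. f (fst p) * (\<rho> (snd p) * (norm (snd p))\<^sup>2))"
    and "(LINT p|lborel. f (fst p) * (\<rho> (snd p) * (norm (snd p))\<^sup>2)) = (LINT x|lborel. f x) * DIM('a)"
  using integrable_lborel_product[OF f kernel_integrable[OF k]]
    integral_lborel_product[OF f kernel_integrable[OF k]] kernel_integral[OF k] by simp_all

lemma integrable_indicator_cball: "integrable lborel (indicator (cball (0::'a::euclidean_space) R) :: 'a \<Rightarrow> real)"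
  using emeasure_lborel_cball_finite[of "0::'a" R] by simp

lemma kernel_product_cball:
  fixes \<rho> :: "'a::euclidean_space \<Rightarrow> real"
  assumes k: "kernel \<rho> \<delta>"
  shows "integrable lborel (\<lambda>p::'a \<times> 'a. c * (indicator (cball 0 R) (fst p) * (\<rho> (snd p) * (norm (snd p))\<^sup>2)))"
    and "(LINT p|(lborel :: ('a \<times> 'a) measure). c * (indicator (cball 0 R) (fst p) * (\<rho> (snd p) * (norm (snd p))\<^sup>2))) =
      c * (measure lborel (cball (0::'a) R) * DIM('a))"
  using kernel_product[OF k integrable_indicator_cball[of R]] by simp_all

text \<open>The Lipschitz bound supplies the factor \<open>(norm z)\<^sup>2\<close>, whose integral
  against the kernel is the dimension. Increments reach beyond the support by at most the horizon,
  hence the ball of radius \<open>R + 1\<close>.\<close>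

lemma diffq_lipschitz:
  fixes w :: "'a::euclidean_space \<Rightarrow> real"
  assumes k: "kernel \<rho> \<delta>" and \<delta>: "\<delta> \<le> 1" and [measurable]: "w \<in> borel_measurable borel"
    and L: "\<And>x z. norm z \<le> 1 \<Longrightarrow> \<bar>w (x + z) - w x\<bar> \<le> L * norm z"
    and R: "\<And>x. w x \<noteq> 0 \<Longrightarrow> norm x \<le> R"
  shows "sq_int lborel (diffq \<rho> w)"
    and "(nrm lborel (diffq \<rho> w))\<^sup>2 \<le> L\<^sup>2 * (measure lborel (cball (0::'a) (R + 1)) * DIM('a))"
proof -
  let ?g = "\<lambda>p::'a \<times> 'a. L\<^sup>2 * (indicator (cball 0 (R + 1)) (fst p) * (\<rho> (snd p) * (norm (snd p))\<^sup>2))"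
  have [measurable]: "\<rho> \<in> borel_measurable borel"
    by (rule kernel_measurable[OF k])
  have le: "(norm (diffq \<rho> w p))\<^sup>2 \<le> ?g p" for p
  proof (cases "\<delta> \<le> norm (snd p) \<or> w (fst p + snd p) = w (fst p)")
    case True
    then show ?thesis
      using kernel_nonneg[OF k, of "snd p"] by (auto simp: diffq_def kernel_eq_0[OF k])
  next
    case False
    obtain x z where p: "p = (x, z)" by (cases p)
    have z: "norm z \<le> 1" using False \<delta> p by auto
    have "norm x \<le> norm (x + z) + norm z"
      by (metis add_diff_cancel_right' norm_triangle_ineq4)
    then have "norm x \<le> R + 1"
      using R[of x] R[of "x + z"] False p z by (cases "w x = 0") auto
    moreover have "\<bar>w (x + z) - w x\<bar>\<^sup>2 \<le> (L * norm z)\<^sup>2"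
      using L[OF z] by (intro power_mono) auto
    then have "\<rho> z * (w (x + z) - w x)\<^sup>2 \<le> \<rho> z * (L * norm z)\<^sup>2"
      using kernel_nonneg[OF k, of z] by (intro mult_left_mono) auto
    ultimately show ?thesis
      using kernel_nonneg[OF k, of z] by (simp add: p diffq_def power_mult_distrib mult_ac)
  qed
  show s: "sq_int lborel (diffq \<rho> w)"
    using le by (intro sq_int_bound[OF _ kernel_product_cball(1)[OF k]]) auto
  have "(nrm lborel (diffq \<rho> w))\<^sup>2 \<le> (LINT p|lborel. ?g p)"
    unfolding nrm_power2 using s le
    by (intro integral_mono kernel_product_cball(1)[OF k]) (auto simp: sq_int_def)
  then show "(nrm lborel (diffq \<rho> w))\<^sup>2 \<le> L\<^sup>2 * (measure lborel (cball (0::'a) (R + 1)) * DIM('a))"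
    by (simp only: kernel_product_cball(2)[OF k])
qed

lemma taylor_nonneg:
  assumes "taylor A p"
  shows "0 \<le> A"
proof -
  have "norm (gradient p 0) \<le> A"
    using assms by (simp add: taylor_def)
  then show ?thesis
    using norm_ge_zero order_trans by blast
qed

lemma taylor_bounds:
  assumes "taylor A p"
  shows "\<bar>gradient p x \<bullet> z\<bar> \<le> A * norm z"
    and "\<bar>p (x + z) - p x - gradient p x \<bullet> z\<bar> \<le> A * (norm z)\<^sup>2"
    and "norm z \<le> 1 \<Longrightarrow> \<bar>p (x + z) - p x\<bar> \<le> 2 * A * norm z"
proof -
  have "\<bar>gradient p x \<bullet> z\<bar> \<le> norm (gradient p x) * norm z"
    by (rule Cauchy_Schwarz_ineq2)
  also have "\<dots> \<le> A * norm z"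
    using assms by (intro mult_right_mono) (auto simp: taylor_def)
  finally show 1: "\<bar>gradient p x \<bullet> z\<bar> \<le> A * norm z" .
  show 2: "\<bar>p (x + z) - p x - gradient p x \<bullet> z\<bar> \<le> A * (norm z)\<^sup>2"
    using assms by (simp add: taylor_def)
  assume "norm z \<le> 1"
  then have "A * (norm z)\<^sup>2 \<le> A * norm z"
    using taylor_nonneg[OF assms] by (intro mult_left_mono) (auto simp: power2_eq_square mult_left_le)
  then show "\<bar>p (x + z) - p x\<bar> \<le> 2 * A * norm z"
    using 1 2 by linarith
qed

text \<open>Replacing the increments by \<open>gradient p x \<bullet> z\<close> and
  \<open>gradient q x \<bullet> z\<close> gives the Dirichlet form exactly, by the normalization of
  the kernel. The replacement costs a term cubic in \<open>norm z\<close>; after the second moment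
  has absorbed two powers, one factor \<open>norm z \<le> \<delta>\<close> remains.\<close>

lemma energy_form_smooth:
  fixes p q :: "'a::euclidean_space \<Rightarrow> real"
  assumes k: "kernel \<rho> \<delta>" and \<delta>: "0 < \<delta>" "\<delta> \<le> 1"
    and smooth: "smooth p" "smooth q" and tp: "taylor A p" and tq: "taylor A q"
    and Rp: "\<And>x. p x \<noteq> 0 \<Longrightarrow> norm x \<le> R" "\<And>x. gradient p x \<noteq> 0 \<Longrightarrow> norm x \<le> R"
    and Rq: "\<And>x. q x \<noteq> 0 \<Longrightarrow> norm x \<le> R"
  shows "\<bar>energy_form \<rho> p q - (LINT x|lborel. gradient p x \<bullet> gradient q x)\<bar>
    \<le> 3 * A\<^sup>2 * (measure lborel (cball (0::'a) (R + 1)) * DIM('a)) * \<delta>"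
proof -
  have [measurable]: "\<rho> \<in> borel_measurable borel" "p \<in> borel_measurable borel" "q \<in> borel_measurable borel"
    "gradient p \<in> borel_measurable borel" "gradient q \<in> borel_measurable borel"
    by (auto intro: kernel_measurable[OF k] smooth_measurable smooth_gradient_measurable smooth)
  have A: "0 \<le> A" by (rule taylor_nonneg[OF tp])
  let ?D = "\<lambda>s. diffq \<rho> p s * diffq \<rho> q s"
  let ?G = "\<lambda>s. \<rho> (snd s) * ((gradient p (fst s) \<bullet> snd s) * (gradient q (fst s) \<bullet> snd s))"
  let ?c = "3 * A\<^sup>2 * \<delta>"
  let ?b = "\<lambda>c (s::'a \<times> 'a). c * (indicator (cball 0 (R + 1)) (fst s) * (\<rho> (snd s) * (norm (snd s))\<^sup>2))"
  have iD: "integrable lborel ?D"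
    using taylor_bounds(3)[OF tp] taylor_bounds(3)[OF tq] Rp(1) Rq
    by (intro integrable_mult_sq_int diffq_lipschitz(1)[OF k \<delta>(2), where L = "2 * A" and R = R]) auto
  have leG: "\<bar>?G s\<bar> \<le> ?b (A\<^sup>2) s" for s
  proof (cases "gradient p (fst s) = 0")
    case False
    then have "norm (fst s) \<le> R + 1" using Rp(2)[of "fst s"] by simp
    moreover have "\<bar>(gradient p (fst s) \<bullet> snd s) * (gradient q (fst s) \<bullet> snd s)\<bar> \<le> (A * norm (snd s)) * (A * norm (snd s))"
      unfolding abs_mult using taylor_bounds(1)[OF tp] taylor_bounds(1)[OF tq] A by (intro mult_mono) auto
    from mult_left_mono[OF this kernel_nonneg[OF k, of "snd s"]]
    have "\<bar>?G s\<bar> \<le> \<rho> (snd s) * ((A * norm (snd s)) * (A * norm (snd s)))"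
      using kernel_nonneg[OF k, of "snd s"] by (simp add: abs_mult)
    ultimately show ?thesis
      by (simp add: power2_eq_square mult_ac)
  qed (use kernel_nonneg[OF k] in simp)
  have iG: "integrable lborel ?G"
    by (rule Bochner_Integration.integrable_bound[OF kernel_product_cball(1)[OF k, of "A\<^sup>2" "R + 1"]])
       (measurable, intro AE_I2, unfold real_norm_def, rule order_trans[OF leG abs_ge_self])
  \<comment> \<open>For fixed \<open>x\<close> the integral over the increment is already
    \<open>gradient p x \<bullet> gradient q x\<close>.\<close>
  have "(LINT s|lborel. ?G s) = (LINT x|lborel. LINT z|lborel. ?G (x, z))"
    by (rule integral_lborel_fst[OF iG])
  also have "\<dots> = (LINT x|lborel. gradient p x \<bullet> gradient q x)"
    using k by (simp add: kernel_def)
  finally have G: "(LINT s|lborel. ?G s) = (LINT x|lborel. gradient p x \<bullet> gradient q x)" .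
  have le: "\<bar>?D s - ?G s\<bar> \<le> ?b ?c s" for s
  proof (cases "\<delta> \<le> norm (snd s)")
    case False
    obtain x z where s: "s = (x, z)" by (cases s)
    have z: "norm z \<le> 1" "norm z \<le> \<delta>" using False \<delta> s by auto
    define a b P Q where ab: "a = p (x + z) - p x" "b = q (x + z) - q x"
      "P = gradient p x \<bullet> z" "Q = gradient q x \<bullet> z"
    have bounds: "\<bar>a\<bar> \<le> 2 * A * norm z" "\<bar>b - Q\<bar> \<le> A * (norm z)\<^sup>2" "\<bar>a - P\<bar> \<le> A * (norm z)\<^sup>2" "\<bar>Q\<bar> \<le> A * norm z"
      using taylor_bounds[OF tp, where x = x and z = z] taylor_bounds[OF tq, where x = x and z = z] z by (simp_all add: ab)
    have zero: "a * b - P * Q = 0" if "\<not> norm x \<le> R + 1"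
    proof -
      have "norm x \<le> norm (x + z) + norm z"
        by (metis add_diff_cancel_right' norm_triangle_ineq4)
      then have "p x = 0" "p (x + z) = 0" "gradient p x = 0"
        using that z Rp(1)[of x] Rp(1)[of "x + z"] Rp(2)[of x] by auto
      then show ?thesis by (simp add: ab)
    qed
    have D: "?D s - ?G s = \<rho> z * (a * b - P * Q)"
    proof -
      have "?D s = (sqrt (\<rho> z) * sqrt (\<rho> z)) * (a * b)"
        by (simp only: s ab diffq_def fst_conv snd_conv mult_ac)
      then show ?thesis
        using kernel_nonneg[OF k, of z] by (simp add: s ab right_diff_distrib)
    qed
    \<comment> \<open>The first product contributes 2, from the factor in the bound on
      \<open>a\<close>, and the second contributes 1: hence the constant 3.\<close>
    have "\<bar>a * b - P * Q\<bar> = \<bar>a * (b - Q) + (a - P) * Q\<bar>"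
      by (simp add: algebra_simps)
    also have "\<dots> \<le> \<bar>a\<bar> * \<bar>b - Q\<bar> + \<bar>a - P\<bar> * \<bar>Q\<bar>"
      using abs_triangle_ineq[of "a * (b - Q)" "(a - P) * Q"] by (simp add: abs_mult)
    also have "\<dots> \<le> (2 * A * norm z) * (A * (norm z)\<^sup>2) + (A * (norm z)\<^sup>2) * (A * norm z)"
      using bounds A by (intro add_mono mult_mono) auto
    also have "\<dots> = 3 * A\<^sup>2 * (norm z)\<^sup>2 * norm z"
      by (simp add: power2_eq_square algebra_simps)
    also have "\<dots> \<le> 3 * A\<^sup>2 * (norm z)\<^sup>2 * \<delta>"
      using z by (intro mult_left_mono) auto
    finally have "\<bar>?D s - ?G s\<bar> \<le> \<rho> z * (3 * A\<^sup>2 * (norm z)\<^sup>2 * \<delta>)"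
      unfolding D abs_mult using kernel_nonneg[OF k, of z] by (simp add: mult_left_mono)
    then show ?thesis
      using zero D by (cases "norm x \<le> R + 1") (auto simp: s mult_ac)
  qed (simp add: diffq_def kernel_eq_0[OF k])
  have "\<bar>energy_form \<rho> p q - (LINT x|lborel. gradient p x \<bullet> gradient q x)\<bar> = \<bar>LINT s|lborel. ?D s - ?G s\<bar>"
    using iD iG by (simp add: energy_form_def G)
  also have "\<dots> \<le> (LINT s|lborel. \<bar>?D s - ?G s\<bar>)"
    by (rule integral_abs_bound)
  also have "\<dots> \<le> (LINT s|lborel. ?b ?c s)"
    by (intro integral_mono integrable_abs Bochner_Integration.integrable_diff iD iG kernel_product_cball(1)[OF k] le)
  finally show ?thesis
    unfolding kernel_product_cball(2)[OF k] by (simp add: mult_ac)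
qed

lemma test_function_diffq_sq_int:
  fixes \<phi> :: "'a::euclidean_space \<Rightarrow> real"
  assumes "kernel \<rho> \<delta>" "\<delta> \<le> 1" "test_function \<Omega> \<phi>"
  shows "sq_int lborel (diffq \<rho> \<phi>)"
proof -
  obtain R where "\<And>x. \<phi> x \<noteq> 0 \<Longrightarrow> norm x \<le> R"
    using test_function_support[OF assms(3)] by metis
  moreover obtain A where "taylor A \<phi>"
    using test_function_taylor[OF assms(3)] by metis
  ultimately show ?thesis
    using diffq_lipschitz(1)[OF assms(1,2) test_function_measurable[OF assms(3)], of "2 * A" R]
      taylor_bounds(3)[of A \<phi>] by blast
qed

lemma energy_form_test_tendsto:
  fixes \<phi> :: "'a::euclidean_space \<Rightarrow> real"
  assumes k: "\<And>j. kernel (\<rho> j) (d j)" and d: "\<And>j. 0 < d j" "d \<longlonglongrightarrow> 0" and \<phi>: "test_function \<Omega> \<phi>"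
  shows "(\<lambda>j. energy_form (\<rho> j) \<phi> \<phi>) \<longlonglongrightarrow> (nrm lborel (gradient \<phi>))\<^sup>2"
proof -
  obtain R where R: "\<And>x. \<phi> x \<noteq> 0 \<Longrightarrow> norm x \<le> R" "\<And>x. gradient \<phi> x \<noteq> 0 \<Longrightarrow> norm x \<le> R"
    using test_function_support[OF \<phi>] by metis
  obtain A where A: "taylor A \<phi>"
    using test_function_taylor[OF \<phi>] by metis
  let ?C = "3 * A\<^sup>2 * (measure lborel (cball (0::'a) (R + 1)) * DIM('a))"
  have "(\<lambda>j. energy_form (\<rho> j) \<phi> \<phi> - (nrm lborel (gradient \<phi>))\<^sup>2) \<longlonglongrightarrow> 0"
  proof (rule Lim_null_comparison)
    have "\<forall>\<^sub>F j in sequentially. d j < 1"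
      using d(2) by (rule order_tendstoD) simp
    then show "\<forall>\<^sub>F j in sequentially. norm (energy_form (\<rho> j) \<phi> \<phi> - (nrm lborel (gradient \<phi>))\<^sup>2) \<le> ?C * d j"
    proof eventually_elim
      case (elim j)
      have "\<bar>energy_form (\<rho> j) \<phi> \<phi> - (LINT x|lborel. gradient \<phi> x \<bullet> gradient \<phi> x)\<bar> \<le> ?C * d j"
        using elim by (intro energy_form_smooth[OF k d(1)] test_function_smooth[OF \<phi>] A R) auto
      then show ?case
        by (simp add: nrm_power2 power2_norm_eq_inner)
    qed
    show "(\<lambda>j. ?C * d j) \<longlonglongrightarrow> 0"
      using tendsto_mult_left[OF d(2), of ?C] by simp
  qed
  then show ?thesis
    by (simp add: LIM_zero_iff)
qed

subsection \<open>Localization and mollification of functions of finite energy\<close>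

text \<open>Discrete product rule: the increment of the product is \<open>\<zeta> (x + z)\<close>
  times the increment of \<open>w\<close> plus \<open>w x\<close> times the increment of
  \<open>\<zeta>\<close>. The second term is paid for by the Lipschitz bound and the second moment,
  so it costs only the norm of \<open>w\<close>.\<close>

lemma diffq_cutoff:
  fixes w \<zeta> :: "'a::euclidean_space \<Rightarrow> real"
  assumes k: "kernel \<rho> \<delta>" and w: "sq_int lborel w" "sq_int lborel (diffq \<rho> w)"
    and [measurable]: "\<zeta> \<in> borel_measurable borel" and \<zeta>: "\<And>x. \<bar>\<zeta> x\<bar> \<le> 1" "\<And>x z. \<bar>\<zeta> (x + z) - \<zeta> x\<bar> \<le> L * norm z"
  shows "sq_int lborel (\<lambda>x. \<zeta> x * w x)" and "nrm lborel (\<lambda>x. \<zeta> x * w x) \<le> nrm lborel w"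
    and "sq_int lborel (diffq \<rho> (\<lambda>x. \<zeta> x * w x))"
    and "(nrm lborel (diffq \<rho> (\<lambda>x. \<zeta> x * w x)))\<^sup>2 \<le>
      2 * (nrm lborel (diffq \<rho> w))\<^sup>2 + 2 * L\<^sup>2 * DIM('a) * (nrm lborel w)\<^sup>2"
proof -
  have [measurable]: "\<rho> \<in> borel_measurable borel" "w \<in> borel_measurable borel"
    using w by (auto simp: sq_int_def intro: kernel_measurable[OF k])
  have iw: "integrable lborel (\<lambda>x. (w x)\<^sup>2)" "integrable lborel (\<lambda>p. (diffq \<rho> w p)\<^sup>2)"
    using w by (simp_all add: sq_int_def)
  have le: "norm (\<zeta> x * w x) \<le> norm (w x)" for x
    using \<zeta>(1)[of x] by (simp add: abs_mult mult_left_le_one_le)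
  show s: "sq_int lborel (\<lambda>x. \<zeta> x * w x)"
  proof (rule sq_int_bound[OF _ iw(1)])
    show "(norm (\<zeta> x * w x))\<^sup>2 \<le> (w x)\<^sup>2" for x
      using power_mono[OF le[of x], of 2] by simp
  qed measurable
  show "nrm lborel (\<lambda>x. \<zeta> x * w x) \<le> nrm lborel w"
    by (intro nrm_mono s w(1) le)
  let ?b = "\<lambda>p. 2 * (diffq \<rho> w p)\<^sup>2 + 2 * L\<^sup>2 * ((w (fst p))\<^sup>2 * (\<rho> (snd p) * (norm (snd p))\<^sup>2))"
  have ib: "integrable lborel ?b"
    using iw(2) kernel_product(1)[OF k iw(1)]
    by (intro Bochner_Integration.integrable_add integrable_mult_right)
  have bd: "(norm (diffq \<rho> (\<lambda>x. \<zeta> x * w x) p))\<^sup>2 \<le> ?b p" for p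
  proof -
    obtain x z where p: "p = (x, z)" by (cases p)
    have "diffq \<rho> (\<lambda>x. \<zeta> x * w x) p = \<zeta> (x + z) * diffq \<rho> w p + sqrt (\<rho> z) * (\<zeta> (x + z) - \<zeta> x) * w x"
      by (simp add: diffq_def p algebra_simps)
    then have "(norm (diffq \<rho> (\<lambda>x. \<zeta> x * w x) p))\<^sup>2 \<le>
        2 * (norm (\<zeta> (x + z) * diffq \<rho> w p))\<^sup>2 + 2 * (norm (sqrt (\<rho> z) * (\<zeta> (x + z) - \<zeta> x) * w x))\<^sup>2"
      by (simp only: norm_add_sq_le)
    also have "(norm (\<zeta> (x + z) * diffq \<rho> w p))\<^sup>2 \<le> (diffq \<rho> w p)\<^sup>2"
      using \<zeta>(1)[of "x + z"] by (simp add: power_mult_distrib abs_square_le_1 mult_left_le_one_le)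
    also have "(norm (sqrt (\<rho> z) * (\<zeta> (x + z) - \<zeta> x) * w x))\<^sup>2 = \<rho> z * (w x)\<^sup>2 * \<bar>\<zeta> (x + z) - \<zeta> x\<bar>\<^sup>2"
      using kernel_nonneg[OF k, of z] by (simp add: power_mult_distrib)
    also have "\<dots> \<le> \<rho> z * (w x)\<^sup>2 * (L * norm z)\<^sup>2"
      using kernel_nonneg[OF k, of z] \<zeta>(2)[of x z] by (intro mult_left_mono power_mono) auto
    finally show ?thesis
      by (simp add: p power_mult_distrib mult_ac)
  qed
  show s2: "sq_int lborel (diffq \<rho> (\<lambda>x. \<zeta> x * w x))"
    using bd by (intro sq_int_bound[OF _ ib]) auto
  have "(nrm lborel (diffq \<rho> (\<lambda>x. \<zeta> x * w x)))\<^sup>2 \<le> (LINT p|lborel. ?b p)"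
    unfolding nrm_power2[of lborel "diffq \<rho> (\<lambda>x. \<zeta> x * w x)"] using s2 bd
    by (intro integral_mono ib) (auto simp: sq_int_def)
  also have "\<dots> = 2 * (nrm lborel (diffq \<rho> w))\<^sup>2 + 2 * L\<^sup>2 * ((LINT x|lborel. (w x)\<^sup>2) * DIM('a))"
    using iw(2) kernel_product[OF k iw(1)] by (simp add: nrm_power2)
  finally show "(nrm lborel (diffq \<rho> (\<lambda>x. \<zeta> x * w x)))\<^sup>2 \<le>
      2 * (nrm lborel (diffq \<rho> w))\<^sup>2 + 2 * L\<^sup>2 * DIM('a) * (nrm lborel w)\<^sup>2"
    by (simp add: nrm_power2 mult_ac)
qed

text \<open>Translating a function amounts to translating the base points of pairs, so averaging
  over translates commutes with taking difference quotients.\<close>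

lemma diffq_translate: "diffq \<rho> (\<lambda>x. w (x + h)) p = diffq \<rho> w (p + (h, 0))"
  by (simp add: diffq_def algebra_simps)

context
  fixes \<eta> w \<rho> :: "'a::euclidean_space \<Rightarrow> real" and \<delta> :: real
  assumes \<eta>: "test_function UNIV \<eta>" "\<And>h. 0 \<le> \<eta> h" "(LINT h|lborel. \<eta> h) = 1"
    and w: "sq_int lborel w" "integrable lborel w"
begin

lemma
  shows mollifier_integrable: "integrable lborel \<eta>"
    and mollifier_measurable: "\<eta> \<in> borel_measurable borel"
    and mollified_measurable: "w \<in> borel_measurable borel"
  using \<eta> w by (auto intro: test_function_integrable test_function_measurable simp: sq_int_def)

declare mollifier_measurable [measurable] mollified_measurable [measurable]

text \<open>A change of variables moves the shift from \<open>w\<close> to \<open>g\<close>. The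
  error thus depends on \<open>w\<close> only through its norm, which makes it uniform along a
  bounded sequence while \<open>g\<close> stays fixed.\<close>

lemma conv_inner_close:
  assumes g: "sq_int lborel g"
    and close: "\<And>h. \<eta> h \<noteq> 0 \<Longrightarrow> nrm lborel (\<lambda>x. g (x + h) - g x) \<le> \<epsilon>"
  shows "\<bar>(LINT x|lborel. g x * conv \<eta> w x) - (LINT x|lborel. g x * w x)\<bar> \<le> \<epsilon> * nrm lborel w"
proof -
  have [measurable]: "g \<in> borel_measurable borel"
    using g by (simp add: sq_int_def)
  have W: "sq_int lborel (\<lambda>x. w (x - h))" "nrm lborel (\<lambda>x. w (x - h)) \<le> nrm lborel w" for h
    using sq_int_translate[OF w(1), of "- h"] nrm_translate[of w "- h"] by simp_all
  note avg = average_sq_int[where W = "\<lambda>h x. w (x - h)" and \<eta> = \<eta> and C = "nrm lborel w",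
    OF _ _ \<eta>(2) mollifier_integrable \<eta>(3) W]
  have 1: "(LINT x|lborel. g x * conv \<eta> w x) = (LINT h|lborel. \<eta> h * (LINT x|lborel. g x * w (x - h)))"
    by (subst conv_eq) (auto intro!: avg(4) g)
  show ?thesis
    unfolding 1
  proof (rule average_close[OF \<eta>(2) mollifier_integrable \<eta>(3)])
    show "integrable lborel (\<lambda>h. \<eta> h * (LINT x|lborel. g x * w (x - h)))"
      by (intro avg(3) g) auto
    fix h assume h: "\<eta> h \<noteq> 0"
    have "(LINT x|lborel. g x * w (x - h)) = (LINT x|lborel. g (x + h) * w x)"
      using lborel_translate(2)[of "\<lambda>x. g x * w (x - h)" h] by simp
    then have "(LINT x|lborel. g x * w (x - h)) - (LINT x|lborel. g x * w x) =
        (LINT x|lborel. (g (x + h) - g x) \<bullet> w x)"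
      using integrable_mult_sq_int[OF sq_int_translate[OF g, of h] w(1)] integrable_mult_sq_int[OF g w(1)]
      by (simp add: left_diff_distrib)
    also have "\<bar>\<dots>\<bar> \<le> nrm lborel (\<lambda>x. g (x + h) - g x) * nrm lborel w"
      by (intro Cauchy_Schwarz_integral sq_int_diff sq_int_translate g w)
    also have "\<dots> \<le> \<epsilon> * nrm lborel w"
      by (intro mult_right_mono close h) simp
    finally show "\<bar>(LINT x|lborel. g x * w (x - h)) - (LINT x|lborel. g x * w x)\<bar> \<le> \<epsilon> * nrm lborel w" .
  qed
qed

context
  assumes k: "kernel \<rho> \<delta>" and dw: "sq_int lborel (diffq \<rho> w)"
begin

lemma conv_diffq: "diffq \<rho> (conv \<eta> w) p = (LINT h|lborel. \<eta> h * diffq \<rho> w (p + (- h, 0)))"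
proof -
  obtain B where B: "\<And>x. \<bar>\<eta> x\<bar> \<le> B"
    using test_function_bounded[OF \<eta>(1)] by metis
  have int: "integrable lborel (\<lambda>h. \<eta> h * w (x - h))" for x
  proof -
    have "integrable (distr lborel borel (\<lambda>h. x - h)) w"
      using w(2) by (simp add: distr_lborel_reflect)
    then have "integrable lborel (\<lambda>h. w (x - h))"
      by (subst (asm) integrable_distr_eq) auto
    from integrable_scaleR_bounded(1)[OF mollifier_measurable _ this, of B] show ?thesis
      using B by (simp add: mult.commute)
  qed
  obtain x z where p: "p = (x, z)" by (cases p)
  have "diffq \<rho> (conv \<eta> w) p = sqrt (\<rho> z) * ((LINT h|lborel. \<eta> h * w (x + z - h)) - (LINT h|lborel. \<eta> h * w (x - h)))"
    by (simp add: diffq_def p conv_eq)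
  also have "\<dots> = sqrt (\<rho> z) * (LINT h|lborel. \<eta> h * w (x + z - h) - \<eta> h * w (x - h))"
    using int by simp
  also have "\<dots> = (LINT h|lborel. sqrt (\<rho> z) * (\<eta> h * w (x + z - h) - \<eta> h * w (x - h)))"
    by simp
  also have "\<dots> = (LINT h|lborel. \<eta> h * diffq \<rho> w (p + (- h, 0)))"
    by (intro Bochner_Integration.integral_cong) (auto simp: diffq_def p algebra_simps)
  finally show ?thesis .
qed

lemma diffq_W:
  "sq_int lborel (\<lambda>p. diffq \<rho> w (p + (- h, 0)))" "nrm lborel (\<lambda>p. diffq \<rho> w (p + (- h, 0))) \<le> nrm lborel (diffq \<rho> w)"
  using sq_int_translate[OF dw, of "(- h, 0)"] nrm_translate[OF sq_int_measurable[OF dw, simplified], of "(- h, 0)"]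
  by simp_all

lemma diffq_W_measurable:
  "(\<lambda>q. diffq \<rho> w (snd q + (- fst q, 0))) \<in> borel_measurable (borel :: ('a \<times> ('a \<times> 'a)) measure)"
proof -
  have [measurable]: "\<rho> \<in> borel_measurable borel"
    by (rule kernel_measurable[OF k])
  have "(\<lambda>q. snd q + (- fst q, 0)) \<in> borel \<rightarrow>\<^sub>M (borel :: ('a \<times> 'a) measure)"
    by (intro borel_measurable_continuous_onI continuous_intros)
  from measurable_compose[OF this diffq_measurable] show ?thesis
    by simp
qed

lemmas diffq_average = average_sq_int[where W = "\<lambda>h p. diffq \<rho> w (p + (- h, 0))" and \<eta> = \<eta>,
    OF mollifier_measurable diffq_W_measurable \<eta>(2) mollifier_integrable \<eta>(3) diffq_W]

lemma conv_diffq_sq_int: "sq_int lborel (diffq \<rho> (conv \<eta> w))"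
  and conv_diffq_nrm: "nrm lborel (diffq \<rho> (conv \<eta> w)) \<le> nrm lborel (diffq \<rho> w)"
  using diffq_average(1,2) by (simp_all add: conv_diffq[abs_def])

text \<open>The same transfer of the shift to \<open>g\<close> as in
  \<open>conv_inner_close\<close>, carried out on pairs by translating base points.\<close>

lemma conv_energy_close:
  assumes g: "sq_int lborel (diffq \<rho> g)" and [measurable]: "g \<in> borel_measurable borel"
    and close: "\<And>h. \<eta> h \<noteq> 0 \<Longrightarrow> nrm lborel (diffq \<rho> (\<lambda>x. g (x + h) - g x)) \<le> \<epsilon>"
  shows "\<bar>energy_form \<rho> g (conv \<eta> w) - energy_form \<rho> g w\<bar> \<le> \<epsilon> * nrm lborel (diffq \<rho> w)"
proof -
  have [measurable]: "\<rho> \<in> borel_measurable borel"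
    by (rule kernel_measurable[OF k])
  have 1: "energy_form \<rho> g (conv \<eta> w) = (LINT h|lborel. \<eta> h * (LINT p|lborel. diffq \<rho> g p * diffq \<rho> w (p + (- h, 0))))"
    unfolding energy_form_def conv_diffq by (rule diffq_average(4)[OF g])
  have g': "sq_int lborel (diffq \<rho> (\<lambda>x. g (x + h)))" for h
    using sq_int_translate[OF g, of "(h, 0)"] by (simp add: diffq_translate[abs_def])
  show ?thesis
    unfolding 1
  proof (rule average_close[OF \<eta>(2) mollifier_integrable \<eta>(3) diffq_average(3)[OF g]])
    fix h assume h: "\<eta> h \<noteq> 0"
    have "(LINT p|lborel. diffq \<rho> g p * diffq \<rho> w (p + (- h, 0))) = energy_form \<rho> (\<lambda>x. g (x + h)) w"
      using lborel_translate(2)[of "\<lambda>p. diffq \<rho> g p * diffq \<rho> w (p + (- h, 0))" "(h, 0)"]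
      by (simp add: energy_form_def diffq_translate add.assoc zero_prod_def[symmetric])
    then have "(LINT p|lborel. diffq \<rho> g p * diffq \<rho> w (p + (- h, 0))) - energy_form \<rho> g w =
        energy_form \<rho> w (\<lambda>x. g (x + h) - g x)"
      by (simp add: energy_form_diff_right[OF dw g' g] energy_form_commute[of \<rho> w])
    also have "\<bar>\<dots>\<bar> \<le> nrm lborel (diffq \<rho> w) * nrm lborel (diffq \<rho> (\<lambda>x. g (x + h) - g x))"
      by (intro energy_form_Cauchy_Schwarz dw sq_int_diffq_diff g g')
    also have "\<dots> \<le> nrm lborel (diffq \<rho> w) * \<epsilon>"
      by (intro mult_left_mono close h) simp
    finally show "\<bar>(LINT p|lborel. diffq \<rho> g p * diffq \<rho> w (p + (- h, 0))) - energy_form \<rho> g w\<bar>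
        \<le> \<epsilon> * nrm lborel (diffq \<rho> w)"
      by (simp add: mult.commute)
  qed
qed

end

end

subsection \<open>Integrals over open sets\<close>

lemma
  fixes h :: "'a::euclidean_space \<Rightarrow> 'b::euclidean_space"
  assumes [measurable]: "h \<in> borel_measurable borel" "S \<in> sets borel"
  shows integral_lebesgue_on_lborel: "(LINT x|lebesgue_on S. h x) = (LINT x|lborel. indicator S x *\<^sub>R h x)"
    and integrable_lebesgue_on_lborel: "integrable (lebesgue_on S) h \<longleftrightarrow> integrable lborel (\<lambda>x. indicator S x *\<^sub>R h x)"
proof -
  have m: "(\<lambda>x. indicator S x *\<^sub>R h x) \<in> borel_measurable lborel"
    by measurable
  have S: "S \<inter> space lebesgue \<in> sets lebesgue"
    using assms(2) by (simp add: sets_completionI_sets)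
  show "(LINT x|lebesgue_on S. h x) = (LINT x|lborel. indicator S x *\<^sub>R h x)"
    by (simp add: integral_restrict_space[OF S] integral_completion[OF m])
  show "integrable (lebesgue_on S) h \<longleftrightarrow> integrable lborel (\<lambda>x. indicator S x *\<^sub>R h x)"
    by (simp add: integrable_restrict_space[OF S] integrable_completion[OF m])
qed

lemma indicator_scaleR_absorb:
  fixes h :: "'a \<Rightarrow> 'b::real_vector"
  assumes "\<And>x. x \<notin> S \<Longrightarrow> h x = 0"
  shows "indicator S x *\<^sub>R h x = h x"
  using assms by (cases "x \<in> S") auto

lemma
  fixes h :: "'a::euclidean_space \<Rightarrow> 'b::euclidean_space"
  assumes "h \<in> borel_measurable borel" "open S" "\<And>x. x \<notin> S \<Longrightarrow> h x = 0"
  shows integral_lebesgue_on_support: "(LINT x|lebesgue_on S. h x) = (LINT x|lborel. h x)"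
    and integrable_lebesgue_on_support: "integrable (lebesgue_on S) h \<longleftrightarrow> integrable lborel h"
  using integral_lebesgue_on_lborel[OF assms(1), of S] integrable_lebesgue_on_lborel[OF assms(1), of S]
    assms(2) by (simp_all add: indicator_scaleR_absorb[of S h, OF assms(3)])

lemma borel_measurable_lebesgue_onI:
  "h \<in> borel_measurable borel \<Longrightarrow> h \<in> borel_measurable (lebesgue_on S)"
  by (intro measurable_restrict_space1 measurable_completion) simp

lemma
  fixes h :: "'a::euclidean_space \<Rightarrow> 'b::euclidean_space"
  assumes h: "h \<in> borel_measurable borel" and S: "open S" "\<And>x. x \<notin> S \<Longrightarrow> h x = 0"
  shows sq_int_lebesgue_on_support: "sq_int (lebesgue_on S) h \<longleftrightarrow> sq_int lborel h"
    and nrm_lebesgue_on_support: "nrm (lebesgue_on S) h = nrm lborel h"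
proof -
  have m: "(\<lambda>x. (norm (h x))\<^sup>2) \<in> borel_measurable borel"
    using h by measurable
  show "sq_int (lebesgue_on S) h \<longleftrightarrow> sq_int lborel h"
    using integrable_lebesgue_on_support[OF m S(1)] S(2) h by (auto simp: sq_int_def borel_measurable_lebesgue_onI)
  show "nrm (lebesgue_on S) h = nrm lborel h"
    using integral_lebesgue_on_support[OF m S(1)] S(2) by (simp add: nrm_def)
qed

subsection \<open>Asymptotic consistency\<close>

text \<open>One vector \<open>a\<close> serves all of \<open>K\<close>, and it can be taken
  arbitrarily short. The margin \<open>r\<close> is room for a mollifier: a single convolution with
  a mollifier centred at \<open>a\<close> carries functions supported in \<open>K\<close> to test
  functions of \<Omega>.\<close>

definition shiftable :: "'a::euclidean_space set \<Rightarrow> 'a set \<Rightarrow> bool" where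
  "shiftable \<Omega> K \<longleftrightarrow> (\<forall>\<tau>>0. \<exists>a r. 0 < r \<and> norm a + r \<le> \<tau> \<and>
     (\<forall>x\<in>K. \<forall>b. norm b \<le> r \<longrightarrow> x + a + b \<in> \<Omega>))"

text \<open>The local problem enters only through \<open>G_eq\<close>, the equation tested with test
  functions. \<open>f\<close> lives on the whole space, in anticipation of an extension by zero, and
  \<open>d j \<le> 1\<close> is arranged by dropping initial terms of a null sequence.\<close>

locale vanishing_horizon =
  fixes \<Omega> :: "'a::euclidean_space set" and f :: "'a \<Rightarrow> real" and G :: "'a \<Rightarrow> 'a"
    and \<rho> :: "nat \<Rightarrow> 'a \<Rightarrow> real" and d :: "nat \<Rightarrow> real"
  assumes \<Omega>: "open \<Omega>" "bounded \<Omega>"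
    and f: "sq_int lborel f"
    and G: "sq_int (lebesgue_on \<Omega>) G"
    and G_eq: "\<And>\<phi>. test_function \<Omega> \<phi> \<Longrightarrow>
      (LINT x|lebesgue_on \<Omega>. G x \<bullet> gradient \<phi> x) = (LINT x|lborel. f x * \<phi> x)"
    and kernel: "\<And>j. kernel (\<rho> j) (d j)"
    and d: "\<And>j. 0 < d j" "\<And>j. d j \<le> 1" "d \<longlonglongrightarrow> 0"
begin

definition bounded_energy :: "(nat \<Rightarrow> 'a \<Rightarrow> real) \<Rightarrow> bool" where
  "bounded_energy w \<longleftrightarrow>
     (\<exists>C. \<forall>j. sq_int lborel (w j) \<and> sq_int lborel (diffq (\<rho> j) (w j)) \<and>
        nrm lborel (w j) \<le> C \<and> nrm lborel (diffq (\<rho> j) (w j)) \<le> C) \<and>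
     (\<forall>j x. w j x \<noteq> 0 \<longrightarrow> x \<in> \<Omega>)"

text \<open>\<open>C\<close> may depend on \<open>w\<close> but not on \<open>\<psi>\<close> or
  \<open>\<epsilon>\<close>, while the threshold for \<open>j\<close> may depend on all of them.
  When \<open>gradient \<psi>\<close> is close to \<open>G\<close> the right-hand side is small, and
  the property is stable under sums of sequences.\<close>

definition consistent :: "(nat \<Rightarrow> 'a \<Rightarrow> real) \<Rightarrow> bool" where
  "consistent w \<longleftrightarrow> (\<exists>C. \<forall>\<psi> \<epsilon>. test_function \<Omega> \<psi> \<longrightarrow> 0 < \<epsilon> \<longrightarrow>
     (\<forall>\<^sub>F j in sequentially. \<bar>(LINT x|lborel. f x * w j x) - energy_form (\<rho> j) \<psi> (w j)\<bar>
        \<le> C * nrm (lebesgue_on \<Omega>) (\<lambda>x. gradient \<psi> x - G x) + \<epsilon>))"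

lemma test_function_gradient_lebesgue_on:
  assumes "test_function \<Omega> \<phi>"
  shows "sq_int (lebesgue_on \<Omega>) (gradient \<phi>)"
    and "nrm (lebesgue_on \<Omega>) (gradient \<phi>) = nrm lborel (gradient \<phi>)"
    and "test_function \<Omega> \<psi> \<Longrightarrow> (LINT x|lebesgue_on \<Omega>. gradient \<psi> x \<bullet> gradient \<phi> x) = (LINT x|lborel. gradient \<psi> x \<bullet> gradient \<phi> x)"
proof -
  have [measurable]: "gradient \<phi> \<in> borel_measurable borel"
    by (rule test_function_gradient_measurable[OF assms])
  have 0: "\<And>x. x \<notin> \<Omega> \<Longrightarrow> gradient \<phi> x = 0"
    by (rule test_function_gradient_eq_0[OF assms])
  show "sq_int (lebesgue_on \<Omega>) (gradient \<phi>)"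
    using test_function_sq_int(2)[OF assms] by (subst sq_int_lebesgue_on_support) (auto simp: \<Omega> 0)
  show "nrm (lebesgue_on \<Omega>) (gradient \<phi>) = nrm lborel (gradient \<phi>)"
    by (rule nrm_lebesgue_on_support) (auto simp: \<Omega> 0)
  assume "test_function \<Omega> \<psi>"
  then have [measurable]: "gradient \<psi> \<in> borel_measurable borel"
    by (rule test_function_gradient_measurable)
  show "(LINT x|lebesgue_on \<Omega>. gradient \<psi> x \<bullet> gradient \<phi> x) = (LINT x|lborel. gradient \<psi> x \<bullet> gradient \<phi> x)"
    by (rule integral_lebesgue_on_support) (auto simp: \<Omega> 0)
qed

text \<open>In both terms \<open>w j\<close> is replaced by its shifted mollification
  \<open>\<phi> j\<close>; for \<open>\<phi> j\<close> the energy is close to the Dirichlet form,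
  and the local equation turns \<open>f\<close> into \<open>G\<close>. The mollifier is fixed before
  \<open>j\<close> grows, so all constants are uniform in \<open>j\<close>. Four errors of
  \<open>\<epsilon> / 4\<close> add up, besides the term from
  \<open>gradient \<psi> - G\<close>.\<close>

lemma consistent_shiftable:
  assumes w: "bounded_energy w" and K: "\<And>j x. w j x \<noteq> 0 \<Longrightarrow> x \<in> K" and sh: "shiftable \<Omega> K" and K\<Omega>: "K \<subseteq> \<Omega>"
  shows "consistent w"
proof -
  obtain C where C: "\<And>j. sq_int lborel (w j)" "\<And>j. sq_int lborel (diffq (\<rho> j) (w j))"
      "\<And>j. nrm lborel (w j) \<le> C" "\<And>j. nrm lborel (diffq (\<rho> j) (w j)) \<le> C"
    using w unfolding bounded_energy_def by blast
  have C0: "0 \<le> C" using C(3)[of 0] nrm_nonneg order_trans by blast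
  obtain R where R: "0 < R" "\<And>x. x \<in> \<Omega> \<Longrightarrow> norm x \<le> R"
    using \<Omega>(2) unfolding bounded_pos by blast
  have supp: "norm x \<le> R" if "w j x \<noteq> 0" for j x
    using K[OF that] K\<Omega> R(2) by blast
  \<comment> \<open>A uniform \<open>L^1\<close> bound; through \<open>conv_taylor\<close> it makes
    the Taylor constants of the mollified functions independent of \<open>j\<close>.\<close>
  define M where "M = C * sqrt (measure lborel (cball (0::'a) R))"
  have iw: "integrable lborel (w j)" and M: "(LINT x|lborel. \<bar>w j x\<bar>) \<le> M" for j
  proof -
    show "integrable lborel (w j)"
      by (rule integrable_sq_int_bounded_support[OF C(1) supp])
    have "(LINT x|lborel. \<bar>w j x\<bar>) \<le> nrm lborel (w j) * sqrt (measure lborel (cball (0::'a) R))"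
      by (rule integrable_sq_int_bounded_support[OF C(1) supp])
    also have "\<dots> \<le> M"
      unfolding M_def by (intro mult_right_mono C) simp
    finally show "(LINT x|lborel. \<bar>w j x\<bar>) \<le> M" .
  qed
  show ?thesis
    unfolding consistent_def
  proof (intro exI[of _ C] allI impI)
    fix \<psi> :: "'a \<Rightarrow> real" and \<epsilon> :: real
    assume \<psi>: "test_function \<Omega> \<psi>" and \<epsilon>: "0 < \<epsilon>"
    define \<kappa> where "\<kappa> = nrm (lebesgue_on \<Omega>) (\<lambda>x. gradient \<psi> x - G x)"
    have \<kappa>: "0 \<le> \<kappa>" by (simp add: \<kappa>_def)
    \<comment> \<open>The translation error allowed for \<open>f\<close> and for the difference
      quotients of \<open>\<psi>\<close>; the added 1 covers \<open>C = 0\<close>.\<close>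
    define \<epsilon>1 where "\<epsilon>1 = \<epsilon> / (4 * (C + 1))"
    have \<epsilon>1: "0 < \<epsilon>1" "\<epsilon>1 * C \<le> \<epsilon> / 4"
      using C0 \<epsilon> by (auto simp: \<epsilon>1_def divide_simps mult_left_le)
    \<comment> \<open>Used twice: as the gap between energy and Dirichlet form, and through its
      square root as the excess in the gradient norm, which gets multiplied by
      \<open>\<kappa>\<close>.\<close>
    define \<epsilon>4 where "\<epsilon>4 = min (\<epsilon> / 4) ((\<epsilon> / (4 * (\<kappa> + 1)))\<^sup>2)"
    have \<epsilon>4: "0 < \<epsilon>4" "\<epsilon>4 \<le> \<epsilon> / 4"
      using \<kappa> \<epsilon> by (auto simp: \<epsilon>4_def)
    have \<epsilon>4': "\<kappa> * sqrt \<epsilon>4 \<le> \<epsilon> / 4"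
    proof -
      have "sqrt \<epsilon>4 \<le> \<epsilon> / (4 * (\<kappa> + 1))"
        using \<kappa> \<epsilon> by (intro real_le_lsqrt) (auto simp: \<epsilon>4_def)
      then have "\<kappa> * sqrt \<epsilon>4 \<le> \<kappa> * (\<epsilon> / (4 * (\<kappa> + 1)))"
        using \<kappa> by (intro mult_left_mono)
      also have "\<dots> \<le> \<epsilon> / 4"
        using \<kappa> \<epsilon> by (simp add: divide_simps)
      finally show ?thesis .
    qed
    obtain R\<psi> where R\<psi>: "0 < R\<psi>" "\<And>x. \<psi> x \<noteq> 0 \<Longrightarrow> norm x \<le> R\<psi>" "\<And>x. gradient \<psi> x \<noteq> 0 \<Longrightarrow> norm x \<le> R\<psi>"
      using test_function_support[OF \<psi>] by metis
    obtain B where B: "0 < B" "\<And>x y. norm (gradient \<psi> y - gradient \<psi> x) \<le> B * norm (y - x)"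
      using test_function_gradient_lipschitz[OF \<psi>] by metis
    define V where "V = measure lborel (cball (0::'a) (R\<psi> + 1 + 1)) * DIM('a)"
    have V: "0 \<le> V" by (simp add: V_def)
    \<comment> \<open>The Lipschitz constant allowed for \<open>\<psi> (x + h) - \<psi> x\<close>:
      by \<open>diffq_lipschitz\<close> the energy norm of this difference is then at most
      \<open>\<epsilon>1\<close>. In the radius \<open>R\<psi> + 1 + 1\<close> of \<open>V\<close>
      one unit is for \<open>h\<close> and one for the increment.\<close>
    define \<epsilon>2 where "\<epsilon>2 = \<epsilon>1 / sqrt (V + 1)"
    have \<epsilon>2: "0 < \<epsilon>2" "\<epsilon>2\<^sup>2 * V \<le> \<epsilon>1\<^sup>2"
      using \<epsilon>1 V by (auto simp: \<epsilon>2_def power_divide divide_simps mult_left_mono)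
    obtain \<theta> where \<theta>: "0 < \<theta>" "\<And>h. norm h < \<theta> \<Longrightarrow> nrm lborel (\<lambda>x. f (x + h) - f x) \<le> \<epsilon>1"
      using nrm_translate_continuous[OF f \<epsilon>1(1)] by metis
    \<comment> \<open>Shifts shorter than this move \<open>f\<close> by at most
      \<open>\<epsilon>1\<close>, and they change \<open>gradient \<psi>\<close> by at most
      \<open>B * \<tau>\<close>, hence by at most \<open>\<epsilon>2\<close>.\<close>
    define \<tau> where "\<tau> = min 1 (min \<theta> (\<epsilon>2 / B))"
    have \<tau>: "0 < \<tau>" "\<tau> \<le> 1" "\<tau> \<le> \<theta>"
      using \<theta> \<epsilon>2 B(1) by (auto simp: \<tau>_def)
    have "B * \<tau> \<le> B * (\<epsilon>2 / B)"
      using B(1) by (intro mult_left_mono) (auto simp: \<tau>_def)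
    then have B\<tau>: "B * \<tau> \<le> \<epsilon>2"
      using B(1) by simp
    obtain a r where ar: "0 < r" "norm a + r \<le> \<tau>" "\<And>x b. x \<in> K \<Longrightarrow> norm b \<le> r \<Longrightarrow> x + a + b \<in> \<Omega>"
      using sh \<tau>(1) unfolding shiftable_def by meson
    \<comment> \<open>Half of the margin \<open>r\<close> is spent on the mollifier; the other half
      is kept for the closure of the supports, which must still lie in \<Omega>.\<close>
    obtain \<eta> where \<eta>: "test_function UNIV \<eta>" "\<And>h. 0 \<le> \<eta> h" "\<And>h. \<eta> h \<noteq> 0 \<Longrightarrow> norm (h - a) < r / 2"
        "integrable lborel \<eta>" "(LINT h|lborel. \<eta> h) = 1"
      using mollifier_exists[of "r / 2" a] ar(1) by (metis half_gt_zero)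
    have \<eta>\<tau>: "norm h < \<tau>" if "\<eta> h \<noteq> 0" for h
      using \<eta>(3)[OF that] ar norm_triangle_ineq[of a "h - a"] by simp
    define \<phi> where "\<phi> j = conv \<eta> (w j)" for j
    define S0 where "S0 = {y + a + b | y b. y \<in> K \<and> norm b \<le> r / 2}"
    define S where "S = closure S0"
    have S\<Omega>: "S \<subseteq> \<Omega>"
    proof
      fix x assume "x \<in> S"
      then have "\<forall>e>0. \<exists>s\<in>S0. dist s x < e"
        by (simp add: S_def closure_approachable)
      then obtain s where "s \<in> S0" "dist s x < r / 2"
        using ar(1) half_gt_zero by blast
      then obtain y b where yb: "y \<in> K" "norm b \<le> r / 2" "norm (y + a + b - x) < r / 2"
        by (auto simp: dist_norm S0_def)
      have "norm (b - (y + a + b - x)) \<le> r"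
        using norm_triangle_ineq4[of b "y + a + b - x"] yb by linarith
      from ar(3)[OF yb(1) this] show "x \<in> \<Omega>"
        by (simp add: algebra_simps)
    qed
    have "compact S"
    proof -
      have "S0 \<subseteq> \<Omega>"
        using closure_subset[of S0] S\<Omega> by (simp add: S_def)
      then have "bounded S0"
        using \<Omega>(2) bounded_subset by blast
      then show ?thesis
        unfolding S_def by (simp add: compact_closure)
    qed
    have \<phi>S: "\<phi> j x = 0" if "x \<notin> S" for j x
    proof (rule ccontr)
      assume "\<phi> j x \<noteq> 0"
      then obtain y where y: "w j y \<noteq> 0" "\<eta> (x - y) \<noteq> 0"
        using conv_nonzero[OF \<eta>(1) iw] unfolding \<phi>_def by metis
      have "x = y + a + (x - y - a)" by simp
      moreover have "norm (x - y - a) \<le> r / 2"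
        using \<eta>(3)[OF y(2)] by simp
      ultimately have "x \<in> S0"
        using K[OF y(1)] unfolding S0_def by blast
      then show False
        using that closure_subset[of S0] by (auto simp: S_def)
    qed
    have t\<phi>: "test_function \<Omega> (\<phi> j)" for j
      using \<phi>S conv_smooth[OF \<eta>(1) iw] by (intro test_functionI[OF _ \<open>compact S\<close> S\<Omega>]) (simp_all add: \<phi>_def)
    have C\<phi>: "sq_int lborel (diffq (\<rho> j) (\<phi> j))" "nrm lborel (diffq (\<rho> j) (\<phi> j)) \<le> C" for j
      using conv_diffq_sq_int[OF \<eta>(1,2,5) C(1) iw kernel C(2), of j]
        order_trans[OF conv_diffq_nrm[OF \<eta>(1,2,5) C(1) iw kernel C(2), of j] C(4)[of j]]
      by (simp_all add: \<phi>_def)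
    have step1: "\<bar>(LINT x|lborel. f x * \<phi> j x) - (LINT x|lborel. f x * w j x)\<bar> \<le> \<epsilon> / 4" for j
    proof -
      have "\<bar>(LINT x|lborel. f x * \<phi> j x) - (LINT x|lborel. f x * w j x)\<bar> \<le> \<epsilon>1 * nrm lborel (w j)"
        unfolding \<phi>_def using \<eta>\<tau> \<tau>(3) by (intro conv_inner_close \<eta> C iw f \<theta>(2)) force
      also have "\<dots> \<le> \<epsilon>1 * C"
        using \<epsilon>1 by (intro mult_left_mono C) simp
      finally show ?thesis using \<epsilon>1(2) by linarith
    qed
    have step2: "\<bar>energy_form (\<rho> j) \<psi> (\<phi> j) - energy_form (\<rho> j) \<psi> (w j)\<bar> \<le> \<epsilon> / 4" for j
    proof -
      have "nrm lborel (diffq (\<rho> j) (\<lambda>x. \<psi> (x + h) - \<psi> x)) \<le> \<epsilon>1" if h: "\<eta> h \<noteq> 0" for h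
      proof -
        have [measurable]: "\<psi> \<in> borel_measurable borel"
          by (rule test_function_measurable[OF \<psi>])
        have h1: "norm h \<le> \<tau>" "norm h \<le> 1"
          using \<eta>\<tau>[OF h] \<tau>(2) by auto
        have d\<psi>: "\<psi> differentiable (at x)" for x
          using smooth_differentiable test_function_smooth[OF \<psi>] by blast
        have dh: "((\<lambda>x. \<psi> (x + h) - \<psi> x) has_derivative (\<lambda>k. (gradient \<psi> (x + h) - gradient \<psi> x) \<bullet> k)) (at x)" for x
        proof -
          have "((\<lambda>x. \<psi> (x + h)) has_derivative (\<lambda>k. gradient \<psi> (x + h) \<bullet> k)) (at x)"
          proof (rule has_derivative_compose[where f = "\<lambda>x. x + h" and f' = "\<lambda>k. k" and g = \<psi>])
            show "((\<lambda>x. x + h) has_derivative (\<lambda>k. k)) (at x)"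
              by (auto intro!: derivative_eq_intros)
          qed (rule gradient_has_derivative[OF d\<psi>])
          from has_derivative_diff[OF this gradient_has_derivative[OF d\<psi>]] show ?thesis
            by (simp add: inner_diff_left)
        qed
        have lip: "\<bar>(\<psi> (x + z + h) - \<psi> (x + z)) - (\<psi> (x + h) - \<psi> x)\<bar> \<le> \<epsilon>2 * norm z" for x z
        proof -
          have "\<bar>(\<psi> (x + z + h) - \<psi> (x + z)) - (\<psi> (x + h) - \<psi> x)\<bar> \<le> \<epsilon>2 * norm (x + z - x)"
          proof (rule lipschitz_of_gradient_bound[where p = "\<lambda>x. \<psi> (x + h) - \<psi> x"])
            fix y
            show "(\<lambda>x. \<psi> (x + h) - \<psi> x) differentiable at y"
              by (rule differentiableI[OF dh])
            have "norm (gradient \<psi> (y + h) - gradient \<psi> y) \<le> B * norm (y + h - y)"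
              by (rule B(2))
            also have "\<dots> \<le> B * \<tau>"
              using h1 B(1) by (intro mult_left_mono) auto
            also have "\<dots> \<le> \<epsilon>2" by (rule B\<tau>)
            finally show "norm (gradient (\<lambda>x. \<psi> (x + h) - \<psi> x) y) \<le> \<epsilon>2"
              by (simp add: gradient_eqI[OF dh])
          qed
          then show ?thesis by simp
        qed
        have sup: "norm x \<le> R\<psi> + 1" if "\<psi> (x + h) - \<psi> x \<noteq> 0" for x
        proof -
          have "norm x \<le> norm (x + h) + norm h"
            by (metis add_diff_cancel_right' norm_triangle_ineq4)
          then show ?thesis
            using R\<psi>(2)[of x] R\<psi>(2)[of "x + h"] that h1 by (cases "\<psi> x = 0") auto
        qed
        have "(nrm lborel (diffq (\<rho> j) (\<lambda>x. \<psi> (x + h) - \<psi> x)))\<^sup>2 \<le> \<epsilon>2\<^sup>2 * V"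
          unfolding V_def using lip sup by (intro diffq_lipschitz(2)[OF kernel d(2)]) auto
        also have "\<dots> \<le> \<epsilon>1\<^sup>2" by (rule \<epsilon>2(2))
        finally show ?thesis
          by (rule power2_le_imp_le) (use \<epsilon>1(1) in simp)
      qed
      then have "\<bar>energy_form (\<rho> j) \<psi> (\<phi> j) - energy_form (\<rho> j) \<psi> (w j)\<bar> \<le> \<epsilon>1 * nrm lborel (diffq (\<rho> j) (w j))"
        unfolding \<phi>_def
        by (intro conv_energy_close[OF \<eta>(1,2,5) C(1) iw kernel C(2)] test_function_measurable[OF \<psi>]
            test_function_diffq_sq_int[OF kernel d(2) \<psi>])
      also have "\<dots> \<le> \<epsilon>1 * C"
        using \<epsilon>1 by (intro mult_left_mono C) simp
      finally show ?thesis using \<epsilon>1(2) by linarith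
    qed
    obtain A\<eta> where A\<eta>: "0 < A\<eta>" "taylor A\<eta> \<eta>"
      using test_function_taylor[OF \<eta>(1)] by metis
    obtain A\<psi> where A\<psi>: "0 < A\<psi>" "taylor A\<psi> \<psi>"
      using test_function_taylor[OF \<psi>] by metis
    define A where "A = max A\<psi> (A\<eta> * M)"
    have tA: "taylor A (\<phi> j)" "taylor A \<psi>" for j
    proof -
      have "A\<eta> * (LINT y|lborel. \<bar>w j y\<bar>) \<le> A\<eta> * M"
        using A\<eta>(1) by (intro mult_left_mono M) simp
      also have "\<dots> \<le> A" by (simp add: A_def)
      finally show "taylor A (\<phi> j)"
        unfolding \<phi>_def using conv_taylor[OF \<eta>(1) iw A\<eta>(2)] taylor_mono by blast
      show "taylor A \<psi>"
        by (rule taylor_mono[OF A\<psi>(2)]) (simp add: A_def)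
    qed
    have supR: "norm x \<le> R" if "\<phi> j x \<noteq> 0 \<or> gradient (\<phi> j) x \<noteq> 0 \<or> \<psi> x \<noteq> 0 \<or> gradient \<psi> x \<noteq> 0" for j x
      using that R(2)[of x] test_function_eq_0[OF t\<phi>, of x j] test_function_gradient_eq_0[OF t\<phi>, of x j]
        test_function_eq_0[OF \<psi>, of x] test_function_gradient_eq_0[OF \<psi>, of x] by blast
    define D where "D = 3 * A\<^sup>2 * (measure lborel (cball (0::'a) (R + 1)) * DIM('a))"
    have close: "\<bar>energy_form (\<rho> j) p (\<phi> j) - (LINT x|lborel. gradient p x \<bullet> gradient (\<phi> j) x)\<bar> \<le> D * d j"
      if "p = \<psi> \<or> p = \<phi> j" for p j
      unfolding D_def
    proof (rule energy_form_smooth[OF kernel d(1,2)])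
      show "smooth p" "smooth (\<phi> j)"
        using that \<psi> t\<phi>[of j] by (auto intro: test_function_smooth)
      show "taylor A p" "taylor A (\<phi> j)"
        using that tA by auto
    qed (use that supR in metis)+
    have "(\<lambda>j. D * d j) \<longlonglongrightarrow> D * 0"
      by (intro tendsto_mult_left d)
    then have "\<forall>\<^sub>F j in sequentially. D * d j < \<epsilon>4"
      using \<epsilon>4(1) by (intro order_tendstoD(2)) auto
    then show "\<forall>\<^sub>F j in sequentially. \<bar>(LINT x|lborel. f x * w j x) - energy_form (\<rho> j) \<psi> (w j)\<bar>
        \<le> C * nrm (lebesgue_on \<Omega>) (\<lambda>x. gradient \<psi> x - G x) + \<epsilon>"
    proof eventually_elim
      case (elim j)
      let ?g = "gradient (\<phi> j)"
      \<comment> \<open>Averaging bounds the energy norm of \<open>\<phi> j\<close> by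
        \<open>C\<close>, and the uniform smoothness of \<open>\<phi> j\<close> converts this into a
        bound on its gradient.\<close>
      have "\<bar>energy_form (\<rho> j) (\<phi> j) (\<phi> j) - (LINT x|lborel. ?g x \<bullet> ?g x)\<bar> \<le> \<epsilon>4"
        using close[of "\<phi> j" j] elim by simp
      then have "(nrm lborel ?g)\<^sup>2 \<le> (nrm lborel (diffq (\<rho> j) (\<phi> j)))\<^sup>2 + \<epsilon>4"
        by (simp add: energy_form_self nrm_power2[of lborel ?g] power2_norm_eq_inner)
      also have "\<dots> \<le> C\<^sup>2 + (sqrt \<epsilon>4)\<^sup>2"
        using C\<phi>(2)[of j] \<epsilon>4(1) by (simp add: power_mono)
      also have "\<dots> \<le> (C + sqrt \<epsilon>4)\<^sup>2"
        using C0 \<epsilon>4(1) by (simp add: power2_sum)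
      finally have ng: "nrm lborel ?g \<le> C + sqrt \<epsilon>4"
        by (rule power2_le_imp_le) (use C0 \<epsilon>4(1) in simp)
      have s\<psi>: "sq_int (lebesgue_on \<Omega>) (gradient \<psi>)" and s\<phi>: "sq_int (lebesgue_on \<Omega>) ?g"
        using test_function_gradient_lebesgue_on(1) \<psi> t\<phi> by auto
      have "(LINT x|lborel. f x * \<phi> j x) - (LINT x|lborel. gradient \<psi> x \<bullet> ?g x) =
          (LINT x|lebesgue_on \<Omega>. G x \<bullet> ?g x) - (LINT x|lebesgue_on \<Omega>. gradient \<psi> x \<bullet> ?g x)"
        by (simp add: G_eq[OF t\<phi>] test_function_gradient_lebesgue_on(3)[OF t\<phi> \<psi>])
      also have "\<dots> = - (LINT x|lebesgue_on \<Omega>. (gradient \<psi> x - G x) \<bullet> ?g x)"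
        using integrable_inner_sq_int[OF G s\<phi>] integrable_inner_sq_int[OF s\<psi> s\<phi>]
        by (simp add: inner_diff_left)
      finally have "\<bar>(LINT x|lborel. f x * \<phi> j x) - (LINT x|lborel. gradient \<psi> x \<bullet> ?g x)\<bar> \<le> \<kappa> * nrm lborel ?g"
        using Cauchy_Schwarz_integral[OF sq_int_diff[OF s\<psi> G] s\<phi>]
        by (simp add: \<kappa>_def test_function_gradient_lebesgue_on(2)[OF t\<phi>])
      also have "\<dots> \<le> \<kappa> * (C + sqrt \<epsilon>4)"
        by (intro mult_left_mono ng \<kappa>)
      also have "\<dots> \<le> C * \<kappa> + \<epsilon> / 4"
        using \<epsilon>4' by (simp add: algebra_simps)
      finally have "\<bar>(LINT x|lborel. f x * \<phi> j x) - (LINT x|lborel. gradient \<psi> x \<bullet> ?g x)\<bar> \<le> C * \<kappa> + \<epsilon> / 4" .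
      moreover have "\<bar>energy_form (\<rho> j) \<psi> (\<phi> j) - (LINT x|lborel. gradient \<psi> x \<bullet> ?g x)\<bar> \<le> \<epsilon> / 4"
        using close[of \<psi> j] elim \<epsilon>4(2) by simp
      ultimately show ?case
        using step1[of j] step2[of j] unfolding \<kappa>_def by linarith
    qed
  qed
qed

lemma consistent_add:
  assumes v: "bounded_energy v" "consistent v" and w: "bounded_energy w" "consistent w"
  shows "consistent (\<lambda>j x. v j x + w j x)"
proof -
  let ?e = "\<lambda>w \<psi> j. (LINT x|lborel. f x * w j x) - energy_form (\<rho> j) \<psi> (w j)"
  let ?k = "\<lambda>\<psi>. nrm (lebesgue_on \<Omega>) (\<lambda>x. gradient \<psi> x - G x)"
  obtain C where C: "\<And>\<psi> \<epsilon>. test_function \<Omega> \<psi> \<Longrightarrow> 0 < \<epsilon> \<Longrightarrow>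
      \<forall>\<^sub>F j in sequentially. \<bar>?e v \<psi> j\<bar> \<le> C * ?k \<psi> + \<epsilon>"
    using v(2) unfolding consistent_def by blast
  obtain C' where C': "\<And>\<psi> \<epsilon>. test_function \<Omega> \<psi> \<Longrightarrow> 0 < \<epsilon> \<Longrightarrow>
      \<forall>\<^sub>F j in sequentially. \<bar>?e w \<psi> j\<bar> \<le> C' * ?k \<psi> + \<epsilon>"
    using w(2) unfolding consistent_def by blast
  show ?thesis
    unfolding consistent_def
  proof (intro exI[of _ "C + C'"] allI impI)
    fix \<psi> :: "'a \<Rightarrow> real" and \<epsilon> :: real
    assume \<psi>: "test_function \<Omega> \<psi>" and \<epsilon>: "0 < \<epsilon>"
    have "\<forall>\<^sub>F j in sequentially. \<bar>?e v \<psi> j\<bar> \<le> C * ?k \<psi> + \<epsilon> / 2"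
      "\<forall>\<^sub>F j in sequentially. \<bar>?e w \<psi> j\<bar> \<le> C' * ?k \<psi> + \<epsilon> / 2"
      using C[OF \<psi>] C'[OF \<psi>] \<epsilon> by simp_all
    then show "\<forall>\<^sub>F j in sequentially. \<bar>?e (\<lambda>j x. v j x + w j x) \<psi> j\<bar> \<le> (C + C') * ?k \<psi> + \<epsilon>"
    proof eventually_elim
      case (elim j)
      have s: "sq_int lborel (v j)" "sq_int lborel (w j)"
        "sq_int lborel (diffq (\<rho> j) (v j))" "sq_int lborel (diffq (\<rho> j) (w j))"
        using v(1) w(1) unfolding bounded_energy_def by blast+
      have "?e (\<lambda>j x. v j x + w j x) \<psi> j = ?e v \<psi> j + ?e w \<psi> j"
        using integrable_mult_sq_int[OF f s(1)] integrable_mult_sq_int[OF f s(2)]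
        by (simp add: energy_form_add_right[OF test_function_diffq_sq_int[OF kernel d(2) \<psi>] s(3,4)] distrib_left)
      then show ?case
        using elim by (simp add: algebra_simps)
    qed
  qed
qed

text \<open>By \<open>diffq_cutoff\<close> the energy after a cutoff is controlled by energy and
  norm together; this is why \<open>bounded_energy\<close> records both bounds.\<close>

lemma bounded_energy_cutoff:
  assumes w: "bounded_energy w" and [measurable]: "\<zeta> \<in> borel_measurable borel"
    and \<zeta>: "\<And>x. \<bar>\<zeta> x\<bar> \<le> 1" "\<And>x z. \<bar>\<zeta> (x + z) - \<zeta> x\<bar> \<le> L * norm z"
  shows "bounded_energy (\<lambda>j x. \<zeta> x * w j x)"
proof -
  obtain C where C: "\<And>j. sq_int lborel (w j)" "\<And>j. sq_int lborel (diffq (\<rho> j) (w j))"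
      "\<And>j. nrm lborel (w j) \<le> C" "\<And>j. nrm lborel (diffq (\<rho> j) (w j)) \<le> C"
    using w unfolding bounded_energy_def by blast
  note cut = diffq_cutoff[OF kernel C(1) C(2) assms(2) \<zeta>]
  define B where "B = sqrt (2 * C\<^sup>2 + 2 * L\<^sup>2 * DIM('a) * C\<^sup>2)"
  have "nrm lborel (diffq (\<rho> j) (\<lambda>x. \<zeta> x * w j x)) \<le> B" for j
    unfolding B_def
  proof (rule real_le_rsqrt)
    have "(nrm lborel (diffq (\<rho> j) (\<lambda>x. \<zeta> x * w j x)))\<^sup>2 \<le>
        2 * (nrm lborel (diffq (\<rho> j) (w j)))\<^sup>2 + 2 * L\<^sup>2 * DIM('a) * (nrm lborel (w j))\<^sup>2"
      by (rule cut(4))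
    also have "\<dots> \<le> 2 * C\<^sup>2 + 2 * L\<^sup>2 * DIM('a) * C\<^sup>2"
      by (intro add_mono mult_left_mono power_mono C) auto
    finally show "(nrm lborel (diffq (\<rho> j) (\<lambda>x. \<zeta> x * w j x)))\<^sup>2 \<le> 2 * C\<^sup>2 + 2 * L\<^sup>2 * DIM('a) * C\<^sup>2" .
  qed
  then have "sq_int lborel (\<lambda>x. \<zeta> x * w j x) \<and> sq_int lborel (diffq (\<rho> j) (\<lambda>x. \<zeta> x * w j x)) \<and>
      nrm lborel (\<lambda>x. \<zeta> x * w j x) \<le> max B C \<and> nrm lborel (diffq (\<rho> j) (\<lambda>x. \<zeta> x * w j x)) \<le> max B C" for j
    using cut(1,3)[of j] order_trans[OF cut(2)[of j] C(3)[of j]] by (simp add: max.coboundedI1 max.coboundedI2)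
  moreover have "\<zeta> x * w j x \<noteq> 0 \<longrightarrow> x \<in> \<Omega>" for j x
    using w unfolding bounded_energy_def by auto
  ultimately show ?thesis
    unfolding bounded_energy_def by blast
qed

text \<open>A compact subset has a uniform distance to the complement, so the shift can be
  0.\<close>

lemma shiftable_compact:
  assumes "compact K" "K \<subseteq> \<Omega>"
  shows "shiftable \<Omega> K"
  unfolding shiftable_def
proof (intro allI impI)
  fix \<tau> :: real assume \<tau>: "0 < \<tau>"
  obtain e where e: "0 < e" "(\<Union>x\<in>K. ball x e) \<subseteq> \<Omega>"
    using compact_subset_open_imp_ball_epsilon_subset[OF assms(1) \<Omega>(1) assms(2)] by metis
  have "x + 0 + b \<in> \<Omega>" if "x \<in> K" "norm b \<le> min \<tau> (e / 2)" for x b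
    using that e(1) by (intro subsetD[OF e(2)] UN_I[of x]) (auto simp: dist_norm)
  then show "\<exists>a r. 0 < r \<and> norm a + r \<le> \<tau> \<and> (\<forall>x\<in>K. \<forall>b. norm b \<le> r \<longrightarrow> x + a + b \<in> \<Omega>)"
    using \<tau> e(1) by (intro exI[of _ 0] exI[of _ "min \<tau> (e / 2)"]) auto
qed

end

text \<open>Near a boundary point, a small step in the vertical direction leads into the interior of the epigraph.\<close>

lemma shiftable_lipschitz:
  fixes \<Omega> :: "'a::euclidean_space set"
  assumes "lipschitz_boundary \<Omega>" "z \<in> frontier \<Omega>"
  obtains r where "0 < r" "shiftable \<Omega> (\<Omega> \<inter> ball z r)"
proof -
  obtain r e \<gamma> L where r: "0 < r" and e: "norm e = 1" and lip: "L-lipschitz_on {y. y \<bullet> e = 0} (\<gamma> :: 'a \<Rightarrow> real)"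
    and eq: "\<Omega> \<inter> ball z r = {x \<in> ball z r. \<gamma> (x - (x \<bullet> e) *\<^sub>R e) < x \<bullet> e}"
    using bspec[OF assms(1)[unfolded lipschitz_boundary_def] assms(2)] by (elim exE conjE) (rule that)
  have ee: "e \<bullet> e = 1"
    using e by (metis power2_norm_eq_inner power_one)
  have L: "0 \<le> L"
    by (rule lipschitz_on_nonneg[OF lip])
  \<comment> \<open>Half the chart radius, so that shifted points stay in the ball where \<Omega> is
    an epigraph.\<close>
  have "shiftable \<Omega> (\<Omega> \<inter> ball z (r / 2))"
    unfolding shiftable_def
  proof (intro allI impI)
    fix \<tau> :: real assume \<tau>: "0 < \<tau>"
    define t where "t = min (\<tau> / 2) (r / 4)"
    \<comment> \<open>The vertical coordinate rises by at least \<open>t - q\<close>, the graph by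
      at most \<open>L * q\<close>. This \<open>q\<close> makes \<open>(L + 1) * q\<close> smaller
      than \<open>t\<close>, also when \<open>L = 0\<close>.\<close>
    define q where "q = t / (2 * (L + 2))"
    have t: "0 < t" "t \<le> \<tau> / 2" "t \<le> r / 4"
      using \<tau> r by (auto simp: t_def)
    have q: "0 < q" "q * (L + 2) < t" "q \<le> t"
      using t L by (auto simp: q_def divide_simps)
    have "x + t *\<^sub>R e + b \<in> \<Omega>" if x: "x \<in> \<Omega> \<inter> ball z (r / 2)" and b: "norm b \<le> q" for x b
    proof -
      define y where "y = x + t *\<^sub>R e + b"
      let ?h = "\<lambda>x. x - (x \<bullet> e) *\<^sub>R e"
      have be: "\<bar>b \<bullet> e\<bar> \<le> q"
        using Cauchy_Schwarz_ineq2[of b e] e b by simp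
      have "dist z y \<le> norm (x - z) + norm (t *\<^sub>R e) + norm b"
        unfolding dist_norm y_def using norm_triangle_ineq[of "x - z + t *\<^sub>R e" b] norm_triangle_ineq[of "x - z" "t *\<^sub>R e"]
        by (simp add: norm_minus_commute[of z] algebra_simps)
      also have "\<dots> < r"
        using x b e t q by (auto simp: dist_norm norm_minus_commute)
      finally have y: "y \<in> ball z r" by simp
      have hy: "?h y - ?h x = b - (b \<bullet> e) *\<^sub>R e"
        by (simp add: y_def inner_add_left ee algebra_simps)
      have "\<bar>\<gamma> (?h y) - \<gamma> (?h x)\<bar> \<le> L * norm (?h y - ?h x)"
        using lipschitz_onD[OF lip, of "?h y" "?h x"] by (simp add: inner_diff_left ee dist_norm)
      also have "\<dots> \<le> L * q"
      proof (rule mult_left_mono[OF _ L])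
        \<comment> \<open>Pythagoras: projection to the hyperplane does not lengthen
          \<open>b\<close>.\<close>
        have "(norm (b - (b \<bullet> e) *\<^sub>R e))\<^sup>2 = (norm b)\<^sup>2 - (b \<bullet> e)\<^sup>2"
          unfolding power2_norm_eq_inner by (simp add: inner_diff_left inner_diff_right ee inner_commute power2_eq_square)
        then have "(norm (b - (b \<bullet> e) *\<^sub>R e))\<^sup>2 \<le> q\<^sup>2"
          using power_mono[OF b norm_ge_zero, of 2] zero_le_power2[of "b \<bullet> e"] by linarith
        then show "norm (?h y - ?h x) \<le> q"
          unfolding hy by (rule power2_le_imp_le) (use q(1) in simp)
      qed
      finally have "\<gamma> (?h y) \<le> \<gamma> (?h x) + L * q" by linarith
      also have "\<gamma> (?h x) < x \<bullet> e"
      proof -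
        have "x \<in> \<Omega> \<inter> ball z r" using x r by auto
        then show ?thesis unfolding eq by simp
      qed
      finally have "\<gamma> (?h y) < x \<bullet> e + L * q" by simp
      moreover have "y \<bullet> e = x \<bullet> e + t + b \<bullet> e"
        by (simp add: y_def inner_add_left ee)
      ultimately have "\<gamma> (?h y) < y \<bullet> e"
        using be q by (simp add: algebra_simps)
      with y have "y \<in> \<Omega> \<inter> ball z r" unfolding eq by simp
      then show ?thesis by (simp add: y_def)
    qed
    then show "\<exists>a q. 0 < q \<and> norm a + q \<le> \<tau> \<and> (\<forall>x\<in>\<Omega> \<inter> ball z (r / 2). \<forall>b. norm b \<le> q \<longrightarrow> x + a + b \<in> \<Omega>)"
      using t q e by (intro exI[of _ "t *\<^sub>R e"] exI[of _ q]) auto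
  qed
  then show ?thesis
    using r by (intro that[of "r / 2"]) auto
qed

context vanishing_horizon
begin

text \<open>A partition of unity by induction over a finite cover of the boundary. At each centre
  the sequence splits into a part supported where shifting works and a remainder that vanishes on
  the half ball where the cutoff is 1. When no centre is left, the supports lie in a compact subset
  of \<Omega>.\<close>

lemma consistent_bounded_energy:
  assumes lip: "lipschitz_boundary \<Omega>" and w: "bounded_energy w"
  shows "consistent w"
proof -
  have "\<forall>z\<in>frontier \<Omega>. \<exists>r>0. shiftable \<Omega> (\<Omega> \<inter> ball z r)"
    using shiftable_lipschitz[OF lip] by metis
  then obtain r where r: "\<And>z. z \<in> frontier \<Omega> \<Longrightarrow> 0 < r z \<and> shiftable \<Omega> (\<Omega> \<inter> ball z (r z))"
    by metis
  \<comment> \<open>\<open>U\<close> collects the region already cleared, so the boundary stays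
    covered by \<open>U\<close> and the half balls around the remaining centres.\<close>
  have main: "consistent w"
    if "finite F" "F \<subseteq> frontier \<Omega>" "bounded_energy w" "open U" "frontier \<Omega> \<subseteq> U \<union> (\<Union>z\<in>F. ball z (r z / 2))"
      "\<And>j x. x \<in> U \<Longrightarrow> w j x = 0" for F U w
    using that
  proof (induction F arbitrary: U w rule: finite_induct)
    case empty
    let ?K = "closure \<Omega> - U"
    have "compact ?K"
      using \<Omega>(2) empty by (intro compact_diff) auto
    moreover have "?K \<subseteq> \<Omega>"
      using empty by (auto simp: closure_Un_frontier)
    moreover have "x \<in> ?K" if "w j x \<noteq> 0" for j x
      using that empty closure_subset[of \<Omega>] unfolding bounded_energy_def by blast
    ultimately show ?case
      using consistent_shiftable[OF empty(2), of ?K] shiftable_compact by blast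
  next
    case (insert z F)
    have z: "z \<in> frontier \<Omega>" using insert by simp
    obtain \<zeta> where \<zeta>: "test_function UNIV \<zeta>" "\<And>x. 0 \<le> \<zeta> x" "\<And>x. \<zeta> x \<le> 1"
        "\<And>x. norm (x - z) \<le> r z / 2 \<Longrightarrow> \<zeta> x = 1" "\<And>x. \<zeta> x \<noteq> 0 \<Longrightarrow> norm (x - z) < r z"
      using cutoff_exists[of "r z" z] r[OF z] by metis
    have [measurable]: "\<zeta> \<in> borel_measurable borel"
      by (rule test_function_measurable[OF \<zeta>(1)])
    obtain L where L: "\<And>x. norm (gradient \<zeta> x) \<le> L"
      using test_function_gradient_bounded[OF \<zeta>(1)] by metis
    have lipz: "\<bar>\<zeta> (x + y) - \<zeta> x\<bar> \<le> L * norm y" for x y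
      using lipschitz_of_gradient_bound[OF smooth_differentiable[OF test_function_smooth[OF \<zeta>(1)]] L, of "x + y" x]
      by simp
    let ?v = "\<lambda>j x. \<zeta> x * w j x" and ?v' = "\<lambda>j x. (1 - \<zeta> x) * w j x"
    have bv: "bounded_energy ?v"
      using \<zeta>(2,3) lipz by (intro bounded_energy_cutoff[where L = L] insert) (auto simp: abs_le_iff intro: order_trans[of _ 0])
    have bv': "bounded_energy ?v'"
    proof (rule bounded_energy_cutoff[where L = L])
      show "\<bar>1 - \<zeta> (x + y) - (1 - \<zeta> x)\<bar> \<le> L * norm y" for x y
        using lipz[of x y] by (simp add: abs_minus_commute)
    qed (use \<zeta>(2,3) insert in \<open>auto simp: abs_le_iff intro: order_trans[of _ 0] add_increasing\<close>)
    have "consistent ?v"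
    proof (rule consistent_shiftable[OF bv, of "\<Omega> \<inter> ball z (r z)"])
      show "x \<in> \<Omega> \<inter> ball z (r z)" if "\<zeta> x * w j x \<noteq> 0" for j x
        using that \<zeta>(5)[of x] insert.prems(2) unfolding bounded_energy_def
        by (auto simp: dist_norm norm_minus_commute)
    qed (use r[OF z] in auto)
    moreover have "consistent ?v'"
    proof (rule insert.IH[where U = "U \<union> ball z (r z / 2)"])
      show "(1 - \<zeta> x) * w j x = 0" if "x \<in> U \<union> ball z (r z / 2)" for j x
        using that \<zeta>(4)[of x] insert.prems(5)[of x j] by (auto simp: dist_norm norm_minus_commute)
    qed (use insert.prems bv' in auto)
    ultimately have "consistent (\<lambda>j x. ?v j x + ?v' j x)"
      by (intro consistent_add bv bv')
    then show ?case
      by (simp add: left_diff_distrib)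
  qed
  have c: "compact (frontier \<Omega>)"
    using \<Omega>(2) by (simp add: compact_frontier_bounded)
  have cover: "frontier \<Omega> \<subseteq> (\<Union>z\<in>frontier \<Omega>. ball z (r z / 2))"
    using r by fastforce
  obtain F where "F \<subseteq> frontier \<Omega>" "finite F" "frontier \<Omega> \<subseteq> (\<Union>z\<in>F. ball z (r z / 2))"
    by (rule compactE_image[OF c _ cover]) auto
  then show ?thesis
    using main[of F w "{}"] w by simp
qed

end

subsection \<open>Radial integrals\<close>

text \<open>Both measures have the same tails: with \<open>N\<close> the dimension and
  \<open>V\<close> the volume of the unit ball, a spherical shell has volume
  \<open>V (\<delta>^N - x^N)\<close>, and the density is the derivative of \<open>V r^N\<close>.
  Restriction to a ball makes the tails finite, as the comparison of measures by tails
  requires.\<close>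

lemma distr_norm_lborel_ball:
  assumes \<delta>: "0 < \<delta>"
  shows "distr (restrict_space lborel (ball (0::'a::euclidean_space) \<delta>)) borel norm =
    density lborel (\<lambda>r. ennreal (DIM('a) * unit_ball_vol DIM('a) * r ^ (DIM('a) - 1)) * indicator {0..\<delta>} r)"
    (is "?M = ?N")
proof (rule measure_eqI_lessThan)
  let ?V = "unit_ball_vol (real DIM('a))"
  let ?F = "\<lambda>r. ?V * r ^ DIM('a)"
  have V: "0 \<le> ?V" by simp
  have norm_meas: "norm \<in> restrict_space lborel (ball (0::'a) \<delta>) \<rightarrow>\<^sub>M borel"
    by (intro measurable_restrict_space1) simp
  have M: "emeasure ?M {x<..} = emeasure lborel {z::'a. x < norm z \<and> norm z < \<delta>}" for x
  proof -
    have "norm -` {x<..} \<inter> space (restrict_space lborel (ball (0::'a) \<delta>)) = {z. x < norm z \<and> norm z < \<delta>}"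
      by (auto simp: space_restrict_space)
    then show ?thesis
      by (subst emeasure_distr[OF norm_meas], simp) (subst emeasure_restrict_space, auto)
  qed
  have ball: "emeasure lborel (ball (0::'a) \<delta>) = ennreal (?F \<delta>)"
    using \<delta> by (simp add: emeasure_ball)
  have cball: "emeasure lborel (cball (0::'a) r) = ennreal (?F r)" if "0 \<le> r" for r
    using that by (simp add: emeasure_cball)
  show "emeasure ?M {x<..} < \<infinity>" for x
  proof -
    have "emeasure lborel {z::'a. x < norm z \<and> norm z < \<delta>} \<le> emeasure lborel (ball (0::'a) \<delta>)"
      by (intro emeasure_mono) auto
    also have "\<dots> < \<infinity>" by (simp add: ball)
    finally show ?thesis by (simp add: M)
  qed
  have deriv: "(?F has_real_derivative DIM('a) * ?V * r ^ (DIM('a) - 1)) (at r)" for r :: real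
    by (auto intro!: derivative_eq_intros)
  have N: "emeasure ?N {x<..} = ennreal (?F \<delta> - ?F (max 0 x))" if "x \<le> \<delta>" for x
  proof -
    have "AE r in lborel. r \<noteq> x" by (rule AE_lborel_singleton)
    then have "AE r in lborel. ennreal (DIM('a) * ?V * r ^ (DIM('a) - 1)) * indicator {0..\<delta>} r * indicator {x<..} r =
        ennreal (DIM('a) * ?V * r ^ (DIM('a) - 1)) * indicator {max 0 x..\<delta>} r"
      by eventually_elim (auto simp: indicator_def)
    then have "emeasure ?N {x<..} = (\<integral>\<^sup>+r. ennreal (DIM('a) * ?V * r ^ (DIM('a) - 1)) * indicator {max 0 x..\<delta>} r \<partial>lborel)"
      by (subst emeasure_density) (auto intro!: nn_integral_cong_AE)
    also have "\<dots> = ennreal (?F \<delta> - ?F (max 0 x))"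
      using that \<delta> V by (intro nn_integral_FTC_Icc) (auto intro!: deriv[simplified])
    finally show ?thesis .
  qed
  show "emeasure ?M {x<..} = emeasure ?N {x<..}" for x
  proof -
    consider "x < 0" | "0 \<le> x" "x < \<delta>" | "\<delta> \<le> x" by linarith
    then show ?thesis
    proof cases
      case 1
      then have "{z::'a. x < norm z \<and> norm z < \<delta>} = ball 0 \<delta>"
        using order_less_le_trans[OF _ norm_ge_zero] by auto
      then show ?thesis
        using 1 \<delta> N[of x] by (simp add: M ball)
    next
      case 2
      have "{z::'a. x < norm z \<and> norm z < \<delta>} = ball 0 \<delta> - cball 0 x"
        by auto
      then have "emeasure ?M {x<..} = emeasure lborel (ball (0::'a) \<delta>) - emeasure lborel (cball (0::'a) x)"
        unfolding M using 2 by (simp add: emeasure_Diff cball subset_iff)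
      also have "\<dots> = ennreal (?F \<delta> - ?F x)"
        using 2 V by (simp add: ball cball ennreal_minus)
      finally show ?thesis
        using 2 N[of x] by simp
    next
      case 3
      then have empty: "{z::'a. x < norm z \<and> norm z < \<delta>} = {}" by auto
      have "emeasure ?M {x<..} = 0"
        by (simp only: M empty emeasure_empty)
      moreover have "emeasure ?N {x<..} \<le> emeasure ?N {\<delta><..}"
        using 3 by (intro emeasure_mono) auto
      moreover have "emeasure ?N {\<delta><..} = 0"
        using N[of \<delta>] \<delta> by simp
      ultimately show ?thesis
        by simp
    qed
  qed
qed auto

lemma nn_integral_radial_ball:
  fixes g :: "real \<Rightarrow> ennreal"
  assumes \<delta>: "0 < \<delta>" and [measurable]: "g \<in> borel_measurable borel"
  shows "(\<integral>\<^sup>+z. g (norm z) * indicator (ball (0::'a::euclidean_space) \<delta>) z \<partial>lborel) =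
    (\<integral>\<^sup>+r. ennreal (DIM('a) * unit_ball_vol DIM('a) * r ^ (DIM('a) - 1)) * indicator {0..\<delta>} r * g r \<partial>lborel)"
proof -
  have "(\<integral>\<^sup>+z. g (norm z) * indicator (ball (0::'a) \<delta>) z \<partial>lborel) =
      (\<integral>\<^sup>+z. g (norm z) \<partial>restrict_space lborel (ball (0::'a) \<delta>))"
    by (subst nn_integral_restrict_space) auto
  also have "\<dots> = (\<integral>\<^sup>+r. g r \<partial>distr (restrict_space lborel (ball (0::'a) \<delta>)) borel norm)"
    by (subst nn_integral_distr) (auto intro: measurable_restrict_space1)
  also have "\<dots> = (\<integral>\<^sup>+r. ennreal (DIM('a) * unit_ball_vol DIM('a) * r ^ (DIM('a) - 1)) * indicator {0..\<delta>} r * g r \<partial>lborel)"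
    unfolding distr_norm_lborel_ball[OF \<delta>] by (subst nn_integral_density) auto
  finally show ?thesis .
qed

text \<open>In the radial variable the integrand becomes a multiple of
  \<open>r powr (1 - 2 * s)\<close>, which is integrable at 0 because \<open>s < 1\<close>.\<close>

lemma
  fixes s \<delta> :: real
  assumes s: "s < 1" and \<delta>: "0 < \<delta>"
  defines "h \<equiv> (\<lambda>z::'a::euclidean_space. indicator (ball 0 \<delta>) z * ((norm z)\<^sup>2 / norm z powr (DIM('a) + 2 * s)))"
  shows integrable_fractional_kernel: "integrable lborel h"
    and integral_fractional_kernel:
      "(LINT z|lborel. h z) = DIM('a) * unit_ball_vol DIM('a) * \<delta> powr (2 - 2 * s) / (2 - 2 * s)"
proof -
  let ?c = "DIM('a) * unit_ball_vol (real DIM('a))"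
  let ?F = "\<lambda>r::real. r powr (2 - 2 * s) / (2 - 2 * s)"
  \<comment> \<open>The integrand is unbounded at 0 once \<open>s > 1 / 2\<close>, so the
    fundamental theorem is applied on the open interval, with the boundary value at 0 taken as a
    limit.\<close>
  have ftc: "set_integrable lborel (einterval (ereal 0) (ereal \<delta>)) (\<lambda>r. r powr (1 - 2 * s))"
    "(LBINT r=ereal 0..ereal \<delta>. r powr (1 - 2 * s)) = ?F \<delta> - 0"
  proof -
    have 1: "(?F has_real_derivative x powr (1 - 2 * s)) (at x)" if "ereal 0 < ereal x" "ereal x < ereal \<delta>" for x
      using that s by (auto intro!: derivative_eq_intros)
    have 2: "isCont (\<lambda>r. r powr (1 - 2 * s)) x" if "ereal 0 < ereal x" "ereal x < ereal \<delta>" for x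
      using that by (intro continuous_intros) auto
    have "((\<lambda>r. r powr (2 - 2 * s) / (2 - 2 * s)) \<longlongrightarrow> 0 powr (2 - 2 * s) / (2 - 2 * s)) (at_right 0)"
      using s by (intro tendsto_intros) (auto simp: eventually_at_right_field intro!: exI[of _ 1])
    then have 3: "((?F \<circ> real_of_ereal) \<longlongrightarrow> 0) (at_right (ereal 0))"
      by (simp add: ereal_tendsto_simps)
    have "(?F \<longlongrightarrow> ?F \<delta>) (at_left \<delta>)"
      using \<delta> s by (intro tendsto_intros) auto
    then have 4: "((?F \<circ> real_of_ereal) \<longlongrightarrow> ?F \<delta>) (at_left (ereal \<delta>))"
      by (simp add: ereal_tendsto_simps)
    note ftc = interval_integral_FTC_nonneg[OF _ 1 2 _ 3 4]
    show "set_integrable lborel (einterval (ereal 0) (ereal \<delta>)) (\<lambda>r. r powr (1 - 2 * s))"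
      using \<delta> by (intro ftc(1)) auto
    show "(LBINT r=ereal 0..ereal \<delta>. r powr (1 - 2 * s)) = ?F \<delta> - 0"
      using \<delta> by (intro ftc(2)) auto
  qed
  have int: "integrable lborel (\<lambda>r. indicator {0<..<\<delta>} r * r powr (1 - 2 * s))"
    "(LINT r|lborel. indicator {0<..<\<delta>} r * r powr (1 - 2 * s)) = ?F \<delta>"
    using ftc \<delta> by (simp_all add: set_integrable_def interval_integral_Ioo set_lebesgue_integral_def)
  have [measurable]: "h \<in> borel_measurable borel"
    unfolding h_def by (intro borel_measurable_times borel_measurable_indicator) (simp, measurable)
  have h0: "0 \<le> h z" for z by (simp add: h_def)
  have pw: "r ^ (DIM('a) - 1) * (r\<^sup>2 / r powr (DIM('a) + 2 * s)) = r powr (1 - 2 * s)" if "0 < r" for r :: real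
  proof -
    have "r ^ (DIM('a) - 1) * (r\<^sup>2 / r powr (DIM('a) + 2 * s)) =
        r powr (real (DIM('a) - 1) + 2 - (DIM('a) + 2 * s))"
      using that by (simp only: powr_diff powr_add powr_realpow powr_numeral less_imp_le times_divide_eq_right)
    also have "real (DIM('a) - 1) + 2 - (DIM('a) + 2 * s) = 1 - 2 * s"
      using DIM_positive[where 'a = 'a] by (simp add: of_nat_diff Suc_leI del: DIM_positive)
    finally show ?thesis .
  qed
  have "(\<integral>\<^sup>+z. ennreal (h z) \<partial>lborel) =
      (\<integral>\<^sup>+z. ennreal ((norm z)\<^sup>2 / norm z powr (DIM('a) + 2 * s)) * indicator (ball (0::'a) \<delta>) z \<partial>lborel)"
    by (intro nn_integral_cong) (auto simp: h_def indicator_def)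
  also have "\<dots> = (\<integral>\<^sup>+r. ennreal (?c * r ^ (DIM('a) - 1)) * indicator {0..\<delta>} r *
      ennreal (r\<^sup>2 / r powr (DIM('a) + 2 * s)) \<partial>lborel)"
    by (rule nn_integral_radial_ball[OF \<delta>]) measurable
  also have "\<dots> = (\<integral>\<^sup>+r. ennreal (?c * (indicator {0<..<\<delta>} r * r powr (1 - 2 * s))) \<partial>lborel)"
  proof (rule nn_integral_cong_AE)
    have "AE r in lborel. r \<noteq> \<delta>" "AE r in lborel. r \<noteq> (0::real)"
      by (rule AE_lborel_singleton)+
    then show "AE r in lborel. ennreal (?c * r ^ (DIM('a) - 1)) * indicator {0..\<delta>} r *
      ennreal (r\<^sup>2 / r powr (DIM('a) + 2 * s)) = ennreal (?c * (indicator {0<..<\<delta>} r * r powr (1 - 2 * s)))"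
    proof eventually_elim
      case (elim r)
      show ?case
      proof (cases "r \<in> {0<..<\<delta>}")
        case True
        then have "ennreal (?c * r ^ (DIM('a) - 1)) * ennreal (r\<^sup>2 / r powr (DIM('a) + 2 * s)) =
            ennreal (?c * (r ^ (DIM('a) - 1) * (r\<^sup>2 / r powr (DIM('a) + 2 * s))))"
          by (subst ennreal_mult[symmetric]) (auto simp: mult_ac)
        also have "\<dots> = ennreal (?c * r powr (1 - 2 * s))"
          using True by (simp only: pw greaterThanLessThan_iff)
        finally show ?thesis
          using True by simp
      next
        case False
        then show ?thesis using elim by (auto simp: indicator_def)
      qed
    qed
  qed
  also have "\<dots> = ennreal (?c * ?F \<delta>)"
    by (subst nn_integral_eq_integral) (use int in auto)
  finally have nn: "(\<integral>\<^sup>+z. ennreal (h z) \<partial>lborel) = ennreal (?c * ?F \<delta>)" .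
  show "integrable lborel h"
    by (rule integrableI_nonneg) (auto simp: h0 nn)
  then show "(LINT z|lborel. h z) = DIM('a) * unit_ball_vol DIM('a) * \<delta> powr (2 - 2 * s) / (2 - 2 * s)"
    using s by (subst integral_eq_nn_integral) (auto simp: h0 nn)
qed

subsection \<open>Radial kernels are isotropic\<close>

text \<open>A quarter turn in the plane of two coordinates yields both the vanishing of the mixed second moments
  and the equality of the pure ones.\<close>

definition quarter_turn :: "'a \<Rightarrow> 'a \<Rightarrow> 'a::euclidean_space \<Rightarrow> 'a" where
  "quarter_turn i j z = z + (z \<bullet> j - z \<bullet> i) *\<^sub>R i + (- (z \<bullet> i) - z \<bullet> j) *\<^sub>R j"

context
  fixes i j :: "'a::euclidean_space"
  assumes ij: "i \<in> Basis" "j \<in> Basis" "i \<noteq> j"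
begin

lemma quarter_turn_inner:
  assumes "b \<in> Basis"
  shows "quarter_turn i j z \<bullet> b = (if b = i then z \<bullet> j else if b = j then - (z \<bullet> i) else z \<bullet> b)"
  using ij assms by (auto simp: quarter_turn_def inner_add_left inner_Basis)

lemma transpose_Basis: "bij_betw (Transposition.transpose i j) Basis Basis"
  using ij by (intro bij_betw_byWitness[where f' = "Transposition.transpose i j"]) (auto simp: Transposition.transpose_def)

lemma norm_quarter_turn: "norm (quarter_turn i j z) = norm z"
proof -
  have n: "(norm y)\<^sup>2 = (\<Sum>b\<in>Basis. (y \<bullet> b)\<^sup>2)" for y :: 'a
    unfolding power2_norm_eq_inner by (subst euclidean_inner) (simp add: power2_eq_square)
  have "(quarter_turn i j z \<bullet> b)\<^sup>2 = (z \<bullet> Transposition.transpose i j b)\<^sup>2" if "b \<in> Basis" for b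
    using that by (simp add: quarter_turn_inner Transposition.transpose_def)
  then have "(\<Sum>b\<in>Basis. (quarter_turn i j z \<bullet> b)\<^sup>2) = (\<Sum>b\<in>Basis. (z \<bullet> Transposition.transpose i j b)\<^sup>2)"
    by (intro sum.cong) auto
  also have "\<dots> = (\<Sum>b\<in>Basis. (z \<bullet> b)\<^sup>2)"
    by (rule sum.reindex_bij_betw[OF transpose_Basis])
  finally show ?thesis
    by (simp add: norm_eq_sqrt_inner n[unfolded power2_norm_eq_inner])
qed

lemma quarter_turn_measurable: "quarter_turn i j \<in> borel_measurable borel"
  unfolding quarter_turn_def by (intro borel_measurable_continuous_onI continuous_intros)

text \<open>Lebesgue measure is determined by its values on boxes, and the preimage of a box is a
  box with two sides exchanged and one of them reflected, hence of equal volume.\<close>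

lemma distr_quarter_turn: "distr lborel borel (quarter_turn i j) = lborel"
proof (rule lborel_eqI[symmetric])
  fix l u :: 'a assume lu: "\<And>b. b \<in> Basis \<Longrightarrow> l \<bullet> b \<le> u \<bullet> b"
  \<comment> \<open>Side \<open>i\<close> of the preimage is the reflected side \<open>j\<close> of
    the box, and side \<open>j\<close> of the preimage is its side \<open>i\<close>.\<close>
  define l' where "l' = l + (- (u \<bullet> j) - l \<bullet> i) *\<^sub>R i + (l \<bullet> i - l \<bullet> j) *\<^sub>R j"
  define u' where "u' = u + (- (l \<bullet> j) - u \<bullet> i) *\<^sub>R i + (u \<bullet> i - u \<bullet> j) *\<^sub>R j"
  have l': "l' \<bullet> b = (if b = i then - (u \<bullet> j) else if b = j then l \<bullet> i else l \<bullet> b)" if "b \<in> Basis" for b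
    using ij that by (auto simp: l'_def inner_add_left inner_Basis)
  have u': "u' \<bullet> b = (if b = i then - (l \<bullet> j) else if b = j then u \<bullet> i else u \<bullet> b)" if "b \<in> Basis" for b
    using ij that by (auto simp: u'_def inner_add_left inner_Basis)
  have eq: "quarter_turn i j -` box l u = box l' u'"
  proof (intro set_eqI iffI)
    fix z assume z: "z \<in> quarter_turn i j -` box l u"
    then have z': "l \<bullet> b < quarter_turn i j z \<bullet> b \<and> quarter_turn i j z \<bullet> b < u \<bullet> b" if "b \<in> Basis" for b
      using that by (simp add: mem_box)
    show "z \<in> box l' u'"
      unfolding mem_box
    proof
      fix b :: 'a assume b: "b \<in> Basis"
      show "l' \<bullet> b < z \<bullet> b \<and> z \<bullet> b < u' \<bullet> b"
        using z'[OF b] z'[OF ij(1)] z'[OF ij(2)] ij b by (auto simp: quarter_turn_inner l' u' split: if_splits)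
    qed
  next
    fix z assume "z \<in> box l' u'"
    then have z': "l' \<bullet> b < z \<bullet> b \<and> z \<bullet> b < u' \<bullet> b" if "b \<in> Basis" for b
      using that by (simp add: mem_box)
    show "z \<in> quarter_turn i j -` box l u"
      unfolding vimage_eq mem_box
    proof
      fix b :: 'a assume b: "b \<in> Basis"
      show "l \<bullet> b < quarter_turn i j z \<bullet> b \<and> quarter_turn i j z \<bullet> b < u \<bullet> b"
        using z'[OF b] z'[OF ij(1)] z'[OF ij(2)] ij b by (auto simp: quarter_turn_inner l' u' split: if_splits)
    qed
  qed
  have "emeasure (distr lborel borel (quarter_turn i j)) (box l u) = emeasure lborel (box l' u')"
    using quarter_turn_measurable by (subst emeasure_distr) (auto simp: eq)
  also have "\<dots> = (\<Prod>b\<in>Basis. (u' - l') \<bullet> b)"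
    using lu ij by (intro emeasure_lborel_box) (auto simp: l' u')
  also have "(\<Prod>b\<in>Basis. (u' - l') \<bullet> b) = (\<Prod>b\<in>Basis. (u - l) \<bullet> Transposition.transpose i j b)"
    by (intro prod.cong) (auto simp: inner_diff_left l' u' Transposition.transpose_def)
  also have "\<dots> = (\<Prod>b\<in>Basis. (u - l) \<bullet> b)"
    by (rule prod.reindex_bij_betw[OF transpose_Basis])
  finally show "emeasure (distr lborel borel (quarter_turn i j)) (box l u) = (\<Prod>b\<in>Basis. (u - l) \<bullet> b)" .
qed simp

lemma integral_quarter_turn:
  fixes g :: "'a \<Rightarrow> real"
  assumes "g \<in> borel_measurable borel"
  shows "(LINT z|lborel. g (quarter_turn i j z)) = (LINT z|lborel. g z)"
proof -
  have "(LINT z|lborel. g z) = (LINT z|distr lborel borel (quarter_turn i j). g z)"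
    by (simp add: distr_quarter_turn)
  also have "\<dots> = (LINT z|lborel. g (quarter_turn i j z))"
    using assms quarter_turn_measurable by (intro integral_distr) auto
  finally show ?thesis by simp
qed

end

text \<open>Quarter turns make the second moment matrix a multiple of the identity; the trace
  \<open>DIM('a)\<close> fixes the multiple as 1, and bilinearity extends this from
  \<open>Basis\<close> to all vectors.\<close>

lemma kernel_radial:
  fixes \<rho> :: "'a::euclidean_space \<Rightarrow> real"
  assumes [measurable]: "\<rho> \<in> borel_measurable borel" and nonneg: "\<And>z. 0 \<le> \<rho> z"
    and supp: "\<And>z. \<delta> \<le> norm z \<Longrightarrow> \<rho> z = 0" and radial: "\<And>y z. norm y = norm z \<Longrightarrow> \<rho> y = \<rho> z"
    and int: "integrable lborel (\<lambda>z. \<rho> z * (norm z)\<^sup>2)" and eq: "(LINT z|lborel. \<rho> z * (norm z)\<^sup>2) = DIM('a)"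
  shows "kernel \<rho> \<delta>"
proof -
  define I where "I a b = (LINT z|lborel. \<rho> z * ((a \<bullet> z) * (b \<bullet> z)))" for a b
  have int2: "integrable lborel (\<lambda>z. \<rho> z * ((a \<bullet> z) * (b \<bullet> z)))" for a b
  proof (rule Bochner_Integration.integrable_bound)
    show "integrable lborel (\<lambda>z. norm a * norm b * (\<rho> z * (norm z)\<^sup>2))"
      using int by simp
    have "norm (\<rho> z * ((a \<bullet> z) * (b \<bullet> z))) \<le> norm (norm a * norm b * (\<rho> z * (norm z)\<^sup>2))" for z
    proof -
      have "\<bar>(a \<bullet> z) * (b \<bullet> z)\<bar> \<le> (norm a * norm z) * (norm b * norm z)"
        unfolding abs_mult by (intro mult_mono Cauchy_Schwarz_ineq2) auto
      from mult_left_mono[OF this nonneg[of z]] show ?thesis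
        using nonneg[of z] by (simp add: abs_mult power2_eq_square mult_ac)
    qed
    then show "AE z in lborel. norm (\<rho> z * ((a \<bullet> z) * (b \<bullet> z))) \<le> norm (norm a * norm b * (\<rho> z * (norm z)\<^sup>2))"
      by simp
  qed measurable
  have turn: "I i j = 0 \<and> I i i = I j j" if ij: "i \<in> Basis" "j \<in> Basis" "i \<noteq> j" for i j
  proof
    have \<rho>: "\<rho> (quarter_turn i j z) = \<rho> z" for z
      by (rule radial) (rule norm_quarter_turn[OF ij])
    have q: "i \<bullet> quarter_turn i j z = j \<bullet> z" "j \<bullet> quarter_turn i j z = - (i \<bullet> z)" for z
      using quarter_turn_inner[OF ij, of i z] quarter_turn_inner[OF ij, of j z] ij by (auto simp: inner_commute)
    \<comment> \<open>The turn preserves \<open>\<rho>\<close> and changes the sign of the product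
      of the two coordinates.\<close>
    have "I i j = (LINT z|lborel. \<rho> (quarter_turn i j z) * ((i \<bullet> quarter_turn i j z) * (j \<bullet> quarter_turn i j z)))"
      unfolding I_def by (rule integral_quarter_turn[OF ij, symmetric]) measurable
    also have "\<dots> = - I i j"
      by (simp add: \<rho> q I_def mult.commute)
    finally show "I i j = 0" by simp
    have "I i i = (LINT z|lborel. \<rho> (quarter_turn i j z) * ((i \<bullet> quarter_turn i j z) * (i \<bullet> quarter_turn i j z)))"
      unfolding I_def by (rule integral_quarter_turn[OF ij, symmetric]) measurable
    also have "\<dots> = I j j"
      by (simp add: \<rho> q I_def)
    finally show "I i i = I j j" .
  qed
  have "real DIM('a) = (LINT z|lborel. (\<Sum>b\<in>Basis. \<rho> z * ((b \<bullet> z) * (b \<bullet> z))))"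
    unfolding eq[symmetric] power2_norm_eq_inner
    by (subst euclidean_inner) (simp add: sum_distrib_left inner_commute)
  also have "\<dots> = (\<Sum>b\<in>Basis. I b b)"
    unfolding I_def by (rule Bochner_Integration.integral_sum) (rule int2)
  finally have sum: "(\<Sum>b\<in>(Basis::'a set). I b b) = DIM('a)" by simp
  have one: "I i i = 1" if "i \<in> Basis" for i
  proof -
    have "(\<Sum>b\<in>(Basis::'a set). I b b) = (\<Sum>b\<in>(Basis::'a set). I i i)"
      using turn[OF that] by (intro sum.cong) metis+
    then show ?thesis using sum by simp
  qed
  have Iab: "I a b = a \<bullet> b" for a b
  proof -
    have "I a b = (LINT z|lborel. (\<Sum>i\<in>Basis. \<Sum>j\<in>Basis. (a \<bullet> i) * (b \<bullet> j) * (\<rho> z * ((i \<bullet> z) * (j \<bullet> z)))))"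
    proof -
      have "\<rho> z * ((a \<bullet> z) * (b \<bullet> z)) =
          (\<Sum>i\<in>Basis. \<Sum>j\<in>Basis. (a \<bullet> i) * (b \<bullet> j) * (\<rho> z * ((i \<bullet> z) * (j \<bullet> z))))" for z
        unfolding euclidean_inner[of a z] euclidean_inner[of b z]
        unfolding sum_product unfolding sum_distrib_left
        by (intro sum.cong refl) (simp add: mult_ac inner_commute)
      then show ?thesis
        unfolding I_def by presburger
    qed
    also have "\<dots> = (\<Sum>i\<in>Basis. \<Sum>j\<in>Basis. (a \<bullet> i) * (b \<bullet> j) * I i j)"
      unfolding I_def using int2
      by (subst Bochner_Integration.integral_sum, simp)+ (simp add: int2)
    also have "\<dots> = (\<Sum>i\<in>Basis. (a \<bullet> i) * (b \<bullet> i))"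
    proof (intro sum.cong refl)
      fix i :: 'a assume i: "i \<in> Basis"
      have "(\<Sum>j\<in>Basis. (a \<bullet> i) * (b \<bullet> j) * I i j) = (\<Sum>j\<in>Basis. if j = i then (a \<bullet> i) * (b \<bullet> i) else 0)"
        using turn[OF i] one[OF i] by (intro sum.cong) auto
      then show "(\<Sum>j\<in>Basis. (a \<bullet> i) * (b \<bullet> j) * I i j) = (a \<bullet> i) * (b \<bullet> i)"
        using i by simp
    qed
    finally show ?thesis by (simp add: euclidean_inner[of a b])
  qed
  show ?thesis
    unfolding kernel_def using int2 Iab nonneg supp by (auto simp: I_def)
qed

text \<open>The factor for which the second moments of the truncated fractional kernel are normalized.\<close>

definition kernel_scale :: "nat \<Rightarrow> real \<Rightarrow> real \<Rightarrow> real" where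
  "kernel_scale N \<delta> s = (2 - 2 * s) / (unit_ball_vol (real N) * \<delta> powr (2 - 2 * s))"

definition fractional_kernel :: "real \<Rightarrow> real \<Rightarrow> 'a::euclidean_space \<Rightarrow> real" where
  "fractional_kernel \<delta> s z =
     (if norm z < \<delta> then kernel_scale DIM('a) \<delta> s / norm z powr (real DIM('a) + 2 * s) else 0)"

lemma kernel_scale_pos:
  assumes "s < 1" "0 < \<delta>"
  shows "0 < kernel_scale N \<delta> s"
  unfolding kernel_scale_def using assms by (intro divide_pos_pos mult_pos_pos) auto

text \<open>\<open>kernel_scale\<close> is the dimension divided by the second moment found in
  \<open>integral_fractional_kernel\<close>.\<close>

lemma kernel_fractional_kernel:
  assumes "s < 1" "0 < \<delta>"
  shows "kernel (fractional_kernel \<delta> s :: 'a::euclidean_space \<Rightarrow> real) \<delta>"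
proof (rule kernel_radial)
  let ?c = "kernel_scale DIM('a) \<delta> s"
  let ?h = "\<lambda>z::'a. indicator (ball 0 \<delta>) z * ((norm z)\<^sup>2 / norm z powr (DIM('a) + 2 * s))"
  have eq: "(\<lambda>z::'a. fractional_kernel \<delta> s z * (norm z)\<^sup>2) = (\<lambda>z. ?c * ?h z)"
    by (auto simp: fractional_kernel_def indicator_def)
  show "(fractional_kernel \<delta> s :: 'a \<Rightarrow> real) \<in> borel_measurable borel"
    unfolding fractional_kernel_def[abs_def] by measurable
  show "0 \<le> fractional_kernel \<delta> s z" for z :: 'a
    using kernel_scale_pos[OF assms, of "DIM('a)"] by (simp add: fractional_kernel_def)
  show "integrable lborel (\<lambda>z::'a. fractional_kernel \<delta> s z * (norm z)\<^sup>2)"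
    unfolding eq using integrable_fractional_kernel[OF assms] by (rule integrable_mult_right)
  have cancel: "c / (V * P) * (N * V * P / c) = N" if "c \<noteq> 0" "V \<noteq> 0" "P \<noteq> 0" for c V P N :: real
    using that by simp
  have V: "unit_ball_vol (real DIM('a)) \<noteq> 0"
    by (rule less_imp_neq[symmetric]) simp
  show "(LINT z|lborel. fractional_kernel \<delta> s (z::'a) * (norm z)\<^sup>2) = DIM('a)"
    unfolding eq integral_mult_right_zero integral_fractional_kernel[OF assms] kernel_scale_def
    by (rule cancel[OF _ V]) (use assms in auto)
qed (auto simp: fractional_kernel_def)

subsection \<open>Convergence of the solutions\<close>

context vanishing_horizon
begin

text \<open>Two limits in a fixed order: for each \<open>n\<close> the index \<open>j\<close> goes
  to infinity and leaves the bound \<open>b n\<close> on the squared distance from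
  \<open>u j\<close> to \<open>\<phi> n\<close>; only then is \<open>n\<close> chosen large.\<close>

lemma solutions_converge:
  fixes u :: "nat \<Rightarrow> 'a \<Rightarrow> real"
  assumes lip: "lipschitz_boundary \<Omega>"
    and u: "\<And>j. sq_int lborel (u j)" "\<And>j. sq_int lborel (diffq (\<rho> j) (u j))" "\<And>j x. u j x \<noteq> 0 \<Longrightarrow> x \<in> \<Omega>"
    and self: "\<And>j. energy_form (\<rho> j) (u j) (u j) = (LINT x|lborel. f x * u j x)"
    and test: "\<And>j \<phi>. test_function \<Omega> \<phi> \<Longrightarrow> energy_form (\<rho> j) (u j) \<phi> = (LINT x|lborel. f x * \<phi> x)"
    and u0: "sq_int (lebesgue_on \<Omega>) u0"
    and \<phi>: "\<And>n. test_function \<Omega> (\<phi> n)"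
    and \<phi>u0: "(\<lambda>n::nat. nrm (lebesgue_on \<Omega>) (\<lambda>x. \<phi> n x - u0 x)) \<longlonglongrightarrow> 0"
    and \<phi>G: "(\<lambda>n. nrm (lebesgue_on \<Omega>) (\<lambda>x. gradient (\<phi> n) x - G x)) \<longlonglongrightarrow> 0"
  shows "(\<lambda>j. nrm (lebesgue_on \<Omega>) (\<lambda>x. u j x - u0 x)) \<longlonglongrightarrow> 0"
proof -
  obtain R0 where R0: "0 < R0" "\<And>x. x \<in> \<Omega> \<Longrightarrow> norm x \<le> R0"
    using \<Omega>(2) unfolding bounded_pos by blast
  \<comment> \<open>Enlarged by 1 for the strict bound that \<open>poincare\<close> asks for, and so
    that \<open>2 * R\<close> exceeds every horizon.\<close>
  define R where "R = R0 + 1"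
  have R: "1 \<le> R" "\<And>x. x \<in> \<Omega> \<Longrightarrow> norm x < R"
    using R0 by (force simp: R_def)+
  have dR: "d j \<le> 2 * R" for j
    using d(2)[of j] R(1) by simp
  have poinc: "(nrm lborel v)\<^sup>2 \<le> 16 * R\<^sup>2 * (nrm lborel (diffq (\<rho> j) v))\<^sup>2"
    if "sq_int lborel v" "sq_int lborel (diffq (\<rho> j) v)" "\<And>x. v x \<noteq> 0 \<Longrightarrow> x \<in> \<Omega>" for v j
    using that R(2) by (intro poincare[OF kernel _ _ dR]) auto
  \<comment> \<open>A priori bound: testing the equation with \<open>u j\<close> bounds its squared
    energy norm by \<open>nrm lborel f * nrm lborel (u j)\<close>, and the Poincare inequality
    bounds the last factor by \<open>4 * R\<close> times the energy norm.\<close>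
  define E where "E = 4 * R * nrm lborel f"
  have bounds: "nrm lborel (u j) \<le> 4 * R * E" "nrm lborel (diffq (\<rho> j) (u j)) \<le> E" for j
  proof -
    let ?e = "nrm lborel (diffq (\<rho> j) (u j))"
    have "(nrm lborel (u j))\<^sup>2 \<le> (4 * R * ?e)\<^sup>2"
      using poinc[OF u(1,2,3), of j] by (simp add: power_mult_distrib)
    then have 1: "nrm lborel (u j) \<le> 4 * R * ?e"
      by (rule power2_le_imp_le) (use R(1) in simp)
    have "?e\<^sup>2 = (LINT x|lborel. f x * u j x)"
      using self[of j] by (simp add: energy_form_self)
    also have "\<dots> \<le> nrm lborel f * nrm lborel (u j)"
      using Cauchy_Schwarz_integral[OF f u(1), of j] by simp
    also have "\<dots> \<le> nrm lborel f * (4 * R * ?e)"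
      by (intro mult_left_mono 1) simp
    finally have "?e * ?e \<le> E * ?e"
      by (simp add: E_def power2_eq_square mult_ac)
    then show 2: "?e \<le> E"
      using R(1) by (cases "?e = 0") (auto simp: E_def mult_le_cancel_right less_le)
    have "4 * R * ?e \<le> 4 * R * E"
      using R(1) 2 by (intro mult_left_mono) auto
    then show "nrm lborel (u j) \<le> 4 * R * E"
      using 1 by linarith
  qed
  have "bounded_energy u"
    unfolding bounded_energy_def
  proof (intro conjI allI impI exI[of _ "max (4 * R * E) E"])
    show "nrm lborel (u j) \<le> max (4 * R * E) E" "nrm lborel (diffq (\<rho> j) (u j)) \<le> max (4 * R * E) E" for j
      using bounds[of j] by auto
  qed (use u in auto)
  from consistent_bounded_energy[OF lip this] obtain C where
    C: "\<And>\<psi> \<epsilon>. test_function \<Omega> \<psi> \<Longrightarrow> 0 < \<epsilon> \<Longrightarrow>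
      \<forall>\<^sub>F j in sequentially. \<bar>(LINT x|lborel. f x * u j x) - energy_form (\<rho> j) \<psi> (u j)\<bar>
        \<le> C * nrm (lebesgue_on \<Omega>) (\<lambda>x. gradient \<psi> x - G x) + \<epsilon>"
    unfolding consistent_def by blast
  define \<kappa> where "\<kappa> n = nrm (lebesgue_on \<Omega>) (\<lambda>x. gradient (\<phi> n) x - G x)" for n
  \<comment> \<open>The first term is the consistency error for \<open>\<phi> n\<close>. The second
    bounds the defect of \<open>\<phi> n\<close> in the identity between the squared gradient norm
    and the integral of \<open>f * \<phi> n\<close>, which holds in the limit.\<close>
  define b where "b n = 16 * R\<^sup>2 * (C * \<kappa> n + \<kappa> n * (nrm (lebesgue_on \<Omega>) G + \<kappa> n))" for n
  have \<kappa>0: "\<kappa> \<longlonglongrightarrow> 0"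
    using \<phi>G by (simp add: \<kappa>_def[abs_def])
  have b0: "b \<longlonglongrightarrow> 0"
    unfolding b_def[abs_def] by (rule tendsto_eq_intros \<kappa>0 refl | simp)+
  have key: "\<forall>\<^sub>F j in sequentially. (nrm lborel (\<lambda>x. u j x - \<phi> n x))\<^sup>2 \<le> b n + \<eta>" if \<eta>: "0 < \<eta>" for n \<eta>
  proof -
    define \<epsilon> where "\<epsilon> = \<eta> / (32 * R\<^sup>2)"
    have \<epsilon>: "0 < \<epsilon>" "16 * R\<^sup>2 * (2 * \<epsilon>) = \<eta>"
      using \<eta> R(1) by (auto simp: \<epsilon>_def)
    have "(\<lambda>j. energy_form (\<rho> j) (\<phi> n) (\<phi> n)) \<longlonglongrightarrow> (nrm lborel (gradient (\<phi> n)))\<^sup>2"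
      by (rule energy_form_test_tendsto[OF kernel d(1,3) \<phi>])
    then have "\<forall>\<^sub>F j in sequentially. energy_form (\<rho> j) (\<phi> n) (\<phi> n) < (nrm lborel (gradient (\<phi> n)))\<^sup>2 + \<epsilon>"
      using \<epsilon> by (intro order_tendstoD(2)) auto
    moreover note C[OF \<phi> \<epsilon>(1), of n]
    ultimately show ?thesis
    proof eventually_elim
      case (elim j)
      note s\<phi> = test_function_diffq_sq_int[OF kernel[of j] d(2)[of j] \<phi>[of n]]
      note sd = sq_int_diffq_diff[OF u(2)[of j] s\<phi>]
      have E: "energy_form (\<rho> j) (u j) (\<phi> n) = (LINT x|lborel. f x * \<phi> n x)"
        by (rule test[OF \<phi>])
      have "(nrm lborel (diffq (\<rho> j) (\<lambda>x. u j x - \<phi> n x)))\<^sup>2 =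
          energy_form (\<rho> j) (\<lambda>x. u j x - \<phi> n x) (\<lambda>x. u j x - \<phi> n x)"
        by (simp add: energy_form_self)
      also have "\<dots> = energy_form (\<rho> j) (u j) (u j) - 2 * energy_form (\<rho> j) (u j) (\<phi> n) + energy_form (\<rho> j) (\<phi> n) (\<phi> n)"
        using energy_form_diff_right[OF sd u(2)[of j] s\<phi>]
          energy_form_diff_right[OF u(2)[of j] u(2)[of j] s\<phi>] energy_form_diff_right[OF s\<phi> u(2)[of j] s\<phi>]
          energy_form_commute[of "\<rho> j" "\<lambda>x. u j x - \<phi> n x" "u j"]
          energy_form_commute[of "\<rho> j" "\<lambda>x. u j x - \<phi> n x" "\<phi> n"] energy_form_commute[of "\<rho> j" "\<phi> n" "u j"]
        by linarith
      \<comment> \<open>By symmetry and the equation,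
        \<open>energy_form (\<rho> j) (\<phi> n) (u j)\<close> in the consistency estimate is the
        integral of \<open>f * \<phi> n\<close>; this cancels one of the two subtracted
        copies.\<close>
      also have "\<dots> \<le> (C * \<kappa> n + \<epsilon>) + ((nrm lborel (gradient (\<phi> n)))\<^sup>2 - (LINT x|lborel. f x * \<phi> n x)) + \<epsilon>"
        using elim E self[of j] energy_form_commute[of "\<rho> j" "\<phi> n" "u j"] by (simp add: \<kappa>_def)
      also have "(nrm lborel (gradient (\<phi> n)))\<^sup>2 - (LINT x|lborel. f x * \<phi> n x) \<le>
          \<kappa> n * (nrm (lebesgue_on \<Omega>) G + \<kappa> n)"
      proof -
        note sg = test_function_gradient_lebesgue_on(1)[OF \<phi>[of n]]
        have "(nrm lborel (gradient (\<phi> n)))\<^sup>2 - (LINT x|lborel. f x * \<phi> n x) =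
            (LINT x|lebesgue_on \<Omega>. gradient (\<phi> n) x \<bullet> gradient (\<phi> n) x) - (LINT x|lebesgue_on \<Omega>. G x \<bullet> gradient (\<phi> n) x)"
          by (simp add: G_eq[OF \<phi>] test_function_gradient_lebesgue_on(2)[OF \<phi>, symmetric] nrm_power2 power2_norm_eq_inner)
        also have "\<dots> = (LINT x|lebesgue_on \<Omega>. (gradient (\<phi> n) x - G x) \<bullet> gradient (\<phi> n) x)"
          using integrable_inner_sq_int[OF sg sg] integrable_inner_sq_int[OF G sg] by (simp add: inner_diff_left)
        also have "\<dots> \<le> \<kappa> n * nrm (lebesgue_on \<Omega>) (gradient (\<phi> n))"
          using Cauchy_Schwarz_integral[OF sq_int_diff[OF sg G] sg] by (simp add: \<kappa>_def)
        also have "\<dots> \<le> \<kappa> n * (nrm (lebesgue_on \<Omega>) G + \<kappa> n)"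
          using nrm_diff_le[OF sg G] by (intro mult_left_mono) (auto simp: \<kappa>_def)
        finally show ?thesis .
      qed
      finally have "(nrm lborel (diffq (\<rho> j) (\<lambda>x. u j x - \<phi> n x)))\<^sup>2 \<le>
          C * \<kappa> n + \<kappa> n * (nrm (lebesgue_on \<Omega>) G + \<kappa> n) + 2 * \<epsilon>"
        by linarith
      then have "16 * R\<^sup>2 * (nrm lborel (diffq (\<rho> j) (\<lambda>x. u j x - \<phi> n x)))\<^sup>2 \<le>
          16 * R\<^sup>2 * (C * \<kappa> n + \<kappa> n * (nrm (lebesgue_on \<Omega>) G + \<kappa> n) + 2 * \<epsilon>)"
        by (rule mult_left_mono) simp
      also have "\<dots> = b n + \<eta>"
        unfolding b_def \<epsilon>(2)[symmetric] by (simp only: distrib_left)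
      finally have "16 * R\<^sup>2 * (nrm lborel (diffq (\<rho> j) (\<lambda>x. u j x - \<phi> n x)))\<^sup>2 \<le> b n + \<eta>" .
      moreover have "(nrm lborel (\<lambda>x. u j x - \<phi> n x))\<^sup>2 \<le> 16 * R\<^sup>2 * (nrm lborel (diffq (\<rho> j) (\<lambda>x. u j x - \<phi> n x)))\<^sup>2"
      proof (rule poinc[OF _ sd])
        show "sq_int lborel (\<lambda>x. u j x - \<phi> n x)"
          by (intro sq_int_diff u test_function_sq_int(1)[OF \<phi>])
        show "x \<in> \<Omega>" if "u j x - \<phi> n x \<noteq> 0" for x
          using that u(3)[of j x] test_function_eq_0[OF \<phi>[of n], of x] by (cases "u j x = 0") auto
      qed
      ultimately show ?case by linarith
    qed
  qed
  show ?thesis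
  proof (rule tendstoI)
    fix \<epsilon> :: real assume \<epsilon>: "0 < \<epsilon>"
    have "\<forall>\<^sub>F n in sequentially. b n < (\<epsilon> / 2)\<^sup>2 / 2"
      using b0 \<epsilon> by (intro order_tendstoD(2)) auto
    moreover have "\<forall>\<^sub>F n in sequentially. nrm (lebesgue_on \<Omega>) (\<lambda>x. \<phi> n x - u0 x) < \<epsilon> / 2"
      using \<phi>u0 \<epsilon> by (intro order_tendstoD(2)) auto
    ultimately have "\<forall>\<^sub>F n in sequentially. b n < (\<epsilon> / 2)\<^sup>2 / 2 \<and> nrm (lebesgue_on \<Omega>) (\<lambda>x. \<phi> n x - u0 x) < \<epsilon> / 2"
      by (rule eventually_conj)
    then obtain n where n: "b n < (\<epsilon> / 2)\<^sup>2 / 2" "nrm (lebesgue_on \<Omega>) (\<lambda>x. \<phi> n x - u0 x) < \<epsilon> / 2"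
      by (auto dest!: eventually_happens)
    have "\<forall>\<^sub>F j in sequentially. (nrm lborel (\<lambda>x. u j x - \<phi> n x))\<^sup>2 \<le> b n + (\<epsilon> / 2)\<^sup>2 / 2"
      using \<epsilon> by (intro key) simp
    then show "\<forall>\<^sub>F j in sequentially. dist (nrm (lebesgue_on \<Omega>) (\<lambda>x. u j x - u0 x)) 0 < \<epsilon>"
    proof eventually_elim
      case (elim j)
      have m: "u j \<in> borel_measurable borel" "\<phi> n \<in> borel_measurable borel"
        using u(1)[of j] test_function_measurable[OF \<phi>] by (auto simp: sq_int_def)
      have z: "\<And>x. x \<notin> \<Omega> \<Longrightarrow> u j x = 0" "\<And>x. x \<notin> \<Omega> \<Longrightarrow> \<phi> n x = 0"
        using u(3) test_function_eq_0[OF \<phi>] by auto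
      have s: "sq_int (lebesgue_on \<Omega>) (u j)" "sq_int (lebesgue_on \<Omega>) (\<phi> n)"
        using sq_int_lebesgue_on_support[OF m(1) \<Omega>(1)] sq_int_lebesgue_on_support[OF m(2) \<Omega>(1)] z u(1)
          test_function_sq_int(1)[OF \<phi>] by auto
      have "(nrm lborel (\<lambda>x. u j x - \<phi> n x))\<^sup>2 < (\<epsilon> / 2)\<^sup>2"
        using elim n(1) by linarith
      then have "nrm lborel (\<lambda>x. u j x - \<phi> n x) < \<epsilon> / 2"
        by (rule power2_less_imp_less) (use \<epsilon> in simp)
      moreover have "nrm (lebesgue_on \<Omega>) (\<lambda>x. u j x - \<phi> n x) = nrm lborel (\<lambda>x. u j x - \<phi> n x)"
        using m z by (intro nrm_lebesgue_on_support \<Omega>(1) borel_measurable_diff) auto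
      ultimately show ?case
        using nrm_triangle_diff[OF s u0] n(2) by simp
    qed
  qed
qed

end

subsection \<open>Test functions in the local problem\<close>

lemma weak_gradient_test_function:
  assumes \<Omega>: "open \<Omega>" and \<phi>: "test_function \<Omega> \<phi>"
  shows "weak_gradient \<Omega> \<phi> (gradient \<phi>)"
proof -
  have m[measurable]: "\<phi> \<in> borel_measurable borel" "gradient \<phi> \<in> borel_measurable borel"
    by (rule test_function_measurable[OF \<phi>], rule test_function_gradient_measurable[OF \<phi>])
  have z: "\<And>x. x \<notin> \<Omega> \<Longrightarrow> \<phi> x = 0" "\<And>x. x \<notin> \<Omega> \<Longrightarrow> gradient \<phi> x = 0"
    using test_function_eq_0[OF \<phi>] test_function_gradient_eq_0[OF \<phi>] by auto
  have s: "L2 \<Omega> \<phi>" "L2 \<Omega> (gradient \<phi>)"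
    unfolding L2_iff_sq_int using sq_int_lebesgue_on_support[OF m(1) \<Omega> z(1)] sq_int_lebesgue_on_support[OF m(2) \<Omega> z(2)]
      test_function_sq_int[OF \<phi>] by auto
  have "(LINT x|lebesgue_on \<Omega>. \<phi> x * partial i \<xi> x) = - (LINT x|lebesgue_on \<Omega>. (gradient \<phi> x \<bullet> i) * \<xi> x)"
    if \<xi>: "test_function \<Omega> \<xi>" and i: "i \<in> Basis" for \<xi> i
  proof -
    have [measurable]: "\<xi> \<in> borel_measurable borel" "partial i \<xi> \<in> borel_measurable borel"
      by (rule test_function_measurable[OF \<xi>], rule test_function_measurable[OF test_function_partial[OF \<xi> i]])
    have "(LINT x|lebesgue_on \<Omega>. \<phi> x * partial i \<xi> x) = (LINT x|lborel. \<phi> x * partial i \<xi> x)"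
      by (intro integral_lebesgue_on_support \<Omega>) (auto simp: z)
    moreover have "(LINT x|lebesgue_on \<Omega>. (gradient \<phi> x \<bullet> i) * \<xi> x) = (LINT x|lborel. (gradient \<phi> x \<bullet> i) * \<xi> x)"
      by (intro integral_lebesgue_on_support \<Omega>) (auto simp: z)
    ultimately show ?thesis
      using integration_by_parts[OF \<xi> \<phi> i] by (simp add: gradient_inner[OF i])
  qed
  with s show ?thesis
    by (auto simp: weak_gradient_def)
qed

lemma test_function_in_H10:
  assumes "open \<Omega>" "test_function \<Omega> \<phi>"
  shows "\<phi> \<in> H10 \<Omega>"
proof -
  have "(\<lambda>n::nat. L2_norm \<Omega> (\<lambda>x. \<phi> x - \<phi> x)) \<longlonglongrightarrow> 0" "(\<lambda>n::nat. L2_norm \<Omega> (\<lambda>x. gradient \<phi> x - gradient \<phi> x)) \<longlonglongrightarrow> 0"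
    by (simp_all add: L2_norm_def)
  then show ?thesis
    using weak_gradient_test_function[OF assms] assms(2) unfolding H10_def mem_Collect_eq
    by (intro exI[of _ "gradient \<phi>"] conjI exI[of _ "\<lambda>_. \<phi>"]) auto
qed

lemma sq_int_inner:
  assumes "sq_int M G"
  shows "sq_int M (\<lambda>x. G x \<bullet> i)"
proof (rule sq_int_bound)
  show "(\<lambda>x. G x \<bullet> i) \<in> borel_measurable M"
    using sq_int_measurable[OF assms] by (intro borel_measurable_inner) auto
  show "integrable M (\<lambda>x. (norm i)\<^sup>2 * (norm (G x))\<^sup>2)"
    using assms by (simp add: sq_int_def)
  show "(norm (G x \<bullet> i))\<^sup>2 \<le> (norm i)\<^sup>2 * (norm (G x))\<^sup>2" for x
    using power_mono[OF Cauchy_Schwarz_ineq2[of "G x" i] abs_ge_zero, of 2]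
    by (simp add: power_mult_distrib mult.commute)
qed

text \<open>Since second derivatives of test functions are test functions, all weak gradients act alike
  on gradients of test functions; no uniqueness theorem for weak gradients is needed.\<close>

lemma weak_gradient_inner_test:
  fixes \<Omega> :: "'a::euclidean_space set"
  assumes \<Omega>: "open \<Omega>" and G: "weak_gradient \<Omega> u G" and \<phi>: "test_function \<Omega> \<phi>"
  shows "(LINT x|lebesgue_on \<Omega>. G x \<bullet> gradient \<phi> x) =
    - (LINT x|lebesgue_on \<Omega>. u x * (\<Sum>i\<in>Basis. partial i (partial i \<phi>) x))"
proof -
  have sG: "sq_int (lebesgue_on \<Omega>) G" and su: "sq_int (lebesgue_on \<Omega>) u"
    using G by (simp_all add: weak_gradient_def L2_iff_sq_int)
  have st: "sq_int (lebesgue_on \<Omega>) \<xi>" if "test_function \<Omega> \<xi>" for \<xi>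
    using weak_gradient_test_function[OF \<Omega> that] by (simp add: weak_gradient_def L2_iff_sq_int)
  have t2: "test_function \<Omega> (partial i (partial i \<phi>))" if "i \<in> Basis" for i
    using test_function_partial[OF test_function_partial[OF \<phi> that] that] .
  have "(LINT x|lebesgue_on \<Omega>. G x \<bullet> gradient \<phi> x) = (LINT x|lebesgue_on \<Omega>. (\<Sum>i\<in>Basis. (G x \<bullet> i) * partial i \<phi> x))"
    by (subst euclidean_inner) (simp add: gradient_inner cong: sum.cong)
  also have "\<dots> = (\<Sum>i\<in>Basis. LINT x|lebesgue_on \<Omega>. (G x \<bullet> i) * partial i \<phi> x)"
    by (intro Bochner_Integration.integral_sum integrable_mult_sq_int sq_int_inner sG st test_function_partial \<phi>)
  also have "\<dots> = (\<Sum>i\<in>Basis. - (LINT x|lebesgue_on \<Omega>. u x * partial i (partial i \<phi>) x))"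
  proof (rule sum.cong[OF refl])
    fix i :: 'a assume i: "i \<in> Basis"
    show "(LINT x|lebesgue_on \<Omega>. (G x \<bullet> i) * partial i \<phi> x) = - (LINT x|lebesgue_on \<Omega>. u x * partial i (partial i \<phi>) x)"
      using G test_function_partial[OF \<phi> i] i unfolding weak_gradient_def by fastforce
  qed
  also have "\<dots> = - (LINT x|lebesgue_on \<Omega>. (\<Sum>i\<in>Basis. u x * partial i (partial i \<phi>) x))"
    by (subst Bochner_Integration.integral_sum) (auto intro!: integrable_mult_sq_int su st t2 simp: sum_negf)
  finally show ?thesis
    by (simp add: sum_distrib_left)
qed

text \<open>The notion of solution and membership in \<open>H10\<close> each come with a weak
  gradient of their own, here \<open>U\<close> and \<open>G\<close>; on gradients of test functions
  they act alike.\<close>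

lemma local_weak_solution_test:
  assumes \<Omega>: "open \<Omega>" and u: "local_weak_solution \<Omega> f u" and G: "weak_gradient \<Omega> u G" and \<phi>: "test_function \<Omega> \<phi>"
  shows "(LINT x|lebesgue_on \<Omega>. G x \<bullet> gradient \<phi> x) = (LINT x|lebesgue_on \<Omega>. f x * \<phi> x)"
proof -
  obtain U where U: "weak_gradient \<Omega> u U" "\<And>v V. v \<in> H10 \<Omega> \<Longrightarrow> weak_gradient \<Omega> v V \<Longrightarrow>
      (LINT x|lebesgue_on \<Omega>. U x \<bullet> V x) = (LINT x|lebesgue_on \<Omega>. f x * v x)"
    using u unfolding local_weak_solution_def by blast
  show ?thesis
    using U(2)[OF test_function_in_H10[OF \<Omega> \<phi>] weak_gradient_test_function[OF \<Omega> \<phi>]]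
      weak_gradient_inner_test[OF \<Omega> G \<phi>] weak_gradient_inner_test[OF \<Omega> U(1) \<phi>] by simp
qed

subsection \<open>The finite-horizon problem as a problem on the whole space\<close>

lemma ball_borel [measurable]: "ball x r \<in> sets borel"
  by simp

text \<open>The energy lives on pairs and evaluates functions at \<open>x + z\<close>. Borel
  measurability survives this composition, which is why a Borel version is chosen at the
  outset.\<close>

lemma borel_representative:
  fixes f :: "'a::euclidean_space \<Rightarrow> real"
  assumes f: "sq_int (lebesgue_on S) f" and S: "open S"
  obtains g where "sq_int lborel g" "\<And>x. x \<notin> S \<Longrightarrow> g x = 0" "AE x in lebesgue_on S. f x = g x"
proof -
  have Sl: "S \<in> sets lebesgue"
    using S by (simp add: sets_completionI_sets)
  have "f \<in> borel_measurable (lebesgue_on S)"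
    using f by (simp add: sq_int_def)
  then have "(\<lambda>x. if x \<in> S then f x else 0) \<in> borel_measurable lebesgue"
    by (rule borel_measurable_if_I[OF _ Sl])
  from completion_ex_borel_measurable_real[OF this] obtain g0 where
    g0[measurable]: "g0 \<in> borel_measurable lborel" and ae: "AE x in lborel. (if x \<in> S then f x else 0) = g0 x"
    by blast
  define g where "g x = indicator S x * g0 x" for x
  have gm: "g \<in> borel_measurable borel"
    unfolding g_def[abs_def] using S g0 by (intro borel_measurable_times borel_measurable_indicator) auto
  have z: "\<And>x. x \<notin> S \<Longrightarrow> g x = 0"
    by (simp add: g_def)
  have "AE x in lebesgue. x \<in> S \<longrightarrow> f x = g x"
    using AE_completion[OF ae] by eventually_elim (auto simp: g_def)
  then have aeS: "AE x in lebesgue_on S. f x = g x"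
    using Sl by (subst AE_restrict_space_iff) auto
  have "sq_int (lebesgue_on S) g"
    using sq_int_cong_AE[OF f borel_measurable_lebesgue_onI[OF gm] aeS] .
  then show ?thesis
    using that[of g] sq_int_lebesgue_on_support[OF gm S z] z aeS by blast
qed

context
  fixes \<Omega> :: "'a::euclidean_space set" and \<delta> s :: real
  assumes \<Omega>: "open \<Omega>" and \<delta>: "0 < \<delta>"
begin

lemma nonlocal_closure_eq: "nonlocal_closure \<delta> \<Omega> = (\<Union>x\<in>\<Omega>. ball x \<delta>)"
  using \<delta> by (auto simp: nonlocal_closure_def nonlocal_boundary_def dist_norm)

lemma open_nonlocal_closure: "open (nonlocal_closure \<delta> \<Omega>)"
  unfolding nonlocal_closure_eq by blast

text \<open>If at least one of two points at distance less than the horizon lies in the domain, then both lie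
  in the nonlocal closure.\<close>

lemma indicator_nonlocal_closure:
  fixes F :: "'a \<Rightarrow> 'a \<Rightarrow> 'b::semiring_1"
  assumes "\<And>x y. x \<notin> \<Omega> \<Longrightarrow> y \<notin> \<Omega> \<Longrightarrow> F x y = 0"
  shows "indicator (nonlocal_closure \<delta> \<Omega>) x * (indicator (nonlocal_closure \<delta> \<Omega> \<inter> ball x \<delta>) y * F x y) =
    indicator (ball x \<delta>) y * F x y"
proof (cases "y \<in> ball x \<delta> \<and> (x \<in> \<Omega> \<or> y \<in> \<Omega>)")
  case True
  then have "x \<in> nonlocal_closure \<delta> \<Omega>" "y \<in> nonlocal_closure \<delta> \<Omega>"
    unfolding nonlocal_closure_eq using \<delta> by (auto simp: dist_commute intro: bexI[of _ x] bexI[of _ y])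
  then show ?thesis
    by (simp add: indicator_def)
next
  case False
  then show ?thesis
    using assms[of x y] by (auto simp: indicator_def)
qed

lemma nn_integral_nonlocal_closure:
  fixes F :: "'a \<Rightarrow> 'a \<Rightarrow> ennreal"
  assumes [measurable]: "\<And>x. F x \<in> borel_measurable borel" and z: "\<And>x y. x \<notin> \<Omega> \<Longrightarrow> y \<notin> \<Omega> \<Longrightarrow> F x y = 0"
  shows "(\<integral>\<^sup>+x. (\<integral>\<^sup>+y. F x y \<partial>lebesgue_on (nonlocal_closure \<delta> \<Omega> \<inter> ball x \<delta>)) \<partial>lebesgue_on (nonlocal_closure \<delta> \<Omega>)) =
    (\<integral>\<^sup>+x. \<integral>\<^sup>+h. indicator (ball 0 \<delta>) h * F x (h + x) \<partial>lborel \<partial>lborel)"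
proof -
  let ?D = "nonlocal_closure \<delta> \<Omega>"
  have D[measurable]: "?D \<in> sets borel"
    using open_nonlocal_closure by simp
  have [simp]: "?D \<in> sets lebesgue" "?D \<inter> ball x \<delta> \<in> sets lebesgue" for x
    using D by (auto intro!: sets_completionI_sets)
  have "(\<integral>\<^sup>+x. (\<integral>\<^sup>+y. F x y \<partial>lebesgue_on (?D \<inter> ball x \<delta>)) \<partial>lebesgue_on ?D) =
      (\<integral>\<^sup>+x. (\<integral>\<^sup>+y. F x y * indicator (?D \<inter> ball x \<delta>) y \<partial>lborel) * indicator ?D x \<partial>lborel)"
    by (simp add: nn_integral_restrict_space nn_integral_completion)
  also have "\<dots> = (\<integral>\<^sup>+x. \<integral>\<^sup>+y. indicator (ball x \<delta>) y * F x y \<partial>lborel \<partial>lborel)"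
  proof (rule nn_integral_cong)
    fix x
    have "(\<integral>\<^sup>+y. F x y * indicator (?D \<inter> ball x \<delta>) y \<partial>lborel) * indicator ?D x =
        (\<integral>\<^sup>+y. indicator ?D x * (indicator (?D \<inter> ball x \<delta>) y * F x y) \<partial>lborel)"
    proof (subst nn_integral_cmult)
      show "(\<lambda>y. indicator (?D \<inter> ball x \<delta>) y * F x y) \<in> borel_measurable lborel"
        by (intro borel_measurable_times_ennreal borel_measurable_indicator) (simp_all add: assms(1) D)
    qed (simp add: mult.commute)
    also have "\<dots> = (\<integral>\<^sup>+y. indicator (ball x \<delta>) y * F x y \<partial>lborel)"
      using indicator_nonlocal_closure[of F, OF z] by simp
    finally show "(\<integral>\<^sup>+y. F x y * indicator (?D \<inter> ball x \<delta>) y \<partial>lborel) * indicator ?D x =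
        (\<integral>\<^sup>+y. indicator (ball x \<delta>) y * F x y \<partial>lborel)" .
  qed
  also have "\<dots> = (\<integral>\<^sup>+x. \<integral>\<^sup>+h. indicator (ball x \<delta>) (h + x) * F x (h + x) \<partial>lborel \<partial>lborel)"
    by (rule nn_integral_cong, rule nn_integral_lborel_translate[symmetric]) measurable
  also have "\<dots> = (\<integral>\<^sup>+x. \<integral>\<^sup>+h. indicator (ball 0 \<delta>) h * F x (h + x) \<partial>lborel \<partial>lborel)"
    by (simp add: indicator_def dist_norm)
  finally show ?thesis .
qed

text \<open>The measurability claim serves \<open>nonlocal_form_cong_AE\<close>, where almost
  everywhere equal functions must both be measurable for their integrals to be compared.\<close>

lemma integral_nonlocal_closure:
  fixes F :: "'a \<Rightarrow> 'a \<Rightarrow> real"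
  assumes m: "(\<lambda>p. F (fst p) (snd p)) \<in> borel_measurable borel" and z: "\<And>x y. x \<notin> \<Omega> \<Longrightarrow> y \<notin> \<Omega> \<Longrightarrow> F x y = 0"
  shows "(LINT x|lebesgue_on (nonlocal_closure \<delta> \<Omega>). LINT y|lebesgue_on (nonlocal_closure \<delta> \<Omega> \<inter> ball x \<delta>). F x y) =
    (LINT x|lborel. LINT h|lborel. indicator (ball 0 \<delta>) h * F x (h + x))"
    and "(\<lambda>x. LINT y|lebesgue_on (nonlocal_closure \<delta> \<Omega> \<inter> ball x \<delta>). F x y) \<in> borel_measurable (lebesgue_on (nonlocal_closure \<delta> \<Omega>))"
proof -
  let ?D = "nonlocal_closure \<delta> \<Omega>"
  let ?I = "\<lambda>x. LINT y|lebesgue_on (?D \<inter> ball x \<delta>). F x y"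
  let ?J = "\<lambda>x. LINT h|lborel. indicator (ball 0 \<delta>) h * F x (h + x)"
  have D[measurable]: "?D \<in> sets borel"
    using open_nonlocal_closure by simp
  have [simp]: "?D \<in> sets lebesgue"
    using D by (auto intro!: sets_completionI_sets)
  have Fx[measurable]: "F x \<in> borel_measurable borel" for x
  proof -
    have "(\<lambda>y. (x, y)) \<in> borel \<rightarrow>\<^sub>M (borel :: ('a \<times> 'a) measure)"
      by (intro borel_measurable_continuous_onI continuous_intros)
    from measurable_compose[OF this m] show ?thesis by simp
  qed
  have "(\<lambda>p. (fst p, snd p + fst p)) \<in> borel \<rightarrow>\<^sub>M (borel :: ('a \<times> 'a) measure)"
    by (intro borel_measurable_continuous_onI continuous_intros)
  from measurable_compose[OF this m] have "(\<lambda>p. F (fst p) (snd p + fst p)) \<in> borel_measurable borel"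
    by simp
  moreover have "(\<lambda>p. indicator (ball (0::'a) \<delta>) (snd p) :: real) \<in> borel_measurable (borel :: ('a \<times> 'a) measure)"
    by (rule measurable_compose[OF measurable_snd_borel borel_measurable_indicator]) simp
  ultimately have "(\<lambda>p. indicator (ball 0 \<delta>) (snd p) * F (fst p) (snd p + fst p)) \<in> borel_measurable (lborel \<Otimes>\<^sub>M lborel)"
    unfolding lborel_prod by simp
  then have Jm: "?J \<in> borel_measurable lborel"
    using lborel.borel_measurable_lebesgue_integral[of "\<lambda>x h. indicator (ball 0 \<delta>) h * F x (h + x)" lborel]
    by (simp add: split_beta)
  have ind: "indicator ?D x * (indicator (?D \<inter> ball x \<delta>) y * F x y) = indicator (ball x \<delta>) y * F x y" for x y
    by (rule indicator_nonlocal_closure) (rule z)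
  have IJ: "indicator ?D x * ?I x = ?J x" for x
  proof -
    have "indicator ?D x * ?I x = (LINT y|lborel. indicator ?D x * (indicator (?D \<inter> ball x \<delta>) y * F x y))"
      using D by (simp add: integral_lebesgue_on_lborel)
    also have "\<dots> = (LINT y|lborel. indicator (ball x \<delta>) y * F x y)"
      by (simp only: ind)
    also have "\<dots> = (LINT h|lborel. indicator (ball x \<delta>) (h + x) * F x (h + x))"
      by (rule lborel_translate(2)[symmetric]) measurable
    also have "\<dots> = ?J x"
      by (simp add: indicator_def dist_norm)
    finally show ?thesis .
  qed
  have "(LINT x|lebesgue_on ?D. ?I x) = (LINT x|lebesgue. indicator ?D x * ?I x)"
    by (subst integral_restrict_space) auto
  also have "\<dots> = (LINT x|lebesgue. ?J x)"
    by (simp only: IJ)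
  also have "\<dots> = (LINT x|lborel. ?J x)"
    by (rule integral_completion[OF Jm])
  finally show "(LINT x|lebesgue_on ?D. ?I x) = (LINT x|lborel. ?J x)" .
  have "?J \<in> borel_measurable (lebesgue_on ?D)"
    using Jm by (intro borel_measurable_lebesgue_onI) simp
  moreover have "?J x = ?I x" if "x \<in> space (lebesgue_on ?D)" for x
    using IJ[of x] that by (simp add: space_restrict_space)
  ultimately show "?I \<in> borel_measurable (lebesgue_on ?D)"
    using measurable_cong[of "lebesgue_on ?D" ?J ?I borel] by blast
qed

lemma diffq_fractional_kernel:
  fixes v w :: "'a \<Rightarrow> real" and x h :: 'a
  assumes "s < 1"
  shows "diffq (fractional_kernel \<delta> s) v (x, h) * diffq (fractional_kernel \<delta> s) w (x, h) =
    kernel_scale DIM('a) \<delta> s * (indicator (ball 0 \<delta>) h * ((v x - v (h + x)) * (w x - w (h + x)) / norm (x - (h + x)) powr (real DIM('a) + 2 * s)))"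
proof -
  let ?\<rho> = "fractional_kernel \<delta> s :: 'a \<Rightarrow> real"
  have "0 \<le> ?\<rho> h"
    using kernel_nonneg[OF kernel_fractional_kernel[OF assms \<delta>]] .
  then have "diffq ?\<rho> v (x, h) * diffq ?\<rho> w (x, h) = ?\<rho> h * ((v (x + h) - v x) * (w (x + h) - w x))"
    by (simp add: diffq_def mult_ac)
  also have "(v (x + h) - v x) * (w (x + h) - w x) = (v x - v (h + x)) * (w x - w (h + x))"
    by (simp add: algebra_simps)
  also have "?\<rho> h * ((v x - v (h + x)) * (w x - w (h + x))) =
      kernel_scale DIM('a) \<delta> s * (indicator (ball 0 \<delta>) h * ((v x - v (h + x)) * (w x - w (h + x)) / norm (x - (h + x)) powr (real DIM('a) + 2 * s)))"
    by (simp add: fractional_kernel_def indicator_def)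
  finally show ?thesis .
qed

lemma nonlocal_form_eq:
  assumes s: "s < 1" and [measurable]: "v \<in> borel_measurable borel" "w \<in> borel_measurable borel"
    and z: "\<And>x. x \<notin> \<Omega> \<Longrightarrow> v x = 0" "\<And>x. x \<notin> \<Omega> \<Longrightarrow> w x = 0"
    and sq: "sq_int lborel (diffq (fractional_kernel \<delta> s) v)" "sq_int lborel (diffq (fractional_kernel \<delta> s) w)"
  shows "nonlocal_form \<delta> s \<Omega> v w = c_const DIM('a) s / 2 / kernel_scale DIM('a) \<delta> s * energy_form (fractional_kernel \<delta> s) v w"
proof -
  let ?F = "\<lambda>x y. (v x - v y) * (w x - w y) / norm (x - y) powr (real DIM('a) + 2 * s)"
  have "energy_form (fractional_kernel \<delta> s) v w = (LINT x|lborel. LINT h|lborel. kernel_scale DIM('a) \<delta> s * (indicator (ball 0 \<delta>) h * ?F x (h + x)))"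
    unfolding energy_form_def integral_lborel_fst[OF integrable_mult_sq_int[OF sq]] diffq_fractional_kernel[OF s] ..
  also have "\<dots> = kernel_scale DIM('a) \<delta> s * (LINT x|lborel. LINT h|lborel. indicator (ball 0 \<delta>) h * ?F x (h + x))"
    by (simp only: integral_mult_right_zero)
  also have "(LINT x|lborel. LINT h|lborel. indicator (ball 0 \<delta>) h * ?F x (h + x)) =
      (LINT x|lebesgue_on (nonlocal_closure \<delta> \<Omega>). LINT y|lebesgue_on (nonlocal_closure \<delta> \<Omega> \<inter> ball x \<delta>). ?F x y)"
    by (rule integral_nonlocal_closure(1)[symmetric]) (measurable, simp add: z)
  finally have "energy_form (fractional_kernel \<delta> s) v w = kernel_scale DIM('a) \<delta> s *
      (LINT x|lebesgue_on (nonlocal_closure \<delta> \<Omega>). LINT y|lebesgue_on (nonlocal_closure \<delta> \<Omega> \<inter> ball x \<delta>). ?F x y)" .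
  moreover have "kernel_scale DIM('a) \<delta> s \<noteq> 0"
    using kernel_scale_pos[OF s \<delta>, of "DIM('a)"] by simp
  ultimately show ?thesis
    unfolding nonlocal_form_def by simp
qed

text \<open>Stated in \<open>ennreal\<close> because it is to decide whether the energy is finite,
  before any integrability is known.\<close>

lemma nonlocal_energy_eq:
  assumes s: "s < 1" and [measurable]: "v \<in> borel_measurable borel" and z: "\<And>x. x \<notin> \<Omega> \<Longrightarrow> v x = 0"
  shows "(\<integral>\<^sup>+p. ennreal ((norm (diffq (fractional_kernel \<delta> s) v p))\<^sup>2) \<partial>lborel) =
    ennreal (kernel_scale DIM('a) \<delta> s) * nonlocal_energy \<delta> s \<Omega> v"
proof -
  let ?F = "\<lambda>x y. ennreal (\<bar>v x - v y\<bar>\<^sup>2 / norm (x - y) powr (real DIM('a) + 2 * s))"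
  have [measurable]: "(fractional_kernel \<delta> s :: 'a \<Rightarrow> real) \<in> borel_measurable borel"
    by (rule kernel_measurable[OF kernel_fractional_kernel[OF s \<delta>]])
  have c: "0 \<le> kernel_scale DIM('a) \<delta> s"
    using kernel_scale_pos[OF s \<delta>, of "DIM('a)"] by simp
  have pw: "ennreal ((norm (diffq (fractional_kernel \<delta> s) v (x, h)))\<^sup>2) =
      ennreal (kernel_scale DIM('a) \<delta> s) * (indicator (ball 0 \<delta>) h * ?F x (h + x))" for x h
  proof -
    define X where "X = \<bar>v x - v (h + x)\<bar>\<^sup>2 / norm (x - (h + x)) powr (real DIM('a) + 2 * s)"
    have "(norm (diffq (fractional_kernel \<delta> s) v (x, h)))\<^sup>2 = kernel_scale DIM('a) \<delta> s * (indicator (ball 0 \<delta>) h * X)"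
      unfolding X_def real_norm_def power2_abs
      by (simp only: power2_eq_square diffq_fractional_kernel[OF s, of v x h v])
    then show ?thesis
      unfolding X_def[symmetric] by (simp add: ennreal_mult' c indicator_def)
  qed
  have "(\<integral>\<^sup>+p. ennreal ((norm (diffq (fractional_kernel \<delta> s) v p))\<^sup>2) \<partial>lborel) =
      (\<integral>\<^sup>+x. \<integral>\<^sup>+h. ennreal (kernel_scale DIM('a) \<delta> s) * (indicator (ball 0 \<delta>) h * ?F x (h + x)) \<partial>lborel \<partial>lborel)"
    by (subst nn_integral_lborel_fst, measurable) (simp only: pw)
  also have "\<dots> = ennreal (kernel_scale DIM('a) \<delta> s) * (\<integral>\<^sup>+x. \<integral>\<^sup>+h. indicator (ball 0 \<delta>) h * ?F x (h + x) \<partial>lborel \<partial>lborel)"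
    by (simp add: nn_integral_cmult)
  also have "(\<integral>\<^sup>+x. \<integral>\<^sup>+h. indicator (ball 0 \<delta>) h * ?F x (h + x) \<partial>lborel \<partial>lborel) = nonlocal_energy \<delta> s \<Omega> v"
    unfolding nonlocal_energy_def
    by (rule nn_integral_nonlocal_closure[symmetric]) (measurable, simp add: z)
  finally show ?thesis .
qed

lemma nonlocal_energy_finite_iff:
  assumes s: "s < 1" and v: "v \<in> borel_measurable borel" "\<And>x. x \<notin> \<Omega> \<Longrightarrow> v x = 0"
  shows "nonlocal_energy \<delta> s \<Omega> v < \<infinity> \<longleftrightarrow> sq_int lborel (diffq (fractional_kernel \<delta> s) v)"
proof -
  have [measurable]: "v \<in> borel_measurable borel" "(fractional_kernel \<delta> s :: 'a \<Rightarrow> real) \<in> borel_measurable borel"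
    using v(1) kernel_measurable[OF kernel_fractional_kernel[OF s \<delta>]] by auto
  have "sq_int lborel (diffq (fractional_kernel \<delta> s) v) \<longleftrightarrow>
      (\<integral>\<^sup>+p. ennreal ((norm (diffq (fractional_kernel \<delta> s) v p))\<^sup>2) \<partial>lborel) < \<infinity>"
    by (auto simp: sq_int_def integrable_iff_bounded)
  also have "\<dots> \<longleftrightarrow> ennreal (kernel_scale DIM('a) \<delta> s) * nonlocal_energy \<delta> s \<Omega> v < \<infinity>"
    by (subst nonlocal_energy_eq[OF s v(1)]) (simp_all add: v(2))
  also have "\<dots> \<longleftrightarrow> nonlocal_energy \<delta> s \<Omega> v < \<infinity>"
    using kernel_scale_pos[OF s \<delta>, of "DIM('a)"] by (auto simp: ennreal_mult_less_top)
  finally show ?thesis by simp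
qed

lemma nonlocal_H0_I:
  assumes s: "s < 1" and v: "sq_int lborel v" "\<And>x. x \<notin> \<Omega> \<Longrightarrow> v x = 0"
    and dv: "sq_int lborel (diffq (fractional_kernel \<delta> s) v)"
  shows "v \<in> nonlocal_H0 \<delta> s \<Omega>"
proof -
  have m: "v \<in> borel_measurable borel"
    using v(1) by (simp add: sq_int_def)
  have "\<Omega> \<subseteq> nonlocal_closure \<delta> \<Omega>"
    by (auto simp: nonlocal_closure_def)
  then have "L2 (nonlocal_closure \<delta> \<Omega>) v"
    unfolding L2_iff_sq_int using v by (subst sq_int_lebesgue_on_support[OF m open_nonlocal_closure]) auto
  moreover have "AE x in lebesgue_on (nonlocal_boundary \<delta> \<Omega>). v x = 0"
    by (rule AE_I2) (simp add: space_restrict_space nonlocal_boundary_def v(2))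
  ultimately show ?thesis
    using nonlocal_energy_finite_iff[OF s m v(2)] dv by (simp add: nonlocal_H0_def)
qed

text \<open>A Borel version of \<open>u\<close> is multiplied by the indicator of \<Omega>; this
  differs from \<open>u\<close> only on a null set, as \<open>u\<close> vanishes almost everywhere
  on the nonlocal boundary. The energy is unchanged because the integrand agrees for almost every
  \<open>x\<close> and then for almost every \<open>y\<close>.\<close>

lemma nonlocal_H0_representative:
  assumes s: "s < 1" and u: "u \<in> nonlocal_H0 \<delta> s \<Omega>"
  obtains v where "sq_int lborel v" "\<And>x. x \<notin> \<Omega> \<Longrightarrow> v x = 0" "sq_int lborel (diffq (fractional_kernel \<delta> s) v)"
    "AE x in lebesgue_on (nonlocal_closure \<delta> \<Omega>). u x = v x"
proof -
  let ?D = "nonlocal_closure \<delta> \<Omega>" and ?B = "nonlocal_boundary \<delta> \<Omega>"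
  have D: "?D \<in> sets borel" and O: "\<Omega> \<in> sets borel"
    using open_nonlocal_closure \<Omega> by auto
  have "?B = ?D - \<Omega>"
    by (auto simp: nonlocal_closure_def nonlocal_boundary_def)
  then have B: "?B \<in> sets borel"
    using D O by simp
  have Dl[simp]: "?D \<in> sets lebesgue" "?B \<in> sets lebesgue" "?D \<inter> ball x \<delta> \<in> sets lebesgue" for x
    using D B by (auto intro!: sets_completionI_sets)
  have su: "sq_int (lebesgue_on ?D) u" and u0: "AE x in lebesgue_on ?B. u x = 0" and eu: "nonlocal_energy \<delta> s \<Omega> u < \<infinity>"
    using u by (auto simp: nonlocal_H0_def L2_iff_sq_int)
  obtain g where g: "sq_int lborel g" "\<And>x. x \<notin> ?D \<Longrightarrow> g x = 0" "AE x in lebesgue_on ?D. u x = g x"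
    using borel_representative[OF su open_nonlocal_closure] by metis
  have gm: "g \<in> borel_measurable borel" using g(1) by (simp add: sq_int_def)
  define v where "v x = indicator \<Omega> x * g x" for x
  have vm: "v \<in> borel_measurable borel"
    unfolding v_def[abs_def] using gm O by (intro borel_measurable_times borel_measurable_indicator) auto
  have z: "\<And>x. x \<notin> \<Omega> \<Longrightarrow> v x = 0" by (simp add: v_def)
  have "AE x in lebesgue. x \<in> ?D \<longrightarrow> u x = g x" "AE x in lebesgue. x \<in> ?B \<longrightarrow> u x = 0"
    using g(3) u0 by (simp_all add: AE_restrict_space_iff)
  then have ae: "AE x in lebesgue. x \<in> ?D \<longrightarrow> u x = v x"
    by eventually_elim (auto simp: v_def indicator_def nonlocal_closure_def)
  then have aeD: "AE x in lebesgue_on ?D. u x = v x"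
    by (simp add: AE_restrict_space_iff)
  have aeDx: "AE y in lebesgue_on (?D \<inter> ball x \<delta>). u y = v y" for x
  proof -
    have "AE y in lebesgue. y \<in> ?D \<inter> ball x \<delta> \<longrightarrow> u y = v y"
      using ae by eventually_elim simp
    then show ?thesis
      by (simp add: AE_restrict_space_iff)
  qed
  have sv: "sq_int lborel v"
  proof (rule sq_int_bound[OF _ ])
    show "integrable lborel (\<lambda>x. (norm (g x))\<^sup>2)" using g(1) by (simp add: sq_int_def)
  qed (use vm in \<open>auto simp: v_def indicator_def\<close>)
  have "nonlocal_energy \<delta> s \<Omega> v = nonlocal_energy \<delta> s \<Omega> u"
    unfolding nonlocal_energy_def
  proof (rule nn_integral_cong_AE)
    show "AE x in lebesgue_on ?D.
        (\<integral>\<^sup>+y. ennreal (\<bar>v x - v y\<bar>\<^sup>2 / norm (x - y) powr (real DIM('a) + 2 * s)) \<partial>lebesgue_on (?D \<inter> ball x \<delta>)) =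
        (\<integral>\<^sup>+y. ennreal (\<bar>u x - u y\<bar>\<^sup>2 / norm (x - y) powr (real DIM('a) + 2 * s)) \<partial>lebesgue_on (?D \<inter> ball x \<delta>))"
      using aeD
    proof eventually_elim
      case (elim x)
      show ?case
      proof (rule nn_integral_cong_AE)
        show "AE y in lebesgue_on (?D \<inter> ball x \<delta>).
            ennreal (\<bar>v x - v y\<bar>\<^sup>2 / norm (x - y) powr (real DIM('a) + 2 * s)) =
            ennreal (\<bar>u x - u y\<bar>\<^sup>2 / norm (x - y) powr (real DIM('a) + 2 * s))"
          using aeDx[of x] by eventually_elim (simp add: elim)
      qed
    qed
  qed
  then have "sq_int lborel (diffq (fractional_kernel \<delta> s) v)"
    using nonlocal_energy_finite_iff[OF s vm z] eu by simp
  then show ?thesis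
    using that[of v] sv z aeD by blast
qed

lemma nonlocal_form_cong_AE:
  assumes u: "u \<in> borel_measurable (lebesgue_on (nonlocal_closure \<delta> \<Omega>))"
    and ae: "AE x in lebesgue_on (nonlocal_closure \<delta> \<Omega>). u x = v x"
    and v: "v \<in> borel_measurable borel" "\<And>x. x \<notin> \<Omega> \<Longrightarrow> v x = 0"
    and w: "w \<in> borel_measurable borel" "\<And>x. x \<notin> \<Omega> \<Longrightarrow> w x = 0"
  shows "nonlocal_form \<delta> s \<Omega> u w = nonlocal_form \<delta> s \<Omega> v w"
proof -
  let ?D = "nonlocal_closure \<delta> \<Omega>"
  let ?I = "\<lambda>u x. LINT y|lebesgue_on (?D \<inter> ball x \<delta>). (u x - u y) * (w x - w y) / norm (x - y) powr (real DIM('a) + 2 * s)"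
  have Dl[simp]: "?D \<in> sets lebesgue" "?D \<inter> ball x \<delta> \<in> sets lebesgue" for x
    using open_nonlocal_closure by (auto intro!: sets_completionI_sets)
  have [measurable]: "v \<in> borel_measurable borel" "w \<in> borel_measurable borel"
    using v w by auto
  have aeDx: "AE y in lebesgue_on (?D \<inter> ball x \<delta>). u y = v y" for x
  proof -
    have "AE y in lebesgue. y \<in> ?D \<longrightarrow> u y = v y"
      using ae by (simp add: AE_restrict_space_iff)
    then have "AE y in lebesgue. y \<in> ?D \<inter> ball x \<delta> \<longrightarrow> u y = v y"
      by eventually_elim simp
    then show ?thesis
      by (simp add: AE_restrict_space_iff)
  qed
  have I: "AE x in lebesgue_on ?D. ?I v x = ?I u x"
    using ae
  proof eventually_elim
    case (elim x)
    have "u \<in> borel_measurable (lebesgue_on (?D \<inter> ball x \<delta>))"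
      by (rule measurable_restrict_mono[OF u]) auto
    moreover have "(\<lambda>y. w y) \<in> borel_measurable (lebesgue_on (?D \<inter> ball x \<delta>))"
        "(\<lambda>y. v y) \<in> borel_measurable (lebesgue_on (?D \<inter> ball x \<delta>))"
        "(\<lambda>y. norm (x - y) powr (real DIM('a) + 2 * s)) \<in> borel_measurable (lebesgue_on (?D \<inter> ball x \<delta>))"
      by (rule borel_measurable_lebesgue_onI, measurable)+
    moreover have "AE y in lebesgue_on (?D \<inter> ball x \<delta>).
        (v x - v y) * (w x - w y) / norm (x - y) powr (real DIM('a) + 2 * s) =
        (u x - u y) * (w x - w y) / norm (x - y) powr (real DIM('a) + 2 * s)"
      using aeDx[of x] by eventually_elim (simp add: elim)
    ultimately show ?case
      by (intro integral_cong_AE borel_measurable_divide borel_measurable_times borel_measurable_diff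
          borel_measurable_const)
  qed
  have Fm: "(\<lambda>p. (v (fst p) - v (snd p)) * (w (fst p) - w (snd p)) / norm (fst p - snd p) powr (real DIM('a) + 2 * s)) \<in> borel_measurable borel"
    by measurable
  have vm: "?I v \<in> borel_measurable (lebesgue_on ?D)"
    by (rule integral_nonlocal_closure(2)) (use Fm in \<open>simp_all add: v w\<close>)
  \<comment> \<open>The inner integrals of \<open>u\<close> and \<open>v\<close> agree almost
    everywhere, and completeness of Lebesgue measure carries measurability over from
    \<open>v\<close>.\<close>
  have um: "?I u \<in> borel_measurable (lebesgue_on ?D)"
  proof -
    have 1: "(\<lambda>x. if x \<in> ?D then ?I v x else 0) \<in> borel_measurable lebesgue"
      by (rule borel_measurable_if_I[OF vm Dl(1)])
    have "AE x in lebesgue. (if x \<in> ?D then ?I v x else 0) = (if x \<in> ?D then ?I u x else 0)"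
    proof -
      have "AE x in lebesgue. x \<in> ?D \<longrightarrow> ?I v x = ?I u x"
        using I by (simp add: AE_restrict_space_iff)
      then show ?thesis
        by eventually_elim auto
    qed
    from borel_measurable_AE[OF 1 this] show ?thesis
      by (rule borel_measurable_if_D)
  qed
  have "(LINT x|lebesgue_on ?D. ?I u x) = (LINT x|lebesgue_on ?D. ?I v x)"
    by (rule integral_cong_AE[OF vm um I, symmetric])
  then show ?thesis
    unfolding nonlocal_form_def by simp
qed

end

section \<open>Cancellation of the constants\<close>

text \<open>The surface measure in \<open>kappa_const\<close> is \<open>DIM('a)\<close> times the
  volume of the unit ball; hence the factor in front of \<open>f\<close> equals the factor between
  \<open>nonlocal_form\<close> and the normalized energy.\<close>

lemma constants_eq:
  assumes s: "0 < s" "s < 1" and \<delta>: "0 < \<delta>"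
  shows "\<delta> powr (2 * (1 - s)) / kappa_const TYPE('a::euclidean_space) s =
    c_const DIM('a) s / 2 / kernel_scale DIM('a) \<delta> s"
    and "c_const DIM('a) s > 0"
proof -
  have N: "0 < real DIM('a)" by simp
  have "0 < Gamma (real DIM('a) / 2 + s)" "0 < Gamma (1 - s)"
    using s N by (intro Gamma_real_pos; linarith)+
  then show c: "c_const DIM('a) s > 0"
    unfolding c_const_def using s by (intro divide_pos_pos mult_pos_pos) auto
  have V: "0 < unit_ball_vol (real DIM('a))" by simp
  have G: "Gamma (real DIM('a) / 2 + 1) = real DIM('a) / 2 * Gamma (real DIM('a) / 2)"
    using N by (intro Gamma_plus1) (auto dest: nonpos_Ints_nonpos)
  have \<sigma>: "sphere_surface_measure (sphere (0::'a) 1) = real DIM('a) * unit_ball_vol (real DIM('a))"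
    unfolding sphere_surface_measure_sphere unit_ball_vol_def G by simp
  have cancel: "P / (4 * N * (1 - s) / (N * V * c)) = c / 2 / ((2 - 2 * s) / (V * P))"
    if "0 < N" "0 < V" "0 < c" "0 < P" for N V c P :: real
    using that s by (simp add: field_simps)
  have "2 * (1 - s) = 2 - 2 * s" by simp
  then show "\<delta> powr (2 * (1 - s)) / kappa_const TYPE('a) s =
    c_const DIM('a) s / 2 / kernel_scale DIM('a) \<delta> s"
    unfolding kappa_const_def \<sigma> kernel_scale_def using cancel[OF N V c, of "\<delta> powr (2 - 2 * s)"] \<delta> by simp
qed

text \<open>After passing to representatives, both sides of the weak formulation carry the same
  nonzero factor \<open>?k\<close>; cancelling it leaves the equation for the normalized
  kernel.\<close>

lemma nonlocal_weak_solution_representative: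
  fixes \<Omega> :: "'a::euclidean_space set"
  assumes s: "0 < s" "s < 1" and \<Omega>: "open \<Omega>" and \<delta>: "0 < \<delta>"
    and fb: "sq_int lborel fb" "\<And>x. x \<notin> \<Omega> \<Longrightarrow> fb x = 0" "AE x in lebesgue_on \<Omega>. f x = fb x"
    and f: "f \<in> borel_measurable (lebesgue_on \<Omega>)"
    and u: "nonlocal_weak_solution \<delta> s \<Omega> (\<lambda>x. \<delta> powr (2 * (1 - s)) / kappa_const TYPE('a) s * f x) u"
  obtains v where "sq_int lborel v" "\<And>x. x \<notin> \<Omega> \<Longrightarrow> v x = 0"
    "sq_int lborel (diffq (fractional_kernel \<delta> s) v)" "AE x in lebesgue_on \<Omega>. u x = v x"
    "\<And>w. sq_int lborel w \<Longrightarrow> (\<And>x. x \<notin> \<Omega> \<Longrightarrow> w x = 0) \<Longrightarrow> sq_int lborel (diffq (fractional_kernel \<delta> s) w) \<Longrightarrow>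
      energy_form (fractional_kernel \<delta> s) v w = (LINT x|lborel. fb x * w x)"
proof -
  let ?D = "nonlocal_closure \<delta> \<Omega>" and ?k = "\<delta> powr (2 * (1 - s)) / kappa_const TYPE('a) s"
  have H0: "u \<in> nonlocal_H0 \<delta> s \<Omega>" and eq: "\<And>w. w \<in> nonlocal_H0 \<delta> s \<Omega> \<Longrightarrow>
      nonlocal_form \<delta> s \<Omega> u w = (LINT x|lebesgue_on \<Omega>. ?k * f x * w x)"
    using u by (auto simp: nonlocal_weak_solution_def)
  have um: "u \<in> borel_measurable (lebesgue_on ?D)"
    using H0 by (simp add: nonlocal_H0_def L2_def)
  obtain v where v: "sq_int lborel v" "\<And>x. x \<notin> \<Omega> \<Longrightarrow> v x = 0"
    "sq_int lborel (diffq (fractional_kernel \<delta> s) v)" "AE x in lebesgue_on ?D. u x = v x"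
    using nonlocal_H0_representative[OF \<Omega> \<delta> s(2) H0] by metis
  have vm: "v \<in> borel_measurable borel" and fbm: "fb \<in> borel_measurable borel"
    using v(1) fb(1) by (simp_all add: sq_int_def)
  have Dl: "?D \<in> sets lebesgue" "\<Omega> \<in> sets lebesgue"
    using open_nonlocal_closure[OF \<Omega> \<delta>] \<Omega> by (auto intro!: sets_completionI_sets)
  have ae: "AE x in lebesgue_on \<Omega>. u x = v x"
  proof -
    have "AE x in lebesgue. x \<in> ?D \<longrightarrow> u x = v x"
      using v(4) Dl by (simp add: AE_restrict_space_iff)
    then have "AE x in lebesgue. x \<in> \<Omega> \<longrightarrow> u x = v x"
      by eventually_elim (simp add: nonlocal_closure_def)
    then show ?thesis
      using Dl by (simp add: AE_restrict_space_iff)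
  qed
  show ?thesis
  proof (rule that[OF v(1,2,3) ae])
    fix w assume w: "sq_int lborel w" "\<And>x. x \<notin> \<Omega> \<Longrightarrow> w x = 0" "sq_int lborel (diffq (fractional_kernel \<delta> s) w)"
    have wm: "w \<in> borel_measurable borel"
      using w(1) by (simp add: sq_int_def)
    have wml: "w \<in> borel_measurable (lebesgue_on \<Omega>)" and fbml: "fb \<in> borel_measurable (lebesgue_on \<Omega>)"
      by (rule borel_measurable_lebesgue_onI, fact)+
    have "?k * energy_form (fractional_kernel \<delta> s) v w = nonlocal_form \<delta> s \<Omega> v w"
      unfolding constants_eq(1)[OF s \<delta>] by (rule nonlocal_form_eq[OF \<Omega> \<delta> s(2) vm wm v(2) w(2) v(3) w(3), symmetric])
    also have "\<dots> = nonlocal_form \<delta> s \<Omega> u w"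
      by (rule nonlocal_form_cong_AE[OF \<Omega> \<delta> um v(4) vm v(2) wm w(2), symmetric])
    also have "\<dots> = (LINT x|lebesgue_on \<Omega>. ?k * f x * w x)"
      by (intro eq nonlocal_H0_I[OF \<Omega> \<delta> s(2)] w)
    also have "\<dots> = (LINT x|lebesgue_on \<Omega>. ?k * (fb x * w x))"
    proof (intro integral_cong_AE borel_measurable_times borel_measurable_const f wml fbml)
      show "AE x in lebesgue_on \<Omega>. ?k * f x * w x = ?k * (fb x * w x)"
        using fb(3) by eventually_elim simp
    qed
    also have "\<dots> = ?k * (LINT x|lborel. fb x * w x)"
      using integral_lebesgue_on_support[OF borel_measurable_times[OF fbm wm] \<Omega>] w(2) by simp
    finally have "?k * energy_form (fractional_kernel \<delta> s) v w = ?k * (LINT x|lborel. fb x * w x)" .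
    moreover have "?k \<noteq> 0"
      unfolding constants_eq(1)[OF s \<delta>] using constants_eq(2)[OF s \<delta>, where 'a = 'a] kernel_scale_pos[OF s(2) \<delta>, of "DIM('a)"] by simp
    ultimately show "energy_form (fractional_kernel \<delta> s) v w = (LINT x|lborel. fb x * w x)"
      by simp
  qed
qed

theorem theorem2:
  fixes \<Omega> :: "'a::euclidean_space set"
    and s :: real
    and f :: "'a \<Rightarrow> real"
    and u :: "real \<Rightarrow> 'a \<Rightarrow> real"
    and u0 :: "'a \<Rightarrow> real"
  assumes "0 < s" and "s < 1"
    and "bounded_lipschitz_domain \<Omega>"
    and "L2 \<Omega> f"
    and "\<And>\<delta>. \<delta> > 0 \<Longrightarrow>
           nonlocal_weak_solution \<delta> s \<Omega>
             (\<lambda>x. \<delta> powr (2 * (1 - s)) / kappa_const TYPE('a) s * f x) (u \<delta>)"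
    and "local_weak_solution \<Omega> f u0"
  shows "\<forall>d :: nat \<Rightarrow> real. (\<forall>j. d j > 0) \<and> d \<longlonglongrightarrow> 0 \<longrightarrow>
           (\<exists>r. strict_mono r \<and>
              (\<lambda>j. L2_norm \<Omega> (\<lambda>x. u (d (r j)) x - u0 x)) \<longlonglongrightarrow> 0)"
proof (intro allI impI)
  fix d :: "nat \<Rightarrow> real"
  assume d: "(\<forall>j. d j > 0) \<and> d \<longlonglongrightarrow> 0"
  have dom: "open \<Omega>" "bounded \<Omega>" "lipschitz_boundary \<Omega>"
    using assms(3) by (auto simp: bounded_lipschitz_domain_def)
  have sf: "sq_int (lebesgue_on \<Omega>) f"
    using assms(4) by (simp add: L2_iff_sq_int)
  then have fm: "f \<in> borel_measurable (lebesgue_on \<Omega>)"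
    by (simp add: sq_int_def)
  obtain fb where fb: "sq_int lborel fb" "\<And>x. x \<notin> \<Omega> \<Longrightarrow> fb x = 0" "AE x in lebesgue_on \<Omega>. f x = fb x"
    using borel_representative[OF sf dom(1)] by metis
  have fbm: "fb \<in> borel_measurable borel"
    using fb(1) by (simp add: sq_int_def)
  have "u0 \<in> H10 \<Omega>"
    using assms(6) by (simp add: local_weak_solution_def)
  then obtain G \<phi> where G: "weak_gradient \<Omega> u0 G" and \<phi>: "\<And>n. test_function \<Omega> (\<phi> n)"
    "(\<lambda>n::nat. L2_norm \<Omega> (\<lambda>x. \<phi> n x - u0 x)) \<longlonglongrightarrow> 0"
    "(\<lambda>n. L2_norm \<Omega> (\<lambda>x. gradient (\<phi> n) x - G x)) \<longlonglongrightarrow> 0"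
    unfolding H10_def by blast
  have su0: "sq_int (lebesgue_on \<Omega>) u0" and sG: "sq_int (lebesgue_on \<Omega>) G"
    using G by (simp_all add: weak_gradient_def L2_iff_sq_int)
  \<comment> \<open>The estimates enlarge supports by 1 and so need horizons at most 1; from index
    \<open>J\<close> on the sequence is that small.\<close>
  obtain J where J: "\<And>j. J \<le> j \<Longrightarrow> d j < 1"
    using order_tendstoD(2)[of d 0 sequentially 1] d by (auto simp: eventually_sequentially)
  define d' where "d' j = d (j + J)" for j
  have d': "\<And>j. 0 < d' j" "\<And>j. d' j \<le> 1" "d' \<longlonglongrightarrow> 0"
    using d less_imp_le[OF J[OF le_add2]] by (simp_all add: d'_def[abs_def] LIMSEQ_ignore_initial_segment)
  define \<rho> :: "nat \<Rightarrow> 'a \<Rightarrow> real" where "\<rho> j = fractional_kernel (d' j) s" for j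
  \<comment> \<open>All properties of one representative are packed into a single predicate, so that
    the axiom of choice yields a whole sequence of representatives.\<close>
  let ?P = "\<lambda>j v. sq_int lborel v \<and> (\<forall>x. x \<notin> \<Omega> \<longrightarrow> v x = 0) \<and> sq_int lborel (diffq (\<rho> j) v) \<and>
      (AE x in lebesgue_on \<Omega>. u (d' j) x = v x) \<and>
      (\<forall>w. sq_int lborel w \<longrightarrow> (\<forall>x. x \<notin> \<Omega> \<longrightarrow> w x = 0) \<longrightarrow> sq_int lborel (diffq (\<rho> j) w) \<longrightarrow>
         energy_form (\<rho> j) v w = (LINT x|lborel. fb x * w x))"
  have "\<exists>v. ?P j v" for j
  proof (rule nonlocal_weak_solution_representative[OF assms(1,2) dom(1) d'(1) fb(1) _ fb(3) fm assms(5)[OF d'(1)]])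
    fix v
    assume "sq_int lborel v" "\<And>x. x \<notin> \<Omega> \<Longrightarrow> v x = 0" "sq_int lborel (diffq (fractional_kernel (d' j) s) v)"
      "AE x in lebesgue_on \<Omega>. u (d' j) x = v x"
      "\<And>w. sq_int lborel w \<Longrightarrow> (\<And>x. x \<notin> \<Omega> \<Longrightarrow> w x = 0) \<Longrightarrow> sq_int lborel (diffq (fractional_kernel (d' j) s) w) \<Longrightarrow>
        energy_form (fractional_kernel (d' j) s) v w = (LINT x|lborel. fb x * w x)"
    then show ?thesis
      unfolding \<rho>_def by (intro exI[of _ v]) simp
  qed (rule fb(2))
  then obtain v where V: "\<And>j. ?P j (v j)"
    using choice[of ?P] by blast
  have v: "sq_int lborel (v j)" "x \<notin> \<Omega> \<Longrightarrow> v j x = 0" "sq_int lborel (diffq (\<rho> j) (v j))"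
    "AE x in lebesgue_on \<Omega>. u (d' j) x = v j x" for j x
    using V[of j] by simp_all
  have v_eq: "energy_form (\<rho> j) (v j) w = (LINT x|lborel. fb x * w x)"
    if "sq_int lborel w" "\<And>x. x \<notin> \<Omega> \<Longrightarrow> w x = 0" "sq_int lborel (diffq (\<rho> j) w)" for j w
    using V[of j] that by simp
  have k: "kernel (\<rho> j) (d' j)" for j
    unfolding \<rho>_def by (rule kernel_fractional_kernel[OF assms(2) d'(1)])
  have G_eq: "(LINT x|lebesgue_on \<Omega>. G x \<bullet> gradient \<psi> x) = (LINT x|lborel. fb x * \<psi> x)"
    if \<psi>: "test_function \<Omega> \<psi>" for \<psi>
  proof -
    have m: "\<psi> \<in> borel_measurable borel"
      by (rule test_function_measurable[OF \<psi>])
    have "(LINT x|lebesgue_on \<Omega>. G x \<bullet> gradient \<psi> x) = (LINT x|lebesgue_on \<Omega>. f x * \<psi> x)"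
      by (rule local_weak_solution_test[OF dom(1) assms(6) G \<psi>])
    also have "\<dots> = (LINT x|lebesgue_on \<Omega>. fb x * \<psi> x)"
    proof (intro integral_cong_AE borel_measurable_times fm borel_measurable_lebesgue_onI m fbm)
      show "AE x in lebesgue_on \<Omega>. f x * \<psi> x = fb x * \<psi> x"
        using fb(3) by eventually_elim simp
    qed
    also have "\<dots> = (LINT x|lborel. fb x * \<psi> x)"
      using fb(2) by (intro integral_lebesgue_on_support dom(1) borel_measurable_times fbm m) simp
    finally show ?thesis .
  qed
  interpret vanishing_horizon \<Omega> fb G \<rho> d'
    by unfold_locales (fact dom(1) dom(2) fb(1) sG G_eq k d')+
  have "(\<lambda>j. nrm (lebesgue_on \<Omega>) (\<lambda>x. v j x - u0 x)) \<longlonglongrightarrow> 0"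
  proof (rule solutions_converge[OF dom(3) v(1,3) _ _ _ su0 \<phi>(1)])
    show "x \<in> \<Omega>" if "v j x \<noteq> 0" for j x
      using v(2) that by blast
    show "energy_form (\<rho> j) (v j) (v j) = (LINT x|lborel. fb x * v j x)" for j
      by (intro v_eq v)
    show "energy_form (\<rho> j) (v j) \<psi> = (LINT x|lborel. fb x * \<psi> x)" if "test_function \<Omega> \<psi>" for j \<psi>
      using that by (intro v_eq test_function_sq_int test_function_eq_0 test_function_diffq_sq_int[OF k d'(2)])
  qed (use \<phi> in \<open>simp_all add: L2_norm_eq_nrm\<close>)
  moreover have "L2_norm \<Omega> (\<lambda>x. u (d' j) x - u0 x) = nrm (lebesgue_on \<Omega>) (\<lambda>x. v j x - u0 x)" for j
  proof -
    have "u (d' j) \<in> borel_measurable (lebesgue_on (nonlocal_closure (d' j) \<Omega>))"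
      using assms(5)[OF d'(1)] by (simp add: nonlocal_weak_solution_def nonlocal_H0_def L2_def)
    then have "u (d' j) \<in> borel_measurable (lebesgue_on \<Omega>)"
      by (rule measurable_restrict_mono) (auto simp: nonlocal_closure_def)
    moreover have "v j \<in> borel_measurable (lebesgue_on \<Omega>)"
      using v(1)[of j] by (intro borel_measurable_lebesgue_onI) (simp add: sq_int_def)
    moreover have "u0 \<in> borel_measurable (lebesgue_on \<Omega>)"
      using su0 by (simp add: sq_int_def)
    moreover have "AE x in lebesgue_on \<Omega>. u (d' j) x - u0 x = v j x - u0 x"
      using v(4)[of j] by eventually_elim simp
    ultimately show ?thesis
      unfolding L2_norm_eq_nrm by (intro nrm_cong_AE borel_measurable_diff)
  qed
  ultimately have "(\<lambda>j. L2_norm \<Omega> (\<lambda>x. u (d (j + J)) x - u0 x)) \<longlonglongrightarrow> 0"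
    by (simp add: d'_def)
  \<comment> \<open>The subsequence is a tail: only the finitely many horizons before index
    \<open>J\<close> are skipped.\<close>
  then show "\<exists>r. strict_mono r \<and> (\<lambda>j. L2_norm \<Omega> (\<lambda>x. u (d (r j)) x - u0 x)) \<longlonglongrightarrow> 0"
    by (intro exI[of _ "\<lambda>j. j + J"]) (simp add: strict_mono_def)
qed

end
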